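(* Let $(P,\theta,\nabla,h)$ be a $G$-invariant exact symplectic Hamiltonian system with respect to an exact symplectic Lie group action $\Phi\colon G\times P\to P$, with exact symplectic momentum map $\mathbf{J}^\Phi_\theta\colon P\to\mathfrak{g}^*$. Let $c\in\mathbb{R}$ be a regular value of $h$ such that $\nabla\pitchfork h^{-1}(c)$, let $i\colon S:=h^{-1}(c)\hookrightarrow P$ be the natural embedding, and let $(S,\eta:=i^*\theta)$ be the corresponding energy hypersurface, equipped with the induced contact Lie group action $\Phi^S\colon G\times S\to S$ and the induced contact momentum map $\mathbf{J}^{\Phi^S}_\eta\colon S\to\mathfrak{g}^*$. Let $\mu\in\mathfrak{g}^*$ be a regular value of both $\mathbf{J}^\Phi_\theta$ and $\mathbf{J}^{\Phi^S}_\eta$. Assume that $\Phi$ is quotientable on $(\mathbf{J}^\Phi_\theta)^{-1}(\mathbb{R}^\times\mu)$ by $K_{[\mu]}$ and that $\Phi^S$ is quotientable on $(\mathbf{J}^{\Phi^S}_\eta)^{-1}(\mathbb{R}^\times\mu)$ by $K_{[\mu]}$. Let $(P_{[\mu]},\theta_{[\mu]},\nabla_{[\mu]},h_{[\mu]})$ be the reduced exact symplectic Hamiltonian system, where $P_{[\mu]}=(\mathbf{J}^\Phi_\theta)^{-1}(\mathbb{R}^\times\mu)/K_{[\mu]}$, let $\jmath\colon S_{[\mu]}:=h_{[\mu]}^{-1}(c)\hookrightarrow P_{[\mu]}$ be the natural embedding, let $M_{[\mu]}:=(\mathbf{J}^{\Phi^S}_\eta)^{-1}(\mathbb{R}^\times\mu)/K_{[\mu]}$,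 and let $i_{M_{[\mu]}}\colon M_{[\mu]}\hookrightarrow P_{[\mu]}$ be the embedding induced on orbit spaces by the restriction of $i$ to a map $(\mathbf{J}^{\Phi^S}_\eta)^{-1}(\mathbb{R}^\times\mu)\hookrightarrow(\mathbf{J}^\Phi_\theta)^{-1}(\mathbb{R}^\times\mu)$. Let $\kappa\colon S_{[\mu]}\to M_{[\mu]}$ be the map defined by $i_{M_{[\mu]}}\circ\kappa=\jmath$. Then $\kappa$ is a diffeomorphism.
   Context: All structures are smooth and real; manifolds are Hausdorff, paracompact and finite-dimensional, and $P$ and $G$ are connected (connectedness is not required of level sets and their quotients). $G$ is a Lie group with Lie algebra $\mathfrak{g}$, and $\langle\cdot,\cdot\rangle$ is the pairing of $\mathfrak{g}^*$ and $\mathfrak{g}$. An exact symplectic manifold $(P,\theta)$ is a manifold $P$ with $\theta\in\Omega^1(P)$ such that $\omega=-\mathrm{d}\theta$ is symplectic. Its Liouville vector field $\nabla$ is the unique vector field with $\iota_\nabla\omega=\theta$. An exact symplectic Hamiltonian system $(P,\theta,\nabla,h)$ is such a triple $(P,\theta,\nabla)$ together with $h\in C^\infty(P)$; it is $G$-invariant if $h\circ\Phi_g=h$ for all $g\in G$. A Lie group action $\Phi\colon G\times P\to P$ is exact symplectic if $\Phi_g^*\theta=\theta$ for all $g\in G$. The fundamental vector field of $\xi\in\mathfrak{g}$ is $\xi_P(p)=\frac{\mathrm{d}}{\mathrm{d}t}|_{t=0}\Phi(\exp(t\xi),p)$. The exact symplectic momentum map $\mathbf{J}^\Phi_\theta\colon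 P\to\mathfrak{g}^*$ is given by $\iota_{\xi_P}\theta=\langle\mathbf{J}^\Phi_\theta,\xi\rangle$ for all $\xi\in\mathfrak{g}$. A co-orientable contact manifold $(S,\eta)$ is a $(2n-1)$-dimensional manifold with a one-form $\eta$ such that $\eta\wedge(\mathrm{d}\eta)^{n-1}$ is a volume form. A contact Lie group action $\Phi^S$ satisfies $(\Phi^S_g)^*\eta=\eta$ for all $g\in G$; its contact momentum map is given by $\iota_{\xi_S}\eta=\langle\mathbf{J}^{\Phi^S}_\eta,\xi\rangle$ for all $\xi\in\mathfrak{g}$. A vector field $Y$ on $M$ is transverse to a submanifold $N\subset M$, written $Y\pitchfork N$, if $\langle Y_x\rangle+\mathrm{T}_xN=\mathrm{T}_xM$ for all $x\in N$. If $c$ is a regular value of $h$ and $\nabla\pitchfork h^{-1}(c)$, then $(h^{-1}(c),i^*\theta)$ is a contact manifold, called an energy hypersurface of $(P,\theta,\nabla,h)$. The induced action and momentum map on $S$ are determined by $\Phi_g\circ i=i\circ\Phi^S_g$ for all $g\in G$ and $\mathbf{J}^{\Phi^S}_\eta=\mathbf{J}^\Phi_\theta\circ i$. Write $\mathbb{R}^\times=\mathbb{R}\setminus\{0\}$ and $\mathbb{R}^\times\mu=\{\lambda\mu\mid\lambda\in\mathbb{R}^\times\}$. For a momentum map $\mathbf{J}$ with regular value $\mu$, $\mathbf{J}^{-1}(\mathbb{R}^\times\mu)$ is regarded as a submanifold. Put $\ker\mu=\{\xi\in\mathfrak{g}\mid\langle\mu,\xi\rangle=0\}$, $\mathfrak{g}_{[\mu]}=\{\xi\in\mathfrak{g}\mid\mathrm{ad}^*_\xi\mu\wedge\mu=0\}$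 and $\mathfrak{k}_{[\mu]}=\ker\mu\cap\mathfrak{g}_{[\mu]}$, which is a Lie subalgebra; $K_{[\mu]}$ is the connected Lie subgroup of $G$ with Lie algebra $\mathfrak{k}_{[\mu]}$. An action is quotientable on $N$ by $K_{[\mu]}$ if the orbit space $N/K_{[\mu]}$ of the restricted action of $K_{[\mu]}$ on $N$ is a manifold and the projection $N\to N/K_{[\mu]}$ is a submersion. Reduced system (modified Marsden–Meyer–Weinstein reduction, known): let $\tau_{[\mu]}\colon(\mathbf{J}^\Phi_\theta)^{-1}(\mathbb{R}^\times\mu)\to P_{[\mu]}$ be the projection and $\jmath_{[\mu]}\colon(\mathbf{J}^\Phi_\theta)^{-1}(\mathbb{R}^\times\mu)\hookrightarrow P$ the immersion. Then $\nabla$ is tangent to $(\mathbf{J}^\Phi_\theta)^{-1}(\mathbb{R}^\times\mu)$, and $(P_{[\mu]},\theta_{[\mu]},\nabla_{[\mu]},h_{[\mu]})$ is the exact symplectic Hamiltonian system with $\omega_{[\mu]}=-\mathrm{d}\theta_{[\mu]}$, $\tau_{[\mu]}^*\omega_{[\mu]}=\jmath_{[\mu]}^*\omega$, $\tau_{[\mu]*}\nabla=\nabla_{[\mu]}$ and $\tau_{[\mu]}^*h_{[\mu]}=\jmath_{[\mu]}^*h$. *)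

theory Defs
  imports "HOL-Analysis.Analysis" "HOL-Algebra.Group_Action" "HOL-Combinatorics.Permutations"
begin

section \<open>Smooth functions between Euclidean spaces\<close>

primrec Ck_on :: "nat \<Rightarrow> 'a::euclidean_space set \<Rightarrow> ('a \<Rightarrow> 'b::real_normed_vector) \<Rightarrow> bool" where
  "Ck_on 0 U f = continuous_on U f"
| "Ck_on (Suc k) U f =
     ((\<forall>x\<in>U. f differentiable (at x)) \<and> (\<forall>v. Ck_on k U (\<lambda>x. frechet_derivative f (at x) v)))"

text \<open>Smoothness on an arbitrary set means local smooth extendability. On a relatively open subset
  of a linear subspace this is ordinary smoothness on an open subset of that vector space.\<close>

definition smooth_on :: "'a::euclidean_space set \<Rightarrow> ('a \<Rightarrow> 'b::real_normed_vector) \<Rightarrow> bool" where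
  "smooth_on A f \<longleftrightarrow>
     (\<forall>x\<in>A. \<exists>U F. open U \<and> x \<in> U \<and> (\<forall>k. Ck_on k U F) \<and> (\<forall>y\<in>A \<inter> U. F y = f y))"

definition ddir :: "('a::real_normed_vector \<Rightarrow> 'b::real_normed_vector) \<Rightarrow> 'a \<Rightarrow> 'a \<Rightarrow> 'b" where
  "ddir f x v = vector_derivative (\<lambda>t. f (x + t *\<^sub>R v)) (at 0)"


section \<open>Manifolds\<close>

text \<open>Points form the carrier of an abstract topology. A chart \<open>(U, \<phi>)\<close> takes \<open>U\<close> onto a
  relatively open subset of some linear subspace of a fixed Euclidean space \<open>'e\<close>; that subspace is
  recovered as \<open>span (\<phi> ` U)\<close>. In this way submanifolds and quotients can be modelled on the same type
  \<open>'e\<close>, dimension 0 included. The dimension is locally constant; it is constant if the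
  manifold is connected. Values of \<open>\<phi>\<close> outside \<open>U\<close> are irrelevant.\<close>

type_synonym ('a, 'e) chart = "'a set \<times> ('a \<Rightarrow> 'e)"

record ('a, 'e) mfd =
  mtop :: "'a topology"
  atlas :: "('a, 'e) chart set"

abbreviation points :: "('a, 'e) mfd \<Rightarrow> 'a set" where
  "points M \<equiv> topspace (mtop M)"

definition chart_inv :: "('a, 'e) chart \<Rightarrow> 'e \<Rightarrow> 'a" where
  "chart_inv c = inv_into (fst c) (snd c)"

definition chart_image :: "('a, 'e) chart \<Rightarrow> 'e set" where
  "chart_image c = snd c ` fst c"

definition chart_space :: "('a, 'e::euclidean_space) chart \<Rightarrow> 'e set" where
  "chart_space c = span (chart_image c)"

definition is_chart :: "'a topology \<Rightarrow> ('a, 'e::euclidean_space) chart \<Rightarrow> bool" where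
  "is_chart X c \<longleftrightarrow>
     openin X (fst c) \<and>
     openin (top_of_set (chart_space c)) (chart_image c) \<and>
     homeomorphic_map (subtopology X (fst c)) (top_of_set (chart_image c)) (snd c)"

definition compatible_charts ::
  "('a, 'e::euclidean_space) chart \<Rightarrow> ('a, 'e) chart \<Rightarrow> bool" where
  "compatible_charts c c' \<longleftrightarrow>
     smooth_on (snd c ` (fst c \<inter> fst c')) (snd c' \<circ> chart_inv c) \<and>
     smooth_on (snd c' ` (fst c \<inter> fst c')) (snd c \<circ> chart_inv c')"

definition paracompact_space :: "'a topology \<Rightarrow> bool" where
  "paracompact_space X \<longleftrightarrow>
     (\<forall>\<U>. (\<forall>U\<in>\<U>. openin X U) \<and> \<Union>\<U> = topspace X \<longrightarrow>
        (\<exists>\<V>. (\<forall>V\<in>\<V>. openin X V) \<and> \<Union>\<V> = topspace X \<and>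
             (\<forall>V\<in>\<V>. \<exists>U\<in>\<U>. V \<subseteq> U) \<and> locally_finite_in X \<V>))"

text \<open>Atlases are not required to be maximal; all notions below are invariant under passing to a
  compatible atlas.\<close>

definition smooth_manifold :: "('a, 'e::euclidean_space) mfd \<Rightarrow> bool" where
  "smooth_manifold M \<longleftrightarrow>
     Hausdorff_space (mtop M) \<and> paracompact_space (mtop M) \<and>
     (\<forall>c\<in>atlas M. is_chart (mtop M) c) \<and>
     (\<forall>c\<in>atlas M. \<forall>c'\<in>atlas M. compatible_charts c c') \<and>
     (\<Union>c\<in>atlas M. fst c) = points M"

definition manifold_dim :: "('a, 'e::euclidean_space) mfd \<Rightarrow> nat \<Rightarrow> bool" where
  "manifold_dim M d \<longleftrightarrow> (\<forall>c\<in>atlas M. fst c \<noteq> {} \<longrightarrow> dim (chart_space c) = d)"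

definition smooth_map ::
  "('a, 'e::euclidean_space) mfd \<Rightarrow> ('b, 'f::euclidean_space) mfd \<Rightarrow> ('a \<Rightarrow> 'b) \<Rightarrow> bool" where
  "smooth_map M N f \<longleftrightarrow>
     continuous_map (mtop M) (mtop N) f \<and>
     (\<forall>c\<in>atlas M. \<forall>c'\<in>atlas N.
        smooth_on (snd c ` {p \<in> fst c. f p \<in> fst c'}) (snd c' \<circ> f \<circ> chart_inv c))"

definition real_line :: "(real, real) mfd" where
  "real_line = \<lparr>mtop = euclidean, atlas = {(UNIV, \<lambda>x. x)}\<rparr>"

definition product_mfd ::
  "('a, 'e) mfd \<Rightarrow> ('b, 'f) mfd \<Rightarrow> ('a \<times> 'b, 'e \<times> 'f) mfd" where
  "product_mfd M N =
     \<lparr>mtop = prod_topology (mtop M) (mtop N),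
      atlas = {(fst c \<times> fst c', map_prod (snd c) (snd c')) | c c'. c \<in> atlas M \<and> c' \<in> atlas N}\<rparr>"

definition diffeomorphism ::
  "('a, 'e::euclidean_space) mfd \<Rightarrow> ('b, 'f::euclidean_space) mfd \<Rightarrow> ('a \<Rightarrow> 'b) \<Rightarrow> bool" where
  "diffeomorphism M N f \<longleftrightarrow>
     smooth_manifold M \<and> smooth_manifold N \<and> smooth_map M N f \<and>
     (\<exists>g. smooth_map N M g \<and> (\<forall>p\<in>points M. g (f p) = p) \<and> (\<forall>q\<in>points N. f (g q) = q))"


section \<open>Tangent vectors and differentials\<close>

definition charts_at :: "('a, 'e) mfd \<Rightarrow> 'a \<Rightarrow> ('a, 'e) chart set" where
  "charts_at M p = {c \<in> atlas M. p \<in> fst c}"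

definition some_chart :: "('a, 'e) mfd \<Rightarrow> 'a \<Rightarrow> ('a, 'e) chart" where
  "some_chart M p = (SOME c. c \<in> charts_at M p)"

text \<open>A tangent vector at \<open>p\<close> is the family of its coordinate representatives in the charts
  around \<open>p\<close>, related by the derivatives of the coordinate changes (and 0 by convention at
  all other charts). The vector space operations are therefore pointwise. In the definitions below
  \<^const>\<open>some_chart\<close> only serves to evaluate expressions that do not depend on the chart.\<close>

type_synonym ('a, 'e) tvec = "('a, 'e) chart \<Rightarrow> 'e"

definition tangent_space :: "('a, 'e::euclidean_space) mfd \<Rightarrow> 'a \<Rightarrow> ('a, 'e) tvec set" where
  "tangent_space M p =
     {v. (\<forall>c. c \<notin> charts_at M p \<longrightarrow> v c = 0) \<and>
         (\<forall>c\<in>charts_at M p. v c \<in> chart_space c) \<and>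
         (\<forall>c\<in>charts_at M p. \<forall>c'\<in>charts_at M p.
            v c' = ddir (snd c' \<circ> chart_inv c) (snd c p) (v c))}"

definition tvec_of ::
  "('a, 'e::euclidean_space) mfd \<Rightarrow> 'a \<Rightarrow> ('a, 'e) chart \<Rightarrow> 'e \<Rightarrow> ('a, 'e) tvec" where
  "tvec_of M p c e =
     (\<lambda>c'. if c' \<in> charts_at M p then ddir (snd c' \<circ> chart_inv c) (snd c p) e else 0)"

definition tcomb ::
  "real \<Rightarrow> ('a, 'e::euclidean_space) tvec \<Rightarrow> real \<Rightarrow> ('a, 'e) tvec \<Rightarrow> ('a, 'e) tvec" where
  "tcomb a u b v = (\<lambda>c. a *\<^sub>R u c + b *\<^sub>R v c)"

definition tmap ::
  "('a, 'e::euclidean_space) mfd \<Rightarrow> ('b, 'f::euclidean_space) mfd \<Rightarrow> ('a \<Rightarrow> 'b) \<Rightarrow> 'a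
     \<Rightarrow> ('a, 'e) tvec \<Rightarrow> ('b, 'f) tvec" where
  "tmap M N f p v =
     (let c = some_chart M p in
       (\<lambda>c'. if c' \<in> charts_at N (f p) then ddir (snd c' \<circ> f \<circ> chart_inv c) (snd c p) (v c) else 0))"

definition dfun ::
  "('a, 'e::euclidean_space) mfd \<Rightarrow> ('a \<Rightarrow> real) \<Rightarrow> 'a \<Rightarrow> ('a, 'e) tvec \<Rightarrow> real" where
  "dfun M h p v = (let c = some_chart M p in ddir (h \<circ> chart_inv c) (snd c p) (v c))"

definition velocity :: "('a, 'e::euclidean_space) mfd \<Rightarrow> (real \<Rightarrow> 'a) \<Rightarrow> ('a, 'e) tvec" where
  "velocity M \<gamma> =
     (\<lambda>c. if c \<in> charts_at M (\<gamma> 0) then vector_derivative (snd c \<circ> \<gamma>) (at 0) else 0)"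

definition submersion ::
  "('a, 'e::euclidean_space) mfd \<Rightarrow> ('b, 'f::euclidean_space) mfd \<Rightarrow> ('a \<Rightarrow> 'b) \<Rightarrow> bool" where
  "submersion M N f \<longleftrightarrow> smooth_map M N f \<and>
     (\<forall>p\<in>points M. tmap M N f p ` tangent_space M p = tangent_space N (f p))"

definition immersion ::
  "('a, 'e::euclidean_space) mfd \<Rightarrow> ('b, 'f::euclidean_space) mfd \<Rightarrow> ('a \<Rightarrow> 'b) \<Rightarrow> bool" where
  "immersion M N f \<longleftrightarrow> smooth_map M N f \<and>
     (\<forall>p\<in>points M. inj_on (tmap M N f p) (tangent_space M p))"

definition smooth_embedding ::
  "('a, 'e::euclidean_space) mfd \<Rightarrow> ('b, 'f::euclidean_space) mfd \<Rightarrow> ('a \<Rightarrow> 'b) \<Rightarrow> bool" where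
  "smooth_embedding M N f \<longleftrightarrow> immersion M N f \<and> embedding_map (mtop M) (mtop N) f"

definition regular_value :: "('a, 'e::euclidean_space) mfd \<Rightarrow> ('a \<Rightarrow> real) \<Rightarrow> real \<Rightarrow> bool" where
  "regular_value M h c \<longleftrightarrow>
     (\<forall>p\<in>points M. h p = c \<longrightarrow> (\<exists>v\<in>tangent_space M p. dfun M h p v \<noteq> 0))"


section \<open>Submanifolds\<close>

text \<open>Slice charts are charts of the maximal atlas, and slices may be taken along any linear subspace.\<close>

definition slice_chart ::
  "('a, 'e::euclidean_space) mfd \<Rightarrow> 'a set \<Rightarrow> ('a, 'e) chart \<Rightarrow> bool" where
  "slice_chart M N c \<longleftrightarrow>
     is_chart (mtop M) c \<and> (\<forall>c'\<in>atlas M. compatible_charts c c') \<and>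
     (\<exists>W. subspace W \<and> snd c ` (fst c \<inter> N) = chart_image c \<inter> W)"

definition embedded_submanifold :: "('a, 'e::euclidean_space) mfd \<Rightarrow> 'a set \<Rightarrow> bool" where
  "embedded_submanifold M N \<longleftrightarrow>
     N \<subseteq> points M \<and> (\<forall>p\<in>N. \<exists>c. slice_chart M N c \<and> p \<in> fst c)"

definition submfd :: "('a, 'e::euclidean_space) mfd \<Rightarrow> 'a set \<Rightarrow> ('a, 'e) mfd" where
  "submfd M N =
     \<lparr>mtop = subtopology (mtop M) N,
      atlas = {(fst c \<inter> N, snd c) | c. slice_chart M N c}\<rparr>"


section \<open>Vector fields and differential forms\<close>

definition vector_field ::
  "('a, 'e::euclidean_space) mfd \<Rightarrow> ('a \<Rightarrow> ('a, 'e) tvec) \<Rightarrow> bool" where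
  "vector_field M X \<longleftrightarrow>
     (\<forall>p\<in>points M. X p \<in> tangent_space M p) \<and>
     (\<forall>c\<in>atlas M. smooth_on (chart_image c) (\<lambda>x. X (chart_inv c x) c))"

text \<open>Covectors are normalised to vanish outside the tangent space, so that equality of
  covectors is equality of functions.\<close>

definition cotangent_space ::
  "('a, 'e::euclidean_space) mfd \<Rightarrow> 'a \<Rightarrow> (('a, 'e) tvec \<Rightarrow> real) set" where
  "cotangent_space M p =
     {\<alpha>. (\<forall>v. v \<notin> tangent_space M p \<longrightarrow> \<alpha> v = 0) \<and>
         (\<forall>u\<in>tangent_space M p. \<forall>v\<in>tangent_space M p. \<forall>a b.
            \<alpha> (tcomb a u b v) = a * \<alpha> u + b * \<alpha> v)}"

type_synonym ('a, 'e) form1 = "'a \<Rightarrow> ('a, 'e) tvec \<Rightarrow> real"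
type_synonym ('a, 'e) form2 = "'a \<Rightarrow> ('a, 'e) tvec \<Rightarrow> ('a, 'e) tvec \<Rightarrow> real"

definition one_form :: "('a, 'e::euclidean_space) mfd \<Rightarrow> ('a, 'e) form1 \<Rightarrow> bool" where
  "one_form M \<theta> \<longleftrightarrow>
     (\<forall>p\<in>points M. \<theta> p \<in> cotangent_space M p) \<and>
     (\<forall>c\<in>atlas M. \<forall>e\<in>chart_space c.
        smooth_on (chart_image c) (\<lambda>x. \<theta> (chart_inv c x) (tvec_of M (chart_inv c x) c e)))"

definition pullback1 ::
  "('a, 'e::euclidean_space) mfd \<Rightarrow> ('b, 'f::euclidean_space) mfd \<Rightarrow> ('a \<Rightarrow> 'b)
     \<Rightarrow> ('b, 'f) form1 \<Rightarrow> ('a, 'e) form1" where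
  "pullback1 M N f \<theta> p v = (if v \<in> tangent_space M p then \<theta> (f p) (tmap M N f p v) else 0)"

definition pullback2 ::
  "('a, 'e::euclidean_space) mfd \<Rightarrow> ('b, 'f::euclidean_space) mfd \<Rightarrow> ('a \<Rightarrow> 'b)
     \<Rightarrow> ('b, 'f) form2 \<Rightarrow> ('a, 'e) form2" where
  "pullback2 M N f \<omega> p u v = \<omega> (f p) (tmap M N f p u) (tmap M N f p v)"

text \<open>In coordinates, \<open>d\<theta>(u, v) = u(\<theta>(v)) - v(\<theta>(u))\<close> for constant \<open>u\<close>, \<open>v\<close>.\<close>

definition dform :: "('a, 'e::euclidean_space) mfd \<Rightarrow> ('a, 'e) form1 \<Rightarrow> ('a, 'e) form2" where
  "dform M \<theta> p u v =
     (let c = some_chart M p;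
          \<theta>\<^sub>c = (\<lambda>e x. \<theta> (chart_inv c x) (tvec_of M (chart_inv c x) c e))
      in ddir (\<theta>\<^sub>c (v c)) (snd c p) (u c) - ddir (\<theta>\<^sub>c (u c)) (snd c p) (v c))"

definition field_bracket ::
  "('a, 'e::euclidean_space) mfd \<Rightarrow> ('a \<Rightarrow> ('a, 'e) tvec) \<Rightarrow> ('a \<Rightarrow> ('a, 'e) tvec)
     \<Rightarrow> 'a \<Rightarrow> ('a, 'e) tvec" where
  "field_bracket M X Y p =
     (\<lambda>c. if c \<in> charts_at M p
          then ddir (\<lambda>x. Y (chart_inv c x) c) (snd c p) (X p c)
             - ddir (\<lambda>x. X (chart_inv c x) c) (snd c p) (Y p c)
          else 0)"

definition transverse ::
  "('a, 'e::euclidean_space) mfd \<Rightarrow> ('a \<Rightarrow> ('a, 'e) tvec) \<Rightarrow> 'a set \<Rightarrow> bool" where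
  "transverse M Y N \<longleftrightarrow>
     (\<forall>x\<in>N. {tcomb a (Y x) 1 (tmap (submfd M N) M (\<lambda>q. q) x u) | a u.
               u \<in> tangent_space (submfd M N) x} = tangent_space M x)"


section \<open>Exact symplectic Hamiltonian systems and contact manifolds\<close>

definition symp :: "('a, 'e::euclidean_space) mfd \<Rightarrow> ('a, 'e) form1 \<Rightarrow> ('a, 'e) form2" where
  "symp M \<theta> p u v = - dform M \<theta> p u v"

text \<open>The form \<open>-d\<theta>\<close> is closed because it is exact, so being symplectic amounts to
  non-degeneracy.\<close>

definition exact_symplectic_manifold ::
  "('a, 'e::euclidean_space) mfd \<Rightarrow> ('a, 'e) form1 \<Rightarrow> bool" where
  "exact_symplectic_manifold M \<theta> \<longleftrightarrow>
     smooth_manifold M \<and> one_form M \<theta> \<and>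
     (\<forall>p\<in>points M. \<forall>u\<in>tangent_space M p.
        (\<forall>v\<in>tangent_space M p. symp M \<theta> p u v = 0) \<longrightarrow> u = (\<lambda>c. 0))"

definition Liouville_field ::
  "('a, 'e::euclidean_space) mfd \<Rightarrow> ('a, 'e) form1 \<Rightarrow> ('a \<Rightarrow> ('a, 'e) tvec) \<Rightarrow> bool" where
  "Liouville_field M \<theta> X \<longleftrightarrow> vector_field M X \<and>
     (\<forall>p\<in>points M. \<forall>v\<in>tangent_space M p. symp M \<theta> p (X p) v = \<theta> p v)"

definition exact_symplectic_Hamiltonian_system ::
  "('a, 'e::euclidean_space) mfd \<Rightarrow> ('a, 'e) form1 \<Rightarrow> ('a \<Rightarrow> ('a, 'e) tvec) \<Rightarrow> ('a \<Rightarrow> real) \<Rightarrow> bool"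
  where
  "exact_symplectic_Hamiltonian_system M \<theta> X h \<longleftrightarrow>
     exact_symplectic_manifold M \<theta> \<and> Liouville_field M \<theta> X \<and> smooth_map M real_line h"

text \<open>\<open>\<eta> \<and> (d\<eta>)\<^sup>m\<close> evaluated at \<open>v 0, \<dots>, v (2 m)\<close>, up to a positive constant factor
  depending only on \<open>m\<close>.\<close>

definition contact_top_form ::
  "('a, 'e::euclidean_space) mfd \<Rightarrow> ('a, 'e) form1 \<Rightarrow> nat \<Rightarrow> 'a \<Rightarrow> (nat \<Rightarrow> ('a, 'e) tvec) \<Rightarrow> real"
  where
  "contact_top_form M \<eta> m p v =
     (\<Sum>\<sigma> | \<sigma> permutes {..<2 * m + 1}.
        real_of_int (sign \<sigma>) * \<eta> p (v (\<sigma> 0)) *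
        (\<Prod>i<m. dform M \<eta> p (v (\<sigma> (2 * i + 1))) (v (\<sigma> (2 * i + 2)))))"

definition contact_manifold :: "('a, 'e::euclidean_space) mfd \<Rightarrow> ('a, 'e) form1 \<Rightarrow> bool" where
  "contact_manifold M \<eta> \<longleftrightarrow>
     smooth_manifold M \<and> one_form M \<eta> \<and>
     (\<exists>n\<ge>1. manifold_dim M (2 * n - 1) \<and>
        (\<forall>p\<in>points M. \<exists>v. (\<forall>i. v i \<in> tangent_space M p) \<and> contact_top_form M \<eta> (n - 1) p v \<noteq> 0))"

definition energy_hypersurface ::
  "('a, 'e::euclidean_space) mfd \<Rightarrow> ('a, 'e) form1 \<Rightarrow> ('a \<Rightarrow> real) \<Rightarrow> real
     \<Rightarrow> ('a, 'e) mfd \<Rightarrow> ('a, 'e) form1 \<Rightarrow> bool" where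
  "energy_hypersurface P \<theta> h c S \<eta> \<longleftrightarrow>
     S = submfd P {p \<in> points P. h p = c} \<and> \<eta> = pullback1 S P (\<lambda>q. q) \<theta> \<and> contact_manifold S \<eta>"


section \<open>Lie groups and momentum maps\<close>

definition Lie_group :: "('g, 'z) monoid_scheme \<Rightarrow> ('g, 'k::euclidean_space) mfd \<Rightarrow> bool" where
  "Lie_group G MG \<longleftrightarrow>
     group G \<and> smooth_manifold MG \<and> carrier G = points MG \<and>
     smooth_map (product_mfd MG MG) MG (\<lambda>(g, g'). g \<otimes>\<^bsub>G\<^esub> g') \<and>
     smooth_map MG MG (\<lambda>g. inv\<^bsub>G\<^esub> g)"

definition Lie_algebra ::
  "('g, 'z) monoid_scheme \<Rightarrow> ('g, 'k::euclidean_space) mfd \<Rightarrow> ('g, 'k) tvec set" where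
  "Lie_algebra G MG = tangent_space MG \<one>\<^bsub>G\<^esub>"

definition Lie_dual ::
  "('g, 'z) monoid_scheme \<Rightarrow> ('g, 'k::euclidean_space) mfd \<Rightarrow> (('g, 'k) tvec \<Rightarrow> real) set" where
  "Lie_dual G MG = cotangent_space MG \<one>\<^bsub>G\<^esub>"

definition left_invariant_field ::
  "('g, 'z) monoid_scheme \<Rightarrow> ('g, 'k::euclidean_space) mfd \<Rightarrow> ('g, 'k) tvec \<Rightarrow> 'g \<Rightarrow> ('g, 'k) tvec"
  where
  "left_invariant_field G MG \<xi> g = tmap MG MG (\<lambda>g'. g \<otimes>\<^bsub>G\<^esub> g') \<one>\<^bsub>G\<^esub> \<xi>"

definition Lie_bracket ::
  "('g, 'z) monoid_scheme \<Rightarrow> ('g, 'k::euclidean_space) mfd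
     \<Rightarrow> ('g, 'k) tvec \<Rightarrow> ('g, 'k) tvec \<Rightarrow> ('g, 'k) tvec" where
  "Lie_bracket G MG \<xi> \<zeta> =
     field_bracket MG (left_invariant_field G MG \<xi>) (left_invariant_field G MG \<zeta>) \<one>\<^bsub>G\<^esub>"

definition one_parameter_subgroup ::
  "('g, 'z) monoid_scheme \<Rightarrow> ('g, 'k::euclidean_space) mfd \<Rightarrow> ('g, 'k) tvec \<Rightarrow> (real \<Rightarrow> 'g) \<Rightarrow> bool"
  where
  "one_parameter_subgroup G MG \<xi> \<gamma> \<longleftrightarrow>
     smooth_map real_line MG \<gamma> \<and> (\<forall>s t. \<gamma> (s + t) = \<gamma> s \<otimes>\<^bsub>G\<^esub> \<gamma> t) \<and> velocity MG \<gamma> = \<xi>"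

definition Lie_exp ::
  "('g, 'z) monoid_scheme \<Rightarrow> ('g, 'k::euclidean_space) mfd \<Rightarrow> ('g, 'k) tvec \<Rightarrow> 'g" where
  "Lie_exp G MG \<xi> = (THE \<gamma>. one_parameter_subgroup G MG \<xi> \<gamma>) 1"

text \<open>\<^const>\<open>group_action\<close> provides the algebraic axioms of a left action; it
  also asks that each \<open>\<Phi> g\<close> be \<open>undefined\<close> outside the carrier.\<close>

definition Lie_group_action ::
  "('g, 'z) monoid_scheme \<Rightarrow> ('g, 'k::euclidean_space) mfd \<Rightarrow> ('a, 'e::euclidean_space) mfd
     \<Rightarrow> ('g \<Rightarrow> 'a \<Rightarrow> 'a) \<Rightarrow> bool" where
  "Lie_group_action G MG M \<Phi> \<longleftrightarrow>
     group_action G (points M) \<Phi> \<and> smooth_map (product_mfd MG M) M (\<lambda>(g, p). \<Phi> g p)"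

text \<open>An exact symplectic action when \<open>\<theta>\<close> is a symplectic potential, and a contact
  action when \<open>\<theta>\<close> is a contact form.\<close>

definition form_preserving_action ::
  "('g, 'z) monoid_scheme \<Rightarrow> ('g, 'k::euclidean_space) mfd \<Rightarrow> ('a, 'e::euclidean_space) mfd
     \<Rightarrow> ('a, 'e) form1 \<Rightarrow> ('g \<Rightarrow> 'a \<Rightarrow> 'a) \<Rightarrow> bool" where
  "form_preserving_action G MG M \<theta> \<Phi> \<longleftrightarrow>
     Lie_group_action G MG M \<Phi> \<and>
     (\<forall>g\<in>carrier G. \<forall>p\<in>points M. pullback1 M M (\<Phi> g) \<theta> p = \<theta> p)"

definition fundamental_field ::
  "('g, 'z) monoid_scheme \<Rightarrow> ('g, 'k::euclidean_space) mfd \<Rightarrow> ('a, 'e::euclidean_space) mfd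
     \<Rightarrow> ('g \<Rightarrow> 'a \<Rightarrow> 'a) \<Rightarrow> ('g, 'k) tvec \<Rightarrow> 'a \<Rightarrow> ('a, 'e) tvec" where
  "fundamental_field G MG M \<Phi> \<xi> p = velocity M (\<lambda>t. \<Phi> (Lie_exp G MG (\<lambda>c. t *\<^sub>R \<xi> c)) p)"

definition momentum_map ::
  "('g, 'z) monoid_scheme \<Rightarrow> ('g, 'k::euclidean_space) mfd \<Rightarrow> ('a, 'e::euclidean_space) mfd
     \<Rightarrow> ('a, 'e) form1 \<Rightarrow> ('g \<Rightarrow> 'a \<Rightarrow> 'a) \<Rightarrow> ('a \<Rightarrow> ('g, 'k) tvec \<Rightarrow> real) \<Rightarrow> bool" where
  "momentum_map G MG M \<theta> \<Phi> J \<longleftrightarrow>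
     (\<forall>p\<in>points M. J p \<in> Lie_dual G MG \<and>
        (\<forall>\<xi>\<in>Lie_algebra G MG. \<theta> p (fundamental_field G MG M \<Phi> \<xi> p) = J p \<xi>))"

text \<open>The tangent spaces of the vector space \<open>\<gg>\<^sup>*\<close> are identified with \<open>\<gg>\<^sup>*\<close>.\<close>

definition regular_momentum_value ::
  "('g, 'z) monoid_scheme \<Rightarrow> ('g, 'k::euclidean_space) mfd \<Rightarrow> ('a, 'e::euclidean_space) mfd
     \<Rightarrow> ('a \<Rightarrow> ('g, 'k) tvec \<Rightarrow> real) \<Rightarrow> (('g, 'k) tvec \<Rightarrow> real) \<Rightarrow> bool" where
  "regular_momentum_value G MG M J \<mu> \<longleftrightarrow>
     (\<forall>p\<in>points M. J p = \<mu> \<longrightarrow>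
        (\<forall>\<nu>\<in>Lie_dual G MG. \<exists>v\<in>tangent_space M p.
           \<forall>\<xi>\<in>Lie_algebra G MG. dfun M (\<lambda>q. J q \<xi>) p v = \<nu> \<xi>))"

definition punctured_line :: "('v \<Rightarrow> real) \<Rightarrow> ('v \<Rightarrow> real) set" where
  "punctured_line \<mu> = {\<lambda>\<xi>. a * \<mu> \<xi> | a. a \<noteq> 0}"

definition momentum_level ::
  "('a, 'e) mfd \<Rightarrow> ('a \<Rightarrow> 'v \<Rightarrow> real) \<Rightarrow> ('v \<Rightarrow> real) \<Rightarrow> 'a set" where
  "momentum_level M J \<mu> = {p \<in> points M. J p \<in> punctured_line \<mu>}"

text \<open>The sign convention for \<open>ad\<^sup>*\<close> is immaterial for the condition \<open>ad\<^sup>*\<^sub>\<xi> \<mu> \<and> \<mu> = 0\<close> below.\<close>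

definition ad_star ::
  "('g, 'z) monoid_scheme \<Rightarrow> ('g, 'k::euclidean_space) mfd \<Rightarrow> ('g, 'k) tvec
     \<Rightarrow> (('g, 'k) tvec \<Rightarrow> real) \<Rightarrow> ('g, 'k) tvec \<Rightarrow> real" where
  "ad_star G MG \<xi> \<mu> \<zeta> = \<mu> (Lie_bracket G MG \<xi> \<zeta>)"

definition ker_alg ::
  "('g, 'z) monoid_scheme \<Rightarrow> ('g, 'k::euclidean_space) mfd
     \<Rightarrow> (('g, 'k) tvec \<Rightarrow> real) \<Rightarrow> ('g, 'k) tvec set" where
  "ker_alg G MG \<mu> = {\<xi> \<in> Lie_algebra G MG. \<mu> \<xi> = 0}"

definition ray_isotropy_alg ::
  "('g, 'z) monoid_scheme \<Rightarrow> ('g, 'k::euclidean_space) mfd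
     \<Rightarrow> (('g, 'k) tvec \<Rightarrow> real) \<Rightarrow> ('g, 'k) tvec set" where
  "ray_isotropy_alg G MG \<mu> =
     {\<xi> \<in> Lie_algebra G MG. \<forall>\<zeta>\<in>Lie_algebra G MG. \<forall>\<zeta>'\<in>Lie_algebra G MG.
        ad_star G MG \<xi> \<mu> \<zeta> * \<mu> \<zeta>' - ad_star G MG \<xi> \<mu> \<zeta>' * \<mu> \<zeta> = 0}"

definition k_alg ::
  "('g, 'z) monoid_scheme \<Rightarrow> ('g, 'k::euclidean_space) mfd
     \<Rightarrow> (('g, 'k) tvec \<Rightarrow> real) \<Rightarrow> ('g, 'k) tvec set" where
  "k_alg G MG \<mu> = ker_alg G MG \<mu> \<inter> ray_isotropy_alg G MG \<mu>"

text \<open>Lie subgroups are immersed: \<open>MK\<close> carries its own topology.\<close>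

definition connected_Lie_subgroup ::
  "('g, 'z) monoid_scheme \<Rightarrow> ('g, 'k::euclidean_space) mfd \<Rightarrow> ('g, 'k) mfd
     \<Rightarrow> ('g, 'k) tvec set \<Rightarrow> bool" where
  "connected_Lie_subgroup G MG MK \<kk> \<longleftrightarrow>
     subgroup (points MK) G \<and> Lie_group (G\<lparr>carrier := points MK\<rparr>) MK \<and>
     connected_space (mtop MK) \<and> immersion MK MG (\<lambda>g. g) \<and>
     tmap MK MG (\<lambda>g. g) \<one>\<^bsub>G\<^esub> ` tangent_space MK \<one>\<^bsub>G\<^esub> = \<kk>"


section \<open>Quotients and the reduced system\<close>

definition orbit_proj ::
  "('g, 'z) monoid_scheme \<Rightarrow> 'g set \<Rightarrow> ('g \<Rightarrow> 'a \<Rightarrow> 'a) \<Rightarrow> 'a \<Rightarrow> 'a set" where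
  "orbit_proj G K \<Phi> p = orbit (G\<lparr>carrier := K\<rparr>) \<Phi> p"

text \<open>\<open>Q\<close> is the orbit space \<open>N/K\<close> with a manifold structure making the projection a
  submersion; such a structure is unique up to the choice of a compatible atlas.\<close>

definition orbit_manifold ::
  "('g, 'z) monoid_scheme \<Rightarrow> 'g set \<Rightarrow> ('g \<Rightarrow> 'a \<Rightarrow> 'a) \<Rightarrow> ('a, 'e::euclidean_space) mfd
     \<Rightarrow> ('a set, 'e) mfd \<Rightarrow> bool" where
  "orbit_manifold G K \<Phi> N Q \<longleftrightarrow>
     smooth_manifold Q \<and> quotient_map (mtop N) (mtop Q) (orbit_proj G K \<Phi>) \<and>
     submersion N Q (orbit_proj G K \<Phi>)"

definition quotientable ::
  "('g, 'z) monoid_scheme \<Rightarrow> 'g set \<Rightarrow> ('g \<Rightarrow> 'a \<Rightarrow> 'a) \<Rightarrow> ('a, 'e::euclidean_space) mfd \<Rightarrow> bool" where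
  "quotientable G K \<Phi> N \<longleftrightarrow> (\<exists>Q. orbit_manifold G K \<Phi> N Q)"

text \<open>The map on orbit spaces induced by \<open>f : N \<rightarrow> N'\<close>, where \<open>\<pi>\<close> and \<open>\<tau>\<close> are the
  projections of \<open>N\<close> and \<open>N'\<close>.\<close>

definition induced_orbit_map ::
  "'a set \<Rightarrow> ('a \<Rightarrow> 'a set) \<Rightarrow> ('b \<Rightarrow> 'b set) \<Rightarrow> ('a \<Rightarrow> 'b) \<Rightarrow> 'a set \<Rightarrow> 'b set" where
  "induced_orbit_map N \<pi> \<tau> f A = \<tau> (f (SOME q. q \<in> N \<and> \<pi> q = A))"

text \<open>The third clause says that \<open>X\<close> is tangent to \<open>N\<close> and is projected to \<open>X'\<close> by \<open>\<tau>\<close>.\<close>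

definition reduced_system ::
  "('a, 'e::euclidean_space) mfd \<Rightarrow> ('a, 'e) form1 \<Rightarrow> ('a \<Rightarrow> ('a, 'e) tvec) \<Rightarrow> ('a \<Rightarrow> real)
     \<Rightarrow> 'a set \<Rightarrow> ('a \<Rightarrow> 'b) \<Rightarrow> ('b, 'f::euclidean_space) mfd \<Rightarrow> ('b, 'f) form1
     \<Rightarrow> ('b \<Rightarrow> ('b, 'f) tvec) \<Rightarrow> ('b \<Rightarrow> real) \<Rightarrow> bool" where
  "reduced_system P \<theta> X h N \<tau> Q \<theta>' X' h' \<longleftrightarrow>
     exact_symplectic_Hamiltonian_system Q \<theta>' X' h' \<and>
     (\<forall>p\<in>N. \<forall>u\<in>tangent_space (submfd P N) p. \<forall>v\<in>tangent_space (submfd P N) p.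
        pullback2 (submfd P N) Q \<tau> (symp Q \<theta>') p u v
          = pullback2 (submfd P N) P (\<lambda>q. q) (symp P \<theta>) p u v) \<and>
     (\<forall>p\<in>N. \<exists>v\<in>tangent_space (submfd P N) p.
        tmap (submfd P N) P (\<lambda>q. q) p v = X p \<and> tmap (submfd P N) Q \<tau> p v = X' (\<tau> p)) \<and>
     (\<forall>p\<in>N. h' (\<tau> p) = h p)"

end

theory Submission
  imports Defs
begin

text \<open>Since \<open>h\<close> is invariant, the level set of \<open>h\<^sub>[\<^sub>\<mu>\<^sub>]\<close> in the quotient and the quotient of the level
  set of \<open>h\<close> consist of the same orbits, so that \<open>i\<close> induces the identity on points and \<open>\<kappa>\<close> can only
  be the identity. Pushing \<open>\<nabla>\<close> down to the quotient shows that \<open>dh\<^sub>[\<^sub>\<mu>\<^sub>](\<nabla>\<^sub>[\<^sub>\<mu>\<^sub>]) = dh(\<nabla>) \<noteq> 0\<close> on the level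
  set, by transversality, hence \<open>c\<close> is a regular value of \<open>h\<^sub>[\<^sub>\<mu>\<^sub>]\<close>. The identity is smooth in both
  directions because a smooth local section of either projection, followed by the other projection,
  is the identity; for \<open>S\<^sub>[\<^sub>\<mu>\<^sub>] \<rightarrow> M\<^sub>[\<^sub>\<mu>\<^sub>]\<close> the section is restricted to \<open>S\<^sub>[\<^sub>\<mu>\<^sub>]\<close>, where it takes values in
  \<open>h\<^sup>-\<^sup>1(c)\<close>.\<close>

section \<open>Calculus of smooth functions\<close>

text \<open>Charts take values in linear subspaces that vary from chart to chart, and
  \<open>smooth_on\<close> only asks for local extensions to the surrounding Euclidean space.
  Derivatives are therefore determined only along the model subspace, and a coordinate change built
  from an extension must be checked to respect it. Local sections of submersions and slice charts of
  regular levels both come from one device: an affine correction gives the extension the derivative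
  \<open>id\<close> at the base point, so the inverse function theorem is needed only in that case.
  Sections are used, rather than descent of maps along a quotient, because \<open>S\<mu>\<close> is
  in general not open in \<open>P\<mu>\<close>: descent would require that \<open>\<tau>\<close>
  restricted to \<open>NS\<close> be a submersion onto \<open>S\<mu>\<close>, whereas a section can
  be restricted to any subset. Hausdorffness and paracompactness of \<open>S\<mu>\<close> are not
  derived from \<open>P\<mu>\<close>: once the identity is continuous in both directions, the
  topologies of \<open>S\<mu>\<close> and \<open>M\<mu>\<close> coincide, and both properties are
  those of \<open>M\<mu>\<close>.\<close>

lemma Ck_on_cong:
  assumes "open U" "\<And>x. x \<in> U \<Longrightarrow> f x = g x" "Ck_on k U f"
  shows "Ck_on k U g"
  using assms(2,3)
proof (induction k arbitrary: f g)
  case 0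
  then show ?case by (simp cong: continuous_on_cong)
next
  case (Suc k)
  have d: "(g has_derivative frechet_derivative f (at x)) (at x)" if "x \<in> U" for x
    using has_derivative_transform_within_open[OF _ \<open>open U\<close> that] Suc.prems that
    by (metis Ck_on.simps(2) frechet_derivative_works)
  have "Ck_on k U (\<lambda>x. frechet_derivative g (at x) v)" for v
    by (rule Suc.IH[of "\<lambda>x. frechet_derivative f (at x) v"])
      (use Suc.prems(2) frechet_derivative_at[OF d] in auto)
  then show ?case using d by (auto simp: differentiable_def)
qed

text \<open>Derivatives are unique, so any explicit formula for \<open>f'\<close> may replace the
  \<open>frechet_derivative\<close> in the definition of \<open>Ck_on\<close>. Each calculus rule
  below thus reduces to showing that its formula is of one order less.\<close>

lemma Ck_on_Suc_derivI:
  assumes "open U" and "\<And>x. x \<in> U \<Longrightarrow> (f has_derivative f' x) (at x)"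
    and "\<And>v. Ck_on k U (\<lambda>x. f' x v)"
  shows "Ck_on (Suc k) U f"
proof -
  have "frechet_derivative f (at x) = f' x" if "x \<in> U" for x
    using assms(2)[OF that] frechet_derivative_at by metis
  then show ?thesis
    using assms(2) by (auto simp: differentiable_def intro!: Ck_on_cong[OF assms(1) _ assms(3)])
qed

lemma Ck_on_has_derivative:
  "Ck_on (Suc k) U f \<Longrightarrow> x \<in> U \<Longrightarrow> (f has_derivative frechet_derivative f (at x)) (at x)"
  by (simp add: frechet_derivative_works)

lemma Ck_on_Suc_imp: "Ck_on (Suc k) U f \<Longrightarrow> Ck_on k U f"
proof (induction k arbitrary: f)
  case 0
  then have "f differentiable_on U" by (simp add: differentiable_on_def differentiable_at_withinI)
  then show ?case by (simp add: differentiable_imp_continuous_on)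
next
  case (Suc k)
  then show ?case by (metis Ck_on.simps(2))
qed

lemma Ck_on_subset: "Ck_on k U f \<Longrightarrow> V \<subseteq> U \<Longrightarrow> Ck_on k V f"
  by (induction k arbitrary: f) (auto intro: continuous_on_subset)

lemma Ck_on_const: "Ck_on k U (\<lambda>x. c)"
  by (induction k arbitrary: c) auto

lemma Ck_on_ident: "Ck_on k U (\<lambda>x. x)"
  by (cases k) (auto intro: Ck_on_const)

lemma Ck_on_linear:
  assumes "bounded_linear L" "open U" "Ck_on k U f"
  shows "Ck_on k U (\<lambda>x. L (f x))"
  using assms(3)
proof (induction k arbitrary: f)
  case 0
  then show ?case
    using assms(1) by (simp add: linear_continuous_on_compose bounded_linear.continuous_on)
next
  case (Suc k)
  show ?case
    by (rule Ck_on_Suc_derivI[OF \<open>open U\<close>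
          bounded_linear.has_derivative[OF assms(1) Ck_on_has_derivative[OF Suc.prems]]])
      (use Suc assms(2) in auto)
qed

lemma Ck_on_add:
  assumes "open U" "Ck_on k U f" "Ck_on k U g"
  shows "Ck_on k U (\<lambda>x. f x + g x)"
  using assms(2,3)
proof (induction k arbitrary: f g)
  case 0
  then show ?case by (simp add: continuous_on_add)
next
  case (Suc k)
  show ?case
    by (rule Ck_on_Suc_derivI[OF \<open>open U\<close> has_derivative_add[OF
            Ck_on_has_derivative[OF Suc.prems(1)] Ck_on_has_derivative[OF Suc.prems(2)]]])
      (use Suc assms(1) in auto)
qed

lemma Ck_on_diff:
  assumes "open U" "Ck_on k U f" "Ck_on k U g"
  shows "Ck_on k U (\<lambda>x. f x - g x)"
  using Ck_on_add[OF assms(1,2) Ck_on_linear[OF bounded_linear_minus[OF bounded_linear_ident] assms(1,3)]]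
  by simp

lemma Ck_on_sum:
  assumes "open U" "\<And>i. i \<in> I \<Longrightarrow> Ck_on k U (f i)"
  shows "Ck_on k U (\<lambda>x. \<Sum>i\<in>I. f i x)"
  using assms(2)
  by (induction I rule: infinite_finite_induct) (auto simp: Ck_on_const Ck_on_add[OF assms(1)])

lemma Ck_on_scaleR:
  assumes "open U" "Ck_on k U a" "Ck_on k U f"
  shows "Ck_on k U (\<lambda>x. a x *\<^sub>R f x)"
  using assms(2,3)
proof (induction k arbitrary: a f)
  case 0
  then show ?case by (simp add: continuous_on_scaleR)
next
  case (Suc k)
  \<comment> \<open>The product rule leaves one factor undifferentiated, so the induction also needs
    \<open>C^k\<close> of \<open>a\<close> and \<open>f\<close> themselves.\<close>
  show ?case
    by (rule Ck_on_Suc_derivI[OF \<open>open U\<close> has_derivative_scaleR[OF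
            Ck_on_has_derivative[OF Suc.prems(1)] Ck_on_has_derivative[OF Suc.prems(2)]]])
      (use Suc.prems in \<open>auto intro!: Ck_on_add[OF assms(1)] Suc.IH intro: Ck_on_Suc_imp\<close>)
qed

text \<open>A family of linear maps depending \<open>C\<^sup>k\<close> on a point is treated pointwise, which avoids
  operator-valued maps.\<close>

lemma linear_apply_sum:
  fixes L :: "'a::euclidean_space \<Rightarrow> 'b::real_normed_vector"
  assumes "linear L"
  shows "L v = (\<Sum>b\<in>Basis. (v \<bullet> b) *\<^sub>R L b)"
proof -
  have "L v = L (\<Sum>b\<in>Basis. (v \<bullet> b) *\<^sub>R b)" by (simp add: euclidean_representation)
  also have "\<dots> = (\<Sum>b\<in>Basis. (v \<bullet> b) *\<^sub>R L b)"
    using assms by (simp add: linear_sum linear_scale)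
  finally show ?thesis .
qed

text \<open>Expanding \<open>g x\<close> in the basis gives a finite sum of scalar coordinates times
  \<open>L x b\<close> with \<open>b\<close> fixed. This serves derivatives in which the linear map
  and its argument vary together, as in the chain rule.\<close>

lemma Ck_on_linear_apply:
  fixes L :: "'a::euclidean_space \<Rightarrow> 'c::euclidean_space \<Rightarrow> 'b::real_normed_vector"
  assumes "open U" "\<And>x. x \<in> U \<Longrightarrow> linear (L x)" "\<And>v. Ck_on k U (\<lambda>x. L x v)" "Ck_on k U g"
  shows "Ck_on k U (\<lambda>x. L x (g x))"
proof (rule Ck_on_cong[OF assms(1)])
  show "Ck_on k U (\<lambda>x. \<Sum>b\<in>Basis. (g x \<bullet> b) *\<^sub>R L x b)"
    by (intro Ck_on_sum Ck_on_scaleR assms Ck_on_linear[OF bounded_linear_inner_left])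
  show "(\<Sum>b\<in>Basis. (g x \<bullet> b) *\<^sub>R L x b) = L x (g x)" if "x \<in> U" for x
    using linear_apply_sum[OF assms(2)[OF that]] by metis
qed

text \<open>Induction on the order: the chain rule applies the derivative of \<open>g\<close> at
  \<open>f x\<close>, a composition of one order less, to the derivative of
  \<open>f\<close>.\<close>

lemma Ck_on_compose:
  assumes "open U" "open V" "f ` U \<subseteq> V" "Ck_on k U f" "Ck_on k V g"
  shows "Ck_on k U (\<lambda>x. g (f x))"
  using assms(4,5)
proof (induction k arbitrary: g)
  case 0
  then show ?case using assms(3) by (auto intro: continuous_on_compose2)
next
  case (Suc k)
  have fV: "f x \<in> V" if "x \<in> U" for x using that assms(3) by auto
  have g': "(g has_derivative frechet_derivative g (at y)) (at y)" if "y \<in> V" for y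
    by (rule Ck_on_has_derivative[OF Suc.prems(2) that])
  show ?case
  proof (rule Ck_on_Suc_derivI[OF \<open>open U\<close>
        has_derivative_compose[OF Ck_on_has_derivative[OF Suc.prems(1)] g'[OF fV]]])
    show "Ck_on k U (\<lambda>x. frechet_derivative g (at (f x)) (frechet_derivative f (at x) v))" for v
    proof (rule Ck_on_linear_apply[OF assms(1)])
      show "linear (frechet_derivative g (at (f x)))" if "x \<in> U" for x
        using g'[OF fV[OF that]] by (rule has_derivative_linear)
      show "Ck_on k U (\<lambda>x. frechet_derivative g (at (f x)) w)" for w
        using Suc.prems by (intro Suc.IH Ck_on_Suc_imp[OF Suc.prems(1)]) simp
    qed (use Suc.prems in simp)
  qed
qed

section \<open>Inverses of families of linear maps and the smooth inverse function theorem\<close>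

lemma linear_two_sided_inverse:
  assumes "linear L" "\<And>v. M (L v) = v" "\<And>v. L (M v) = v"
  shows "linear M"
proof (rule linearI)
  show "M (v + w) = M v + M w" for v w
    using assms(2)[of "M v + M w"] by (simp add: assms linear_add)
  show "M (r *\<^sub>R v) = r *\<^sub>R M v" for r v
    using assms(2)[of "r *\<^sub>R M v"] by (simp add: assms linear_scale)
qed

text \<open>The inverse of \<open>(z, w) \<mapsto> (z, L z w)\<close> is \<open>(z, w) \<mapsto> (z, M z w)\<close>, so differentiability of \<open>M\<close> is
  that of an inverse function; continuity of \<open>M\<close> need not be established beforehand.\<close>

lemma differentiable_inverse_family:
  fixes L M :: "'a::euclidean_space \<Rightarrow> 'a \<Rightarrow> 'a"
  assumes "open V" and lin: "\<And>y. y \<in> V \<Longrightarrow> linear (L y)"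
    and MoL: "\<And>y v. y \<in> V \<Longrightarrow> M y (L y v) = v" and LoM: "\<And>y v. y \<in> V \<Longrightarrow> L y (M y v) = v"
    and diff: "\<And>y v. y \<in> V \<Longrightarrow> (\<lambda>y. L y v) differentiable (at y)" and "y \<in> V"
  shows "((\<lambda>y. M y v) has_derivative
    (\<lambda>u. - M y (frechet_derivative (\<lambda>z. L z (M y v)) (at y) u))) (at y)"
proof -
  define D where "D z w = frechet_derivative (\<lambda>z. L z w) (at z)" for z w
  have D: "((\<lambda>z. L z w) has_derivative D z w) (at z)" if "z \<in> V" for z w
    using diff[OF that] by (simp add: D_def frechet_derivative_works)
  define \<Psi> where "\<Psi> = (\<lambda>(z, w). (z, L z w))"
  define \<Xi> where "\<Xi> = (\<lambda>(z, w). (z, M z w))"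
  \<comment> \<open>The partial derivative in \<open>z\<close> is expanded along the coordinates of
    \<open>w\<close>, so that only derivatives of \<open>L\<close> at fixed basis vectors occur. The
    resulting map is block triangular, and \<open>\<Xi>'\<close> is obtained by solving it for
    \<open>b\<close>.\<close>
  define \<Psi>' where "\<Psi>' = (\<lambda>(z, w) (a, b). (a, (\<Sum>e\<in>Basis. (w \<bullet> e) *\<^sub>R D z e a) + L z b))"
  define \<Xi>' where "\<Xi>' = (\<lambda>(z, w) (a, b). (a, M z (b - (\<Sum>e\<in>Basis. (w \<bullet> e) *\<^sub>R D z e a))))"
  have linM: "linear (M z)" if "z \<in> V" for z
    using linear_two_sided_inverse[OF lin[OF that]] MoL[OF that] LoM[OF that] by blast
  \<comment> \<open>\<open>L z w\<close> is linear in \<open>w\<close>, hence so is its derivative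
    in \<open>z\<close>.\<close>
  have D_sum: "D z w a = (\<Sum>e\<in>Basis. (w \<bullet> e) *\<^sub>R D z e a)" if "z \<in> V" for z w a
  proof -
    have "((\<lambda>z. L z w) has_derivative (\<lambda>a. \<Sum>e\<in>Basis. (w \<bullet> e) *\<^sub>R D z e a)) (at z)"
    proof (rule has_derivative_transform_within_open[OF _ \<open>open V\<close> that])
      show "((\<lambda>z. \<Sum>e\<in>Basis. (w \<bullet> e) *\<^sub>R L z e) has_derivative
          (\<lambda>a. \<Sum>e\<in>Basis. (w \<bullet> e) *\<^sub>R D z e a)) (at z)"
        by (intro has_derivative_sum has_derivative_scaleR_right D that)
    qed (use linear_apply_sum[OF lin] in metis)
    from has_derivative_unique[OF D[OF that] this] show ?thesis by (rule fun_cong)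
  qed
  have \<Psi>: "(\<Psi> has_derivative \<Psi>' p) (at p)" if pV: "p \<in> V \<times> UNIV" for p
  proof -
    obtain z w where p: "p = (z, w)" "z \<in> V" using pV by auto
    have "((\<lambda>p. (fst p, \<Sum>e\<in>Basis. (snd p \<bullet> e) *\<^sub>R L (fst p) e)) has_derivative \<Psi>' p) (at p)"
    proof -
      have 1: "((\<lambda>p. L (fst p) e) has_derivative (\<lambda>q. D z e (fst q))) (at p)" for e
        using has_derivative_compose[OF has_derivative_fst[OF has_derivative_ident],
            where x = p and s = UNIV and g = "\<lambda>z. L z e"]
          D[OF p(2), of e] by (simp add: p(1))
      have "((\<lambda>p. (fst p, \<Sum>e\<in>Basis. (snd p \<bullet> e) *\<^sub>R L (fst p) e)) has_derivative
          (\<lambda>q. (fst q, \<Sum>e\<in>Basis. (snd p \<bullet> e) *\<^sub>R D z e (fst q) + (snd q \<bullet> e) *\<^sub>R L (fst p) e))) (at p)"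
        by (intro has_derivative_Pair has_derivative_sum has_derivative_scaleR 1 has_derivative_fst
            has_derivative_inner_left has_derivative_snd has_derivative_ident)
      moreover have "(\<lambda>q. (fst q, \<Sum>e\<in>Basis. (snd p \<bullet> e) *\<^sub>R D z e (fst q) + (snd q \<bullet> e) *\<^sub>R L (fst p) e))
          = \<Psi>' p"
        unfolding \<Psi>'_def p(1)
        by (simp add: fun_eq_iff sum.distrib flip: linear_apply_sum[OF lin[OF p(2)]])
      ultimately show ?thesis by simp
    qed
    then show ?thesis
    proof (rule has_derivative_transform_within_open)
      show "open (V \<times> UNIV :: ('a \<times> 'a) set)" using \<open>open V\<close> by (simp add: open_Times)
      show "(fst q, \<Sum>e\<in>Basis. (snd q \<bullet> e) *\<^sub>R L (fst q) e) = \<Psi> q" if "q \<in> V \<times> UNIV" for q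
        using that linear_apply_sum[OF lin[of "fst q"], of "snd q"] by (simp add: \<Psi>_def split_beta mem_Times_iff)
    qed (rule pV)
  qed
  have "(\<Xi> has_derivative \<Xi>' p) (at (\<Psi> p))" if "p \<in> V \<times> UNIV" for p
  proof (rule has_derivative_inverse_on[OF _ \<Psi>])
    show "open (V \<times> UNIV :: ('a \<times> 'a) set)" using \<open>open V\<close> by (simp add: open_Times)
    show "\<Xi> (\<Psi> q) = q" if "q \<in> V \<times> UNIV" for q using that MoL by (auto simp: \<Xi>_def \<Psi>_def)
    show "\<Psi>' p \<circ> \<Xi>' p = id"
      using that LoM by (auto simp: \<Xi>'_def \<Psi>'_def)
  qed (use that in auto)
  from this[of "(y, M y v)"] \<open>y \<in> V\<close> have "(\<Xi> has_derivative \<Xi>' (y, M y v)) (at (y, v))"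
    by (simp add: \<Psi>_def LoM)
  \<comment> \<open>Freezing the second argument at \<open>v\<close> isolates \<open>M\<close>; the
    variation \<open>(u, 0)\<close> leaves only the off-diagonal block of \<open>\<Xi>'\<close>,
    which carries the minus sign.\<close>
  then have "((\<lambda>z. \<Xi> (z, v)) has_derivative (\<lambda>u. \<Xi>' (y, M y v) (u, 0))) (at y)"
    using has_derivative_compose[OF has_derivative_Pair[OF has_derivative_ident has_derivative_const],
        where x = y and s = UNIV and g = \<Xi>] by simp
  then have "((\<lambda>z. snd (\<Xi> (z, v))) has_derivative (\<lambda>u. snd (\<Xi>' (y, M y v) (u, 0)))) (at y)"
    by (rule has_derivative_snd)
  moreover have "snd (\<Xi>' (y, M y v) (u, 0)) = - M y (D y (M y v) u)" for u
    unfolding \<Xi>'_def D_sum[OF \<open>y \<in> V\<close>, of "M y v"] using linM[OF \<open>y \<in> V\<close>]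
    by (simp add: linear_neg)
  ultimately show ?thesis
    by (simp add: \<Xi>_def D_def)
qed

text \<open>The derivative of the inverse, \<open>- M (DL) M\<close>, contains \<open>M\<close> only
  undifferentiated, so each order of \<open>L\<close> yields the same order of \<open>M\<close> by
  induction.\<close>

lemma Ck_on_inverse_family:
  fixes L M :: "'a::euclidean_space \<Rightarrow> 'a \<Rightarrow> 'a"
  assumes "open V" and lin: "\<And>y. y \<in> V \<Longrightarrow> linear (L y)"
    and MoL: "\<And>y v. y \<in> V \<Longrightarrow> M y (L y v) = v" and LoM: "\<And>y v. y \<in> V \<Longrightarrow> L y (M y v) = v"
    and diff: "\<And>y v. y \<in> V \<Longrightarrow> (\<lambda>y. L y v) differentiable (at y)"
    and "\<And>v. Ck_on k V (\<lambda>y. L y v)"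
  shows "Ck_on k V (\<lambda>y. M y v)"
  using assms(6)
proof (induction k arbitrary: v)
  case 0
  \<comment> \<open>Continuity of \<open>M\<close> is drawn from its differentiability; hence
    \<open>diff\<close> is assumed separately from the order \<open>k\<close>.\<close>
  have "(\<lambda>y. M y v) differentiable (at y)" if "y \<in> V" for y
    using differentiable_inverse_family[OF assms(1-5) that] by (auto simp: differentiable_def)
  then show ?case
    by (simp add: differentiable_imp_continuous_on differentiable_on_def differentiable_at_withinI)
next
  case (Suc k)
  have linM: "linear (M z)" if "z \<in> V" for z
    using linear_two_sided_inverse[OF lin[OF that]] MoL[OF that] LoM[OF that] by blast
  have M: "Ck_on k V (\<lambda>y. M y w)" for w
    by (rule Suc.IH) (rule Ck_on_Suc_imp[OF Suc.prems])
  show ?case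
  proof (rule Ck_on_Suc_derivI[OF \<open>open V\<close> differentiable_inverse_family[OF assms(1-5)]])
    fix u
    \<comment> \<open>Linearity in \<open>w\<close> is what allows the varying vector
      \<open>M y v\<close> to be inserted for \<open>w\<close> below.\<close>
    have D_lin: "linear (\<lambda>w. frechet_derivative (\<lambda>z. L z w) (at y) u)" if "y \<in> V" for y
    proof -
      have D: "((\<lambda>z. L z w) has_derivative frechet_derivative (\<lambda>z. L z w) (at y)) (at y)" for w
        using diff[OF that] by (simp add: frechet_derivative_works)
      show ?thesis
      proof (rule linearI)
        fix w w' :: 'a and r :: real
        have "((\<lambda>z. L z (w + w')) has_derivative (\<lambda>u. frechet_derivative (\<lambda>z. L z w) (at y) u
            + frechet_derivative (\<lambda>z. L z w') (at y) u)) (at y)"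
          by (rule has_derivative_transform_within_open[OF has_derivative_add[OF D D] \<open>open V\<close> that])
            (simp add: lin linear_add)
        from has_derivative_unique[OF D this] show "frechet_derivative (\<lambda>z. L z (w + w')) (at y) u
            = frechet_derivative (\<lambda>z. L z w) (at y) u + frechet_derivative (\<lambda>z. L z w') (at y) u"
          by (rule fun_cong)
        have "((\<lambda>z. L z (r *\<^sub>R w)) has_derivative
            (\<lambda>u. r *\<^sub>R frechet_derivative (\<lambda>z. L z w) (at y) u)) (at y)"
          by (rule has_derivative_transform_within_open[OF has_derivative_scaleR_right[OF D]
                \<open>open V\<close> that]) (simp add: lin linear_scale)
        from has_derivative_unique[OF D this] show "frechet_derivative (\<lambda>z. L z (r *\<^sub>R w)) (at y) u
            = r *\<^sub>R frechet_derivative (\<lambda>z. L z w) (at y) u"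
          by (rule fun_cong)
      qed
    qed
    show "Ck_on k V (\<lambda>y. - M y (frechet_derivative (\<lambda>z. L z (M y v)) (at y) u))"
      using Suc.prems
      by (intro Ck_on_linear[OF bounded_linear_minus[OF bounded_linear_ident] \<open>open V\<close>]
          Ck_on_linear_apply[OF \<open>open V\<close> linM M]
          Ck_on_linear_apply[OF \<open>open V\<close> D_lin _ M]) auto
  qed
qed

text \<open>The inverse function theorem gives a differentiable \<open>G\<close> with
  \<open>G' = (DF o G)^-1\<close>; bootstrapping this formula raises the order of \<open>G\<close>
  indefinitely.\<close>

lemma smooth_inverse_function:
  fixes F :: "'a::euclidean_space \<Rightarrow> 'a"
  assumes "open U" and F: "\<And>k. Ck_on k U F" and "x0 \<in> U"
    and der0: "(F has_derivative (\<lambda>v. v)) (at x0)"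
  obtains U' V G where "open U'" "U' \<subseteq> U" "x0 \<in> U'" "open V" "F x0 \<in> V"
    "homeomorphism U' V F G" "\<And>k. Ck_on k V G"
proof -
  \<comment> \<open>The theorem to be applied wants an operator-valued continuous derivative; in
    finite dimension its continuity can be checked on each vector.\<close>
  define F' where "F' x = Blinfun (frechet_derivative F (at x))" for x
  have hd: "(F has_derivative frechet_derivative F (at x)) (at x)" if "x \<in> U" for x
    by (rule Ck_on_has_derivative[OF F that])
  have F'_apply: "blinfun_apply (F' x) = frechet_derivative F (at x)" if "x \<in> U" for x
    unfolding F'_def using hd[OF that] by (simp add: bounded_linear_Blinfun_apply has_derivative_bounded_linear)
  have cont: "continuous_on U F'"
  proof (rule continuous_on_blinfun_componentwise)
    show "continuous_on U (\<lambda>x. blinfun_apply (F' x) i)" for i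
      using F[of "Suc 0"] by (simp add: F'_apply cong: continuous_on_cong)
  qed
  have inv0: "id_blinfun o\<^sub>L F' x0 = id_blinfun"
    by (rule blinfun_eqI)
      (simp add: F'_apply \<open>x0 \<in> U\<close> frechet_derivative_at[OF der0, symmetric])
  obtain U' V G G' where *: "open U'" "U' \<subseteq> U" "x0 \<in> U'" "open V" "F x0 \<in> V"
    "homeomorphism U' V F G"
    "\<And>y. y \<in> V \<Longrightarrow> (G has_derivative (G' y)) (at y)"
    "\<And>y. y \<in> V \<Longrightarrow> G' y = inv_into UNIV (blinfun_apply (F' (G y)))"
    "\<And>y. y \<in> V \<Longrightarrow> bij (blinfun_apply (F' (G y)))"
    using inverse_function_theorem[OF \<open>open U\<close> _ cont \<open>x0 \<in> U\<close> inv0] hd F'_apply by metis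
  have GU: "G y \<in> U" if "y \<in> V" for y
    using *(2,6) that unfolding homeomorphism_def by blast
  have G: "Ck_on k V G" for k
  proof (induction k)
    case 0
    then show ?case using *(6) by (simp add: homeomorphism_def)
  next
    case (Suc k)
    have DF: "Ck_on k U (\<lambda>x. frechet_derivative F (at x) v)" for k v
      using F[of "Suc k"] by simp
    \<comment> \<open>\<open>G' y\<close> inverts the derivative of \<open>F\<close> at
      \<open>G y\<close>, which depends \<open>C^k\<close> on \<open>y\<close> as soon as
      \<open>G\<close> does. The differentiability in \<open>y\<close> required at every order is
      already known for \<open>G\<close>.\<close>
    have "Ck_on k V (\<lambda>y. G' y v)" for v
    proof (rule Ck_on_inverse_family[OF \<open>open V\<close>])
      fix y v assume y: "y \<in> V"
      show "linear (frechet_derivative F (at (G y)))"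
        using hd[OF GU[OF y]] by (rule has_derivative_linear)
      show "G' y (frechet_derivative F (at (G y)) v) = v" "frechet_derivative F (at (G y)) (G' y v) = v"
        using *(8,9)[OF y] by (simp_all add: F'_apply GU y bij_is_inj bij_is_surj inv_f_f surj_f_inv_f)
      have "((\<lambda>x. frechet_derivative F (at x) v) has_derivative
        frechet_derivative (\<lambda>x. frechet_derivative F (at x) v) (at (G y))) (at (G y))"
        by (rule Ck_on_has_derivative[OF DF GU[OF y]])
      then show "(\<lambda>y. frechet_derivative F (at (G y)) v) differentiable (at y)"
        using has_derivative_compose[OF *(7)[OF y]] by (auto simp: differentiable_def)
    next
      show "Ck_on k V (\<lambda>y. frechet_derivative F (at (G y)) v)" for v
        using GU by (intro Ck_on_compose[OF \<open>open V\<close> \<open>open U\<close> _ Suc DF]) auto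
    qed
    from Ck_on_Suc_derivI[OF \<open>open V\<close> *(7) this] show ?case by simp
  qed
  show ?thesis using that * G by blast
qed

section \<open>Smooth functions on arbitrary subsets of Euclidean space\<close>

lemma smooth_onE:
  assumes "smooth_on A f" "x \<in> A"
  obtains U F where "open U" "x \<in> U" "\<And>k. Ck_on k U F" "\<And>y. y \<in> A \<Longrightarrow> y \<in> U \<Longrightarrow> F y = f y"
proof -
  from bspec[OF assms(1)[unfolded smooth_on_def] assms(2)] obtain U F where
    "open U \<and> x \<in> U \<and> (\<forall>k. Ck_on k U F) \<and> (\<forall>y\<in>A \<inter> U. F y = f y)" by (elim exE)
  then show thesis by (intro that[of U F]) auto
qed

lemma smooth_onI:
  assumes "\<And>x. x \<in> A \<Longrightarrow>
    \<exists>U F. open U \<and> x \<in> U \<and> (\<forall>k. Ck_on k U F) \<and> (\<forall>y\<in>A. y \<in> U \<longrightarrow> F y = f y)"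
  shows "smooth_on A f"
  unfolding smooth_on_def
proof
  fix x assume "x \<in> A"
  from assms[OF this] obtain U F where
    "open U \<and> x \<in> U \<and> (\<forall>k. Ck_on k U F) \<and> (\<forall>y\<in>A. y \<in> U \<longrightarrow> F y = f y)" by (elim exE)
  then show "\<exists>U F. open U \<and> x \<in> U \<and> (\<forall>k. Ck_on k U F) \<and> (\<forall>y\<in>A \<inter> U. F y = f y)"
    by (intro exI[of _ U] exI[of _ F]) simp
qed

lemma smooth_on_cong_subset:
  assumes "smooth_on A f" "B \<subseteq> A" "\<And>x. x \<in> B \<Longrightarrow> f x = g x"
  shows "smooth_on B g"
proof (rule smooth_onI)
  fix x assume "x \<in> B"
  then obtain U F where "open U" "x \<in> U" "\<And>k. Ck_on k U F"
    "\<And>y. y \<in> A \<Longrightarrow> y \<in> U \<Longrightarrow> F y = f y"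
    using smooth_onE[OF assms(1)] assms(2) by (metis subsetD)
  then show "\<exists>U F. open U \<and> x \<in> U \<and> (\<forall>k. Ck_on k U F) \<and> (\<forall>y\<in>B. y \<in> U \<longrightarrow> F y = g y)"
    using assms(2,3) by (intro exI[of _ U] exI[of _ F]) auto
qed

lemma smooth_on_subset: "smooth_on A f \<Longrightarrow> B \<subseteq> A \<Longrightarrow> smooth_on B f"
  by (rule smooth_on_cong_subset) auto

lemma smooth_on_local:
  assumes "\<And>x. x \<in> A \<Longrightarrow> \<exists>T. open T \<and> x \<in> T \<and> smooth_on (A \<inter> T) f"
  shows "smooth_on A f"
proof (rule smooth_onI)
  fix x assume "x \<in> A"
  then obtain T where T: "open T" "x \<in> T" "smooth_on (A \<inter> T) f" using assms by blast
  obtain U F where "open U" "x \<in> U" "\<And>k. Ck_on k U F"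
    "\<And>y. y \<in> A \<inter> T \<Longrightarrow> y \<in> U \<Longrightarrow> F y = f y"
    using smooth_onE[OF T(3), of x] \<open>x \<in> A\<close> T(2) by blast
  then show "\<exists>U F. open U \<and> x \<in> U \<and> (\<forall>k. Ck_on k U F) \<and> (\<forall>y\<in>A. y \<in> U \<longrightarrow> F y = f y)"
    using T by (intro exI[of _ "U \<inter> T"] exI[of _ F]) (auto intro: Ck_on_subset)
qed

lemma smooth_on_Ck: "open U \<Longrightarrow> (\<And>k. Ck_on k U F) \<Longrightarrow> A \<subseteq> U \<Longrightarrow> smooth_on A F"
  by (rule smooth_onI) (intro exI[of _ U] exI[of _ F], auto)

lemma smooth_on_ident: "smooth_on A (\<lambda>x. x)"
  by (rule smooth_on_Ck[of UNIV]) (auto intro: Ck_on_ident)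

lemma smooth_on_compose:
  assumes f: "smooth_on A f" and g: "smooth_on B g" and "f ` A \<subseteq> B"
  shows "smooth_on A (\<lambda>x. g (f x))"
proof (rule smooth_onI)
  fix x assume x: "x \<in> A"
  obtain U F where F: "open U" "x \<in> U" "\<And>k. Ck_on k U F"
    "\<And>y. y \<in> A \<Longrightarrow> y \<in> U \<Longrightarrow> F y = f y"
    by (rule smooth_onE[OF f x]) blast
  have fx: "f x \<in> B" using x assms(3) by auto
  obtain V H where H: "open V" "f x \<in> V" "\<And>k. Ck_on k V H"
    "\<And>y. y \<in> B \<Longrightarrow> y \<in> V \<Longrightarrow> H y = g y"
    by (rule smooth_onE[OF g fx]) blast
  let ?W = "U \<inter> F -` V"
  have "continuous_on U F" using F(3)[of 0] by simp
  then have W: "open ?W" using F(1) H(1) by (rule continuous_open_preimage)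
  have "Ck_on k ?W (\<lambda>x. H (F x))" for k
    by (rule Ck_on_compose[OF W H(1) _ Ck_on_subset[OF F(3)] H(3)]) auto
  moreover have "x \<in> ?W" using F H x by simp
  moreover have "H (F y) = g (f y)" if "y \<in> A" "y \<in> ?W" for y
    using that F(4)[of y] H(4)[of "f y"] assms(3) by auto
  ultimately show "\<exists>U F. open U \<and> x \<in> U \<and> (\<forall>k. Ck_on k U F) \<and> (\<forall>y\<in>A. y \<in> U \<longrightarrow> F y = g (f y))"
    using W by (intro exI[of _ ?W] exI[of _ "\<lambda>x. H (F x)"]) simp
qed

lemma smooth_on_imp_continuous_on:
  assumes "smooth_on A f" shows "continuous_on A f"
  unfolding continuous_on_eq_continuous_within
proof
  fix x assume x: "x \<in> A"
  obtain U F where F: "open U" "x \<in> U" "\<And>k. Ck_on k U F"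
    "\<And>y. y \<in> A \<Longrightarrow> y \<in> U \<Longrightarrow> F y = f y"
    by (rule smooth_onE[OF assms x]) blast
  have "continuous_on U F" using F(3)[of 0] by simp
  then have "continuous (at x within A) F"
    using F by (simp add: continuous_on_eq_continuous_at continuous_at_imp_continuous_within)
  moreover have "\<forall>\<^sub>F y in at x within A. F y = f y"
    unfolding eventually_at_topological using F by blast
  moreover have "F x = f x" using F x by simp
  ultimately show "continuous (at x within A) f"
    unfolding continuous_within by (auto intro: Lim_transform_eventually)
qed

section \<open>Directional derivatives along a model subspace\<close>

lemma eventually_line_in:
  fixes V :: "'a::euclidean_space set"
  assumes "openin (top_of_set V) D" "subspace V" "x \<in> D" "v \<in> V"
  shows "\<forall>\<^sub>F t in nhds (0::real). x + t *\<^sub>R v \<in> D"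
proof -
  obtain T where T: "open T" "D = V \<inter> T" using assms(1) by (auto simp: openin_open)
  have "isCont (\<lambda>t::real. x + t *\<^sub>R v) 0"
    by (intro continuous_intros)
  then have "((\<lambda>t::real. x + t *\<^sub>R v) \<longlongrightarrow> x + 0 *\<^sub>R v) (nhds 0)"
    by (simp add: isCont_def tendsto_at_iff_tendsto_nhds[of "\<lambda>t. x + t *\<^sub>R v" 0, simplified])
  then have "\<forall>\<^sub>F t in nhds (0::real). x + t *\<^sub>R v \<in> T"
    using T assms(3) by (simp add: topological_tendstoD)
  then show ?thesis
    by eventually_elim (use T assms in \<open>auto simp: subspace_add subspace_scale\<close>)
qed

text \<open>From a point of \<open>D\<close>, a short segment in any direction of \<open>V\<close>
  stays in \<open>D\<close>, and the difference of its end points spans that direction. Since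
  \<open>chart_space\<close> is defined as a span, this identifies the model spaces of restricted
  and modified charts.\<close>

lemma span_openin_subspace:
  fixes V :: "'a::euclidean_space set"
  assumes "openin (top_of_set V) D" "subspace V" "D \<noteq> {}"
  shows "span D = V"
proof
  show "span D \<subseteq> V" using assms by (simp add: openin_imp_subset span_minimal)
  show "V \<subseteq> span D"
  proof
    fix v assume v: "v \<in> V"
    obtain x where x: "x \<in> D" using assms(3) by auto
    obtain e where e: "e > 0" "\<And>t. dist t 0 < e \<Longrightarrow> x + t *\<^sub>R v \<in> D"
      using eventually_line_in[OF assms(1,2) x v] unfolding eventually_nhds_metric by auto
    have "x + (e / 2) *\<^sub>R v - x \<in> span D" using e x by (intro span_diff span_base) auto
    then have "(e / 2) *\<^sub>R v \<in> span D" by simp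
    from span_scale[OF this, of "2 / e"] show "v \<in> span D" using e(1) by simp
  qed
qed

text \<open>Only the derivative along the model subspace is determined by the function; the linear map
  below comes from some smooth extension.\<close>

lemma smooth_on_derivative:
  assumes "smooth_on E f" "x \<in> E"
  obtains L where "bounded_linear L"
    "\<And>(\<gamma>::real \<Rightarrow> _) w. \<lbrakk>(\<gamma> has_vector_derivative w) (at 0); \<gamma> 0 = x; \<forall>\<^sub>F t in nhds 0. \<gamma> t \<in> E\<rbrakk>
      \<Longrightarrow> ((\<lambda>t. f (\<gamma> t)) has_vector_derivative L w) (at 0)"
proof -
  obtain U F where F: "open U" "x \<in> U" "\<And>k. Ck_on k U F"
    "\<And>y. y \<in> E \<Longrightarrow> y \<in> U \<Longrightarrow> F y = f y"
    by (rule smooth_onE[OF assms]) blast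
  let ?L = "frechet_derivative F (at x)"
  have L: "(F has_derivative ?L) (at x)" by (rule Ck_on_has_derivative[OF F(3,2)])
  show ?thesis
  proof (rule that)
    show lin: "bounded_linear ?L" using L by (rule has_derivative_bounded_linear)
    fix \<gamma> :: "real \<Rightarrow> _" and w
    assume \<gamma>: "(\<gamma> has_vector_derivative w) (at 0)" "\<gamma> 0 = x" "\<forall>\<^sub>F t in nhds 0. \<gamma> t \<in> E"
    have "((\<lambda>t. F (\<gamma> t)) has_derivative (\<lambda>t. ?L (t *\<^sub>R w))) (at 0)"
      using \<gamma>(1) unfolding has_vector_derivative_def
      by (rule has_derivative_compose) (use L \<gamma>(2) in simp)
    then have "((\<lambda>t. F (\<gamma> t)) has_vector_derivative ?L w) (at 0)"
      using lin unfolding has_vector_derivative_def by (simp add: linear_simps)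
    moreover have "\<forall>\<^sub>F t in nhds 0. F (\<gamma> t) = f (\<gamma> t)"
    proof -
      have "isCont \<gamma> 0" using \<gamma>(1) has_vector_derivative_continuous by blast
      then have "(\<gamma> \<longlongrightarrow> x) (nhds 0)"
        unfolding isCont_def tendsto_at_iff_tendsto_nhds using \<gamma>(2) by simp
      then have "\<forall>\<^sub>F t in nhds 0. \<gamma> t \<in> U" using F by (simp add: topological_tendstoD)
      with \<gamma>(3) show ?thesis by eventually_elim (simp add: F)
    qed
    ultimately show "((\<lambda>t. f (\<gamma> t)) has_vector_derivative ?L w) (at 0)"
      using has_vector_derivative_cong_ev[where x = 0 and S = UNIV and f = "\<lambda>t. F (\<gamma> t)"
          and g = "\<lambda>t. f (\<gamma> t)"]
      using \<gamma>(2) F(2) assms(2) by (simp add: F(4))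
  qed
qed

lemma line_has_vector_derivative: "((\<lambda>t. x + t *\<^sub>R v) has_vector_derivative v) (at 0)"
  by (auto intro!: derivative_eq_intros)

lemma smooth_on_ddir:
  assumes "smooth_on D f" "openin (top_of_set V) D" "subspace V" "x \<in> D"
  obtains L where "bounded_linear L"
    "\<And>v. v \<in> V \<Longrightarrow> ((\<lambda>t. f (x + t *\<^sub>R v)) has_vector_derivative L v) (at 0)"
    "\<And>v. v \<in> V \<Longrightarrow> ddir f x v = L v"
proof -
  obtain L where L: "bounded_linear L"
    "\<And>(\<gamma>::real \<Rightarrow> _) w. \<lbrakk>(\<gamma> has_vector_derivative w) (at 0); \<gamma> 0 = x; \<forall>\<^sub>F t in nhds 0. \<gamma> t \<in> D\<rbrakk>
      \<Longrightarrow> ((\<lambda>t. f (\<gamma> t)) has_vector_derivative L w) (at 0)"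
    using smooth_on_derivative[OF assms(1,4)] by blast
  have d: "((\<lambda>t. f (x + t *\<^sub>R v)) has_vector_derivative L v) (at 0)" if "v \<in> V" for v
    by (rule L(2)[OF line_has_vector_derivative _ eventually_line_in[OF assms(2-4) that]]) simp
  show ?thesis
    by (rule that[OF L(1) d]) (simp_all add: ddir_def vector_derivative_at[OF d])
qed

lemma ddir_has_vector_derivative:
  assumes "smooth_on D f" "openin (top_of_set V) D" "subspace V" "x \<in> D" "v \<in> V"
  shows "((\<lambda>t. f (x + t *\<^sub>R v)) has_vector_derivative ddir f x v) (at 0)"
proof -
  obtain L where "\<And>v. v \<in> V \<Longrightarrow> ((\<lambda>t. f (x + t *\<^sub>R v)) has_vector_derivative L v) (at 0)"
    "\<And>v. v \<in> V \<Longrightarrow> ddir f x v = L v"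
    by (rule smooth_on_ddir[OF assms(1-4)]) blast
  then show ?thesis using assms(5) by simp
qed

lemma ddir_cong:
  fixes V :: "'a::euclidean_space set"
  assumes "openin (top_of_set V) D" "subspace V" "x \<in> D" "v \<in> V"
    and "\<And>y. y \<in> D \<Longrightarrow> f y = g y"
  shows "ddir f x v = ddir g x v"
proof -
  have "\<forall>\<^sub>F t in nhds (0::real). f (x + t *\<^sub>R v) = g (x + t *\<^sub>R v)"
    using eventually_line_in[OF assms(1-4)] by eventually_elim (rule assms(5))
  then show ?thesis unfolding ddir_def by (intro vector_derivative_cong_eq) auto
qed

text \<open>A linear retraction onto \<open>W\<close> does not change \<open>f\<close> on
  \<open>D\<close>, so it fixes the directional derivative too.\<close>

lemma ddir_in_subspace:
  fixes f :: "'a::euclidean_space \<Rightarrow> 'b::euclidean_space"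
  assumes "smooth_on D f" "openin (top_of_set V) D" "subspace V" "x \<in> D" "v \<in> V"
    and "f ` D \<subseteq> W" "subspace W"
  shows "ddir f x v \<in> W"
proof -
  \<comment> \<open>A right inverse of the identity on \<open>W\<close> with range in
    \<open>W\<close> is a linear projection onto \<open>W\<close>.\<close>
  have "\<exists>r. range r \<subseteq> W \<and> linear r \<and> (\<forall>w\<in>id ` W. id (r w) = w)"
    by (rule linear_exists_right_inverse_on[OF linear_id assms(7)])
  then show ?thesis
  proof (elim exE conjE)
    fix r assume r: "range r \<subseteq> W" "linear r" and "\<forall>w\<in>id ` W. id (r w) = w"
    then have rW: "r w = w" if "w \<in> W" for w using that by simp
    have "bounded_linear r" using linear_conv_bounded_linear r(2) by blast
    then have "((\<lambda>t. r (f (x + t *\<^sub>R v))) has_vector_derivative r (ddir f x v)) (at 0)"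
      by (rule bounded_linear.has_vector_derivative[OF _ ddir_has_vector_derivative[OF assms(1-5)]])
    then have "ddir (\<lambda>y. r (f y)) x v = r (ddir f x v)"
      unfolding ddir_def by (rule vector_derivative_at)
    moreover have "ddir (\<lambda>y. r (f y)) x v = ddir f x v"
    proof (rule ddir_cong[OF assms(2-5)])
      show "r (f y) = f y" if "y \<in> D" for y by (rule rW) (use that assms(6) in blast)
    qed
    ultimately have "ddir f x v = r (ddir f x v)" by simp
    moreover have "r (ddir f x v) \<in> W" using r(1) by blast
    ultimately show ?thesis by simp
  qed
qed

text \<open>\<open>E\<close> need not be relatively open in any subspace. Then \<open>L\<close>,
  coming from an extension of \<open>g\<close>, is not determined by \<open>g\<close>, yet the chain
  rule holds because the curve \<open>f (x + t *\<^sub>R v)\<close> stays in \<open>E\<close>. The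
  last clause identifies \<open>L\<close> where \<open>E\<close> is relatively open.\<close>

lemma ddir_chain:
  assumes f: "smooth_on D f" "openin (top_of_set V) D" "subspace V" "x \<in> D"
    and g: "smooth_on E g" "f ` D \<subseteq> E"
  obtains L where "bounded_linear L" "\<And>v. v \<in> V \<Longrightarrow> ddir (\<lambda>y. g (f y)) x v = L (ddir f x v)"
    "\<And>W w. \<lbrakk>openin (top_of_set W) E; subspace W; w \<in> W\<rbrakk> \<Longrightarrow> ddir g (f x) w = L w"
proof -
  have fx: "f x \<in> E" using assms by auto
  obtain L where L: "bounded_linear L"
    "\<And>(\<gamma>::real \<Rightarrow> _) w. \<lbrakk>(\<gamma> has_vector_derivative w) (at 0); \<gamma> 0 = f x; \<forall>\<^sub>F t in nhds 0. \<gamma> t \<in> E\<rbrakk>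
      \<Longrightarrow> ((\<lambda>t. g (\<gamma> t)) has_vector_derivative L w) (at 0)"
    using smooth_on_derivative[OF g(1) fx] by blast
  have "((\<lambda>t. g (f (x + t *\<^sub>R v))) has_vector_derivative L (ddir f x v)) (at 0)" if "v \<in> V" for v
  proof (rule L(2)[OF ddir_has_vector_derivative[OF f that]])
    show "\<forall>\<^sub>F t in nhds 0. f (x + t *\<^sub>R v) \<in> E"
      using eventually_line_in[OF f(2-4) that] by eventually_elim (use g(2) in auto)
  qed simp
  moreover have "((\<lambda>t. g (f x + t *\<^sub>R w)) has_vector_derivative L w) (at 0)"
    if "openin (top_of_set W) E" "subspace W" "w \<in> W" for W w
    by (rule L(2)[OF line_has_vector_derivative _ eventually_line_in[OF that(1,2) fx that(3)]]) simp
  ultimately show ?thesis using that[OF L(1)] unfolding ddir_def by (simp add: vector_derivative_at)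
qed

section \<open>Smooth maps on subsets of manifolds\<close>

lemma is_chart_openin: "is_chart X c \<Longrightarrow> openin X (fst c)"
  and is_chart_openin_image: "is_chart X c \<Longrightarrow> openin (top_of_set (chart_space c)) (chart_image c)"
  unfolding is_chart_def by auto

lemma subspace_chart_space: "subspace (chart_space c)"
  by (simp add: chart_space_def)

lemma is_chart_inj_on:
  assumes "is_chart X c" shows "inj_on (snd c) (fst c)"
proof -
  have "topspace (subtopology X (fst c)) = fst c"
    using openin_subset[OF is_chart_openin[OF assms]] by auto
  then show ?thesis using assms unfolding is_chart_def homeomorphic_map_def by metis
qed

lemma chart_inv_left: "is_chart X c \<Longrightarrow> p \<in> fst c \<Longrightarrow> chart_inv c (snd c p) = p"
  by (simp add: chart_inv_def is_chart_inj_on)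

lemma chart_inv_right: "y \<in> chart_image c \<Longrightarrow> snd c (chart_inv c y) = y"
  unfolding chart_inv_def chart_image_def by (rule f_inv_into_f)

lemma chart_inv_in: "y \<in> chart_image c \<Longrightarrow> chart_inv c y \<in> fst c"
  unfolding chart_inv_def chart_image_def by (rule inv_into_into)

lemma chart_in_image: "p \<in> fst c \<Longrightarrow> snd c p \<in> chart_image c"
  by (simp add: chart_image_def)

lemma chart_in_space: "p \<in> fst c \<Longrightarrow> snd c p \<in> chart_space c"
  unfolding chart_space_def by (intro span_base chart_in_image)

lemma chart_openin_image:
  assumes c: "is_chart X c" and W: "openin X W" "W \<subseteq> fst c"
  shows "openin (top_of_set (chart_space c)) (snd c ` W)"
proof -
  have "open_map (subtopology X (fst c)) (top_of_set (chart_image c)) (snd c)"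
    using c unfolding is_chart_def by (simp add: homeomorphic_imp_open_map)
  moreover have "openin (subtopology X (fst c)) W"
    using W is_chart_openin[OF c] by (simp add: openin_open_subtopology)
  ultimately have "openin (top_of_set (chart_image c)) (snd c ` W)"
    unfolding open_map_def by blast
  then show ?thesis using is_chart_openin_image[OF c] by (rule openin_trans)
qed

lemma chart_openin_vimage:
  assumes c: "is_chart X c" and T: "open T"
  shows "openin X {p \<in> fst c. snd c p \<in> T}"
proof -
  have "continuous_map (subtopology X (fst c)) (top_of_set (chart_image c)) (snd c)"
    using c unfolding is_chart_def by (simp add: homeomorphic_imp_continuous_map)
  then have "continuous_map (subtopology X (fst c)) euclidean (snd c)"
    by (simp add: continuous_map_in_subtopology)
  then have "openin (subtopology X (fst c)) {p \<in> topspace (subtopology X (fst c)). snd c p \<in> T}"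
    using T by (intro openin_continuous_map_preimage) auto
  moreover have "topspace (subtopology X (fst c)) = fst c"
    using openin_subset[OF is_chart_openin[OF c]] by auto
  ultimately have "openin (subtopology X (fst c)) {p \<in> fst c. snd c p \<in> T}" by (simp only:)
  then show ?thesis using is_chart_openin[OF c] by (simp add: openin_open_subtopology)
qed

text \<open>Transfers neighbourhoods from the manifold to the surrounding Euclidean space, which is
  where \<open>smooth_on\<close> is localised.\<close>

lemma chart_local_set:
  assumes c: "is_chart X c" and W: "openin X W"
  obtains T where "open T" "\<And>q. q \<in> fst c \<Longrightarrow> snd c q \<in> T \<longleftrightarrow> q \<in> W"
proof -
  have "openin X (W \<inter> fst c)" using W is_chart_openin[OF c] by blast
  from chart_openin_image[OF c this] obtain T where T: "open T"
    "snd c ` (W \<inter> fst c) = chart_space c \<inter> T"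
    by (auto simp: openin_open)
  have "snd c q \<in> T \<longleftrightarrow> q \<in> W" if q: "q \<in> fst c" for q
  proof
    assume "snd c q \<in> T"
    then have "snd c q \<in> snd c ` (W \<inter> fst c)" using T(2) chart_in_space[OF q] by simp
    then show "q \<in> W" using is_chart_inj_on[OF c] q by (auto dest: inj_onD)
  next
    assume "q \<in> W"
    then have "snd c q \<in> snd c ` (W \<inter> fst c)" using q by simp
    then show "snd c q \<in> T" unfolding T(2) by simp
  qed
  then show ?thesis using that T(1) by blast
qed

lemma chart_smooth_on_local:
  assumes c: "is_chart X c" "A \<subseteq> fst c"
    and loc: "\<And>p. p \<in> A \<Longrightarrow> \<exists>W. openin X W \<and> p \<in> W \<and> smooth_on (snd c ` (A \<inter> W)) f"
  shows "smooth_on (snd c ` A) f"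
proof (rule smooth_on_local)
  fix x assume "x \<in> snd c ` A"
  then obtain p where p: "p \<in> A" "x = snd c p" by blast
  obtain W where W: "openin X W" "p \<in> W" "smooth_on (snd c ` (A \<inter> W)) f"
    using loc[OF p(1)] by blast
  obtain T where T: "open T" "\<And>q. q \<in> fst c \<Longrightarrow> snd c q \<in> T \<longleftrightarrow> q \<in> W"
    by (rule chart_local_set[OF c(1) W(1)]) blast
  have "snd c ` A \<inter> T \<subseteq> snd c ` (A \<inter> W)" using T(2) c(2) by blast
  then show "\<exists>T. open T \<and> x \<in> T \<and> smooth_on (snd c ` A \<inter> T) f"
    using T p W c(2) smooth_on_subset[OF W(3)] by blast
qed

text \<open>A momentum level set over a punctured line need not be closed, so that its paracompactness
  would require metrizability of the ambient manifold.\<close>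

definition premanifold :: "('a, 'e::euclidean_space) mfd \<Rightarrow> bool" where
  "premanifold M \<longleftrightarrow>
     (\<forall>c\<in>atlas M. is_chart (mtop M) c) \<and>
     (\<forall>c\<in>atlas M. \<forall>c'\<in>atlas M. compatible_charts c c') \<and>
     (\<Union>c\<in>atlas M. fst c) = points M"

lemma smooth_manifold_iff_premanifold:
  "smooth_manifold M \<longleftrightarrow>
    Hausdorff_space (mtop M) \<and> paracompact_space (mtop M) \<and> premanifold M"
  unfolding smooth_manifold_def premanifold_def by (rule refl)

text \<open>Membership in the maximal atlas: the slice charts that make up the atlas of
  \<open>submfd M B\<close>, and the charts constructed for level sets, need not belong to
  \<open>atlas M\<close>.\<close>

definition max_chart :: "('a, 'e::euclidean_space) mfd \<Rightarrow> ('a, 'e) chart \<Rightarrow> bool" where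
  "max_chart M c \<longleftrightarrow> is_chart (mtop M) c \<and> (\<forall>c'\<in>atlas M. compatible_charts c c')"

lemma max_chart_is_chart: "max_chart M c \<Longrightarrow> is_chart (mtop M) c"
  by (simp add: max_chart_def)

lemma atlas_max_chart: "premanifold M \<Longrightarrow> c \<in> atlas M \<Longrightarrow> max_chart M c"
  by (simp add: premanifold_def max_chart_def)

lemma premanifold_chart_at:
  assumes "premanifold M" "p \<in> points M"
  obtains c where "c \<in> atlas M" "p \<in> fst c"
  using assms unfolding premanifold_def by blast

lemma compatible_chartsD:
  assumes "compatible_charts c c'"
  shows "smooth_on (snd c ` (fst c \<inter> fst c')) (\<lambda>x. snd c' (chart_inv c x))"
    "smooth_on (snd c' ` (fst c \<inter> fst c')) (\<lambda>x. snd c (chart_inv c' x))"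
  using assms unfolding compatible_charts_def o_def by auto

text \<open>Each of the two charts is known to be compatible only with the atlas, so near every
  point the coordinate change is factored through an atlas chart \<open>d\<close>.\<close>

lemma max_chart_transition:
  assumes M: "premanifold M" and c: "max_chart M c" and c': "max_chart M c'"
  shows "smooth_on (snd c ` (fst c \<inter> fst c')) (\<lambda>x. snd c' (chart_inv c x))"
proof (rule chart_smooth_on_local[OF max_chart_is_chart[OF c]])
  note chc = max_chart_is_chart[OF c]
  fix p assume p: "p \<in> fst c \<inter> fst c'"
  then have "p \<in> points M" using openin_subset[OF is_chart_openin[OF chc]] by blast
  then obtain d where d: "d \<in> atlas M" "p \<in> fst d" by (rule premanifold_chart_at[OF M])
  have chd: "is_chart (mtop M) d" using d(1) M by (simp add: premanifold_def)
  let ?B = "snd c ` (fst c \<inter> fst c' \<inter> fst d)"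
  have "smooth_on ?B (\<lambda>x. snd c' (chart_inv d (snd d (chart_inv c x))))"
  proof (rule smooth_on_compose[where g = "\<lambda>x. snd c' (chart_inv d x)"])
    show "smooth_on ?B (\<lambda>x. snd d (chart_inv c x))"
      by (rule smooth_on_subset[OF compatible_chartsD(1)]) (use c d(1) in \<open>auto simp: max_chart_def\<close>)
    show "smooth_on (snd d ` (fst c' \<inter> fst d)) (\<lambda>x. snd c' (chart_inv d x))"
      by (rule compatible_chartsD(2)) (use c' d(1) in \<open>auto simp: max_chart_def\<close>)
    show "(\<lambda>x. snd d (chart_inv c x)) ` ?B \<subseteq> snd d ` (fst c' \<inter> fst d)"
      using chart_inv_left[OF chc] by auto
  qed
  then have "smooth_on ?B (\<lambda>x. snd c' (chart_inv c x))"
    by (rule smooth_on_cong_subset) (auto simp: chart_inv_left[OF chc] chart_inv_left[OF chd])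
  then show "\<exists>W. openin (mtop M) W \<and> p \<in> W \<and>
      smooth_on (snd c ` (fst c \<inter> fst c' \<inter> W)) (\<lambda>x. snd c' (chart_inv c x))"
    using is_chart_openin[OF chd] d(2) by blast
qed auto

text \<open>Smoothness of a map on an arbitrary subset of a manifold lets level sets, their quotients and
  local sections be treated uniformly.\<close>

definition smooth_rel ::
  "('a, 'e::euclidean_space) mfd \<Rightarrow> 'a set \<Rightarrow> ('b, 'f::euclidean_space) mfd \<Rightarrow> ('a \<Rightarrow> 'b) \<Rightarrow> bool" where
  "smooth_rel M A N f \<longleftrightarrow> (\<forall>p\<in>A. \<exists>c c' U. max_chart M c \<and> max_chart N c' \<and>
     openin (mtop M) U \<and> p \<in> U \<and> U \<subseteq> fst c \<and> f ` (A \<inter> U) \<subseteq> fst c' \<and>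
     smooth_on (snd c ` (A \<inter> U)) (\<lambda>x. snd c' (f (chart_inv c x))))"

section \<open>Calculus of maps that are smooth on a subset\<close>

lemma smooth_relE:
  assumes "smooth_rel M A N f" "p \<in> A"
  obtains c c' U where "max_chart M c" "max_chart N c'" "openin (mtop M) U" "p \<in> U" "U \<subseteq> fst c"
    "f ` (A \<inter> U) \<subseteq> fst c'" "smooth_on (snd c ` (A \<inter> U)) (\<lambda>x. snd c' (f (chart_inv c x)))"
proof -
  from bspec[OF assms(1)[unfolded smooth_rel_def] assms(2)] show thesis
    by (elim exE conjE) (rule that)
qed

lemma smooth_relI:
  assumes "\<And>p. p \<in> A \<Longrightarrow> \<exists>c c' U. max_chart M c \<and> max_chart N c' \<and>
     openin (mtop M) U \<and> p \<in> U \<and> U \<subseteq> fst c \<and> f ` (A \<inter> U) \<subseteq> fst c' \<and>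
     smooth_on (snd c ` (A \<inter> U)) (\<lambda>x. snd c' (f (chart_inv c x)))"
  shows "smooth_rel M A N f"
  using assms unfolding smooth_rel_def by (rule ballI)

lemma smooth_rel_cong_subset:
  assumes f: "smooth_rel M A N f" and B: "B \<subseteq> A" "\<And>p. p \<in> B \<Longrightarrow> f p = g p"
  shows "smooth_rel M B N g"
proof (rule smooth_relI)
  fix p assume "p \<in> B"
  then have "p \<in> A" using B by auto
  then obtain c c' U where *: "max_chart M c" "max_chart N c'" "openin (mtop M) U" "p \<in> U" "U \<subseteq> fst c"
    "f ` (A \<inter> U) \<subseteq> fst c'" "smooth_on (snd c ` (A \<inter> U)) (\<lambda>x. snd c' (f (chart_inv c x)))"
    by (rule smooth_relE[OF f])
  have "g ` (B \<inter> U) \<subseteq> fst c'" using * B by auto (metis IntI image_subset_iff subsetD)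
  moreover have "smooth_on (snd c ` (B \<inter> U)) (\<lambda>x. snd c' (g (chart_inv c x)))"
    by (rule smooth_on_cong_subset[OF *(7)])
      (use B chart_inv_left[OF max_chart_is_chart[OF *(1)]] *(5) in auto)
  ultimately show "\<exists>c c' U. max_chart M c \<and> max_chart N c' \<and>
     openin (mtop M) U \<and> p \<in> U \<and> U \<subseteq> fst c \<and> g ` (B \<inter> U) \<subseteq> fst c' \<and>
     smooth_on (snd c ` (B \<inter> U)) (\<lambda>x. snd c' (g (chart_inv c x)))"
    using *(1-5) by blast
qed

lemmas smooth_rel_subset = smooth_rel_cong_subset[OF _ _ refl]

lemma smooth_rel_local:
  assumes "\<And>p. p \<in> A \<Longrightarrow> \<exists>V. openin (mtop M) V \<and> p \<in> V \<and> smooth_rel M (A \<inter> V) N f"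
  shows "smooth_rel M A N f"
proof (rule smooth_relI)
  fix p assume p: "p \<in> A"
  then obtain V where V: "openin (mtop M) V" "p \<in> V" "smooth_rel M (A \<inter> V) N f" using assms by blast
  have "p \<in> A \<inter> V" using p V by blast
  then obtain c c' U where *: "max_chart M c" "max_chart N c'" "openin (mtop M) U" "p \<in> U" "U \<subseteq> fst c"
    "f ` (A \<inter> V \<inter> U) \<subseteq> fst c'" "smooth_on (snd c ` (A \<inter> V \<inter> U)) (\<lambda>x. snd c' (f (chart_inv c x)))"
    by (rule smooth_relE[OF V(3)])
  have "openin (mtop M) (V \<inter> U)" "p \<in> V \<inter> U" "V \<inter> U \<subseteq> fst c" using V * by auto
  moreover have "A \<inter> V \<inter> U = A \<inter> (V \<inter> U)" by blast
  ultimately show "\<exists>c c' U. max_chart M c \<and> max_chart N c' \<and>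
     openin (mtop M) U \<and> p \<in> U \<and> U \<subseteq> fst c \<and> f ` (A \<inter> U) \<subseteq> fst c' \<and>
     smooth_on (snd c ` (A \<inter> U)) (\<lambda>x. snd c' (f (chart_inv c x)))"
    using *(1,2,6,7) by metis
qed

lemma smooth_rel_points:
  assumes "smooth_rel M A N f" shows "A \<subseteq> points M" "f ` A \<subseteq> points N"
proof -
  show "A \<subseteq> points M"
  proof
    fix p assume "p \<in> A"
    then obtain U where "openin (mtop M) U" "p \<in> U" using smooth_relE[OF assms] by metis
    then show "p \<in> points M" using openin_subset by blast
  qed
  show "f ` A \<subseteq> points N"
  proof
    fix q assume "q \<in> f ` A"
    then obtain p where p: "p \<in> A" "q = f p" by blast
    then obtain c' U where "max_chart N c'" "p \<in> U" "f ` (A \<inter> U) \<subseteq> fst c'"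
      using smooth_relE[OF assms] by metis
    then show "q \<in> points N"
      using p openin_subset[OF is_chart_openin[OF max_chart_is_chart]] by blast
  qed
qed

text \<open>Continuity at \<open>p\<close>: the coordinate expression is continuous on its domain,
  and charts translate open sets on both sides.\<close>

lemma smooth_rel_nhd:
  assumes f: "smooth_rel M A N f" and p: "p \<in> A" and W: "openin (mtop N) W" "f p \<in> W"
  obtains V where "openin (mtop M) V" "p \<in> V" "f ` (A \<inter> V) \<subseteq> W"
proof -
  obtain c c' U where *: "max_chart M c" "max_chart N c'" "openin (mtop M) U" "p \<in> U" "U \<subseteq> fst c"
    "f ` (A \<inter> U) \<subseteq> fst c'" and sm: "smooth_on (snd c ` (A \<inter> U)) (\<lambda>x. snd c' (f (chart_inv c x)))"
    by (rule smooth_relE[OF f p])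
  note ch = max_chart_is_chart[OF *(1)]
  obtain T where T: "open T" "\<And>q. q \<in> fst c' \<Longrightarrow> snd c' q \<in> T \<longleftrightarrow> q \<in> W"
    by (rule chart_local_set[OF max_chart_is_chart[OF *(2)] W(1)]) blast
  obtain R where R: "open R"
    "R \<inter> snd c ` (A \<inter> U) = (\<lambda>x. snd c' (f (chart_inv c x))) -` T \<inter> snd c ` (A \<inter> U)"
    using smooth_on_imp_continuous_on[OF sm] T(1) unfolding continuous_on_open_invariant by metis
  let ?V = "U \<inter> {q \<in> fst c. snd c q \<in> R}"
  have key: "snd c q \<in> R \<longleftrightarrow> f q \<in> W" if q: "q \<in> A" "q \<in> U" for q
  proof -
    have "snd c q \<in> R \<longleftrightarrow> snd c' (f (chart_inv c (snd c q))) \<in> T"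
      using R(2) q by blast
    also have "\<dots> \<longleftrightarrow> f q \<in> W"
    proof -
      have "q \<in> fst c" "f q \<in> fst c'" using q *(5,6) by auto
      then show ?thesis using T(2) chart_inv_left[OF ch] by simp
    qed
    finally show ?thesis .
  qed
  show ?thesis
  proof (rule that)
    show "openin (mtop M) ?V" using *(3) chart_openin_vimage[OF ch R(1)] by blast
    show "p \<in> ?V" using key[OF p *(4)] W(2) *(4,5) by auto
    show "f ` (A \<inter> ?V) \<subseteq> W" using key by auto
  qed
qed

lemma smooth_rel_continuous_map:
  assumes f: "smooth_rel M A N f"
  shows "continuous_map (subtopology (mtop M) A) (mtop N) f"
  unfolding continuous_map_def
proof (intro conjI allI impI)
  show "f \<in> topspace (subtopology (mtop M) A) \<rightarrow> points N"
    using smooth_rel_points[OF f] by auto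
  fix W assume W: "openin (mtop N) W"
  have A: "topspace (subtopology (mtop M) A) = A" using smooth_rel_points(1)[OF f] by auto
  show "openin (subtopology (mtop M) A) {x \<in> topspace (subtopology (mtop M) A). f x \<in> W}"
    unfolding A
  proof (subst openin_subopen, intro ballI)
    fix p assume p: "p \<in> {x \<in> A. f x \<in> W}"
    then obtain V where "openin (mtop M) V" "p \<in> V" "f ` (A \<inter> V) \<subseteq> W"
      using smooth_rel_nhd[OF f _ W] by blast
    then show "\<exists>T. openin (subtopology (mtop M) A) T \<and> p \<in> T \<and> T \<subseteq> {x \<in> A. f x \<in> W}"
      using p by (intro exI[of _ "V \<inter> A"]) (auto simp: openin_subtopology)
  qed
qed

text \<open>The definition offers some pair of charts at each point; coordinate changes on both
  sides carry smoothness over to any given pair.\<close>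

lemma smooth_rel_in_charts:
  assumes M: "premanifold M" and N: "premanifold N" and f: "smooth_rel M A N f"
    and c: "max_chart M c" and c': "max_chart N c'"
  shows "smooth_on (snd c ` {p \<in> A \<inter> fst c. f p \<in> fst c'}) (\<lambda>x. snd c' (f (chart_inv c x)))"
    (is "smooth_on (snd c ` ?A) _")
proof (rule chart_smooth_on_local[OF max_chart_is_chart[OF c]])
  note chc = max_chart_is_chart[OF c] and chc' = max_chart_is_chart[OF c']
  fix p assume p: "p \<in> ?A"
  then have pA: "p \<in> A" by simp
  obtain d d' U where *: "max_chart M d" "max_chart N d'" "openin (mtop M) U" "p \<in> U" "U \<subseteq> fst d"
    "f ` (A \<inter> U) \<subseteq> fst d'" and sm: "smooth_on (snd d ` (A \<inter> U)) (\<lambda>x. snd d' (f (chart_inv d x)))"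
    by (rule smooth_relE[OF f pA])
  note chd = max_chart_is_chart[OF *(1)] and chd' = max_chart_is_chart[OF *(2)]
  let ?B = "snd c ` (?A \<inter> U)"
  have "smooth_on ?B (\<lambda>x. snd c' (chart_inv d' (snd d' (f (chart_inv d (snd d (chart_inv c x)))))))"
  proof (rule smooth_on_compose[where g = "\<lambda>x. snd c' (chart_inv d' x)"])
    show "smooth_on ?B (\<lambda>x. snd d' (f (chart_inv d (snd d (chart_inv c x)))))"
    proof (rule smooth_on_compose[OF _ sm])
      show "smooth_on ?B (\<lambda>x. snd d (chart_inv c x))"
        by (rule smooth_on_subset[OF max_chart_transition[OF M c *(1)]]) (use *(5) in auto)
      show "(\<lambda>x. snd d (chart_inv c x)) ` ?B \<subseteq> snd d ` (A \<inter> U)"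
        using chart_inv_left[OF chc] by auto
    qed
    show "smooth_on (snd d' ` (fst d' \<inter> fst c')) (\<lambda>x. snd c' (chart_inv d' x))"
      by (rule max_chart_transition[OF N *(2) c'])
    show "(\<lambda>x. snd d' (f (chart_inv d (snd d (chart_inv c x))))) ` ?B \<subseteq> snd d' ` (fst d' \<inter> fst c')"
    proof clarsimp
      fix q assume q: "q \<in> U" "q \<in> A" "q \<in> fst c" "f q \<in> fst c'"
      then have "q \<in> fst d" "f q \<in> fst d'" using *(5,6) by auto
      then show "snd d' (f (chart_inv d (snd d (chart_inv c (snd c q))))) \<in> snd d' ` (fst d' \<inter> fst c')"
        using q chart_inv_left[OF chc] chart_inv_left[OF chd] by simp
    qed
  qed
  then have "smooth_on ?B (\<lambda>x. snd c' (f (chart_inv c x)))"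
  proof (rule smooth_on_cong_subset)
    fix x assume "x \<in> ?B"
    then obtain q where q: "x = snd c q" "q \<in> ?A" "q \<in> U" by blast
    then have "f q \<in> fst d'" using *(6) by auto
    then show "snd c' (chart_inv d' (snd d' (f (chart_inv d (snd d (chart_inv c x))))))
        = snd c' (f (chart_inv c x))"
      using q *(5) chart_inv_left[OF chc, of q] chart_inv_left[OF chd, of q]
        chart_inv_left[OF chd', of "f q"] by auto
  qed simp
  then show "\<exists>W. openin (mtop M) W \<and> p \<in> W \<and> smooth_on (snd c ` (?A \<inter> W)) (\<lambda>x. snd c' (f (chart_inv c x)))"
    using *(3,4) by blast
qed auto

lemma smooth_rel_compose:
  assumes M: "premanifold M" and N: "premanifold N"
    and f: "smooth_rel M A N f" and g: "smooth_rel N B Q g" and fB: "f ` A \<subseteq> B"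
  shows "smooth_rel M A Q (\<lambda>p. g (f p))"
proof (rule smooth_relI)
  fix p assume p: "p \<in> A"
  then have fp: "f p \<in> B" using fB by auto
  obtain c e U where c: "max_chart M c" "max_chart N e" "openin (mtop M) U" "p \<in> U" "U \<subseteq> fst c"
    "f ` (A \<inter> U) \<subseteq> fst e" "smooth_on (snd c ` (A \<inter> U)) (\<lambda>x. snd e (f (chart_inv c x)))"
    by (rule smooth_relE[OF f p])
  obtain d d' V where d: "max_chart N d" "max_chart Q d'" "openin (mtop N) V" "f p \<in> V" "V \<subseteq> fst d"
    "g ` (B \<inter> V) \<subseteq> fst d'" and sm: "smooth_on (snd d ` (B \<inter> V)) (\<lambda>x. snd d' (g (chart_inv d x)))"
    by (rule smooth_relE[OF g fp])
  note chc = max_chart_is_chart[OF c(1)] and chd = max_chart_is_chart[OF d(1)]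
  obtain W where W: "openin (mtop M) W" "p \<in> W" "f ` (A \<inter> W) \<subseteq> V"
    by (rule smooth_rel_nhd[OF f p d(3,4)])
  let ?U = "U \<inter> W"
  have "smooth_on (snd c ` (A \<inter> ?U)) (\<lambda>x. snd d' (g (chart_inv d (snd d (f (chart_inv c x))))))"
  proof (rule smooth_on_compose[OF _ sm])
    show "smooth_on (snd c ` (A \<inter> ?U)) (\<lambda>x. snd d (f (chart_inv c x)))"
      by (intro smooth_on_subset[OF smooth_rel_in_charts[OF M N f c(1) d(1)]] image_mono)
        (use c(5) d(5) W(3) in auto)
    show "(\<lambda>x. snd d (f (chart_inv c x))) ` snd c ` (A \<inter> ?U) \<subseteq> snd d ` (B \<inter> V)"
    proof (clarsimp)
      fix q assume q: "q \<in> A" "q \<in> U" "q \<in> W"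
      then have "chart_inv c (snd c q) = q" using c(5) by (intro chart_inv_left[OF chc]) auto
      then show "snd d (f (chart_inv c (snd c q))) \<in> snd d ` (B \<inter> V)" using q W(3) fB by auto
    qed
  qed
  then have "smooth_on (snd c ` (A \<inter> ?U)) (\<lambda>x. snd d' (g (f (chart_inv c x))))"
  proof (rule smooth_on_cong_subset)
    fix x assume "x \<in> snd c ` (A \<inter> ?U)"
    then obtain q where q: "x = snd c q" "q \<in> A" "q \<in> U" "q \<in> W" by blast
    then have "chart_inv c x = q" using c(5) by (auto intro: chart_inv_left[OF chc])
    moreover have "f q \<in> fst d" using q W(3) d(5) by auto
    ultimately show "snd d' (g (chart_inv d (snd d (f (chart_inv c x))))) = snd d' (g (f (chart_inv c x)))"
      using chart_inv_left[OF chd] by simp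
  qed simp
  moreover have "(\<lambda>p. g (f p)) ` (A \<inter> ?U) \<subseteq> fst d'" using W(3) fB d(6) by auto
  moreover have "openin (mtop M) ?U" "p \<in> ?U" "?U \<subseteq> fst c" using c W by auto
  ultimately show "\<exists>c c' U. max_chart M c \<and> max_chart Q c' \<and>
     openin (mtop M) U \<and> p \<in> U \<and> U \<subseteq> fst c \<and> (\<lambda>p. g (f p)) ` (A \<inter> U) \<subseteq> fst c' \<and>
     smooth_on (snd c ` (A \<inter> U)) (\<lambda>x. snd c' (g (f (chart_inv c x))))"
    using c(1) d(2) by blast
qed

lemma smooth_map_imp_smooth_rel:
  assumes M: "premanifold M" and N: "premanifold N" and f: "smooth_map M N f"
  shows "smooth_rel M (points M) N f"
proof (rule smooth_relI)
  fix p assume p: "p \<in> points M"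
  have cont: "continuous_map (mtop M) (mtop N) f"
    and sm: "\<And>c c'. c \<in> atlas M \<Longrightarrow> c' \<in> atlas N \<Longrightarrow>
      smooth_on (snd c ` {p \<in> fst c. f p \<in> fst c'}) (\<lambda>x. snd c' (f (chart_inv c x)))"
    using f unfolding smooth_map_def o_def by auto
  obtain c where c: "c \<in> atlas M" "p \<in> fst c" by (rule premanifold_chart_at[OF M p])
  have "f p \<in> points N" using cont p by (auto simp: continuous_map_def)
  then obtain c' where c': "c' \<in> atlas N" "f p \<in> fst c'" by (rule premanifold_chart_at[OF N])
  note mc = atlas_max_chart[OF M c(1)] atlas_max_chart[OF N c'(1)]
  let ?U = "fst c \<inter> {q \<in> points M. f q \<in> fst c'}"
  have "openin (mtop M) ?U"
    using is_chart_openin[OF max_chart_is_chart[OF mc(1)]] is_chart_openin[OF max_chart_is_chart[OF mc(2)]]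
    by (intro openin_Int openin_continuous_map_preimage[OF cont])
  moreover have "smooth_on (snd c ` (points M \<inter> ?U)) (\<lambda>x. snd c' (f (chart_inv c x)))"
    by (rule smooth_on_subset[OF sm[OF c(1) c'(1)]]) auto
  ultimately show "\<exists>c c' U. max_chart M c \<and> max_chart N c' \<and>
     openin (mtop M) U \<and> p \<in> U \<and> U \<subseteq> fst c \<and> f ` (points M \<inter> U) \<subseteq> fst c' \<and>
     smooth_on (snd c ` (points M \<inter> U)) (\<lambda>x. snd c' (f (chart_inv c x)))"
    using mc c(2) c'(2) p by (intro exI[of _ c] exI[of _ c'] exI[of _ ?U]) auto
qed

lemma smooth_rel_imp_smooth_map:
  assumes M: "premanifold M" and N: "premanifold N" and f: "smooth_rel M (points M) N f"
  shows "smooth_map M N f"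
  unfolding smooth_map_def o_def
proof (intro conjI ballI)
  show "continuous_map (mtop M) (mtop N) f"
    using smooth_rel_continuous_map[OF f] by simp
  fix c c' assume c: "c \<in> atlas M" and c': "c' \<in> atlas N"
  have "fst c \<subseteq> points M"
    using openin_subset[OF is_chart_openin[OF max_chart_is_chart[OF atlas_max_chart[OF M c]]]] .
  then show "smooth_on (snd c ` {p \<in> fst c. f p \<in> fst c'}) (\<lambda>x. snd c' (f (chart_inv c x)))"
    by (intro smooth_on_subset[OF smooth_rel_in_charts[OF M N f
            atlas_max_chart[OF M c] atlas_max_chart[OF N c']]]) auto
qed

lemma smooth_rel_ident:
  assumes M: "premanifold M" "A \<subseteq> points M"
  shows "smooth_rel M A M (\<lambda>p. p)"
proof (rule smooth_relI)
  fix p assume "p \<in> A"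
  then obtain c where c: "c \<in> atlas M" "p \<in> fst c"
    using premanifold_chart_at[OF M(1)] M(2) by blast
  note mc = atlas_max_chart[OF M(1) c(1)]
  note ch = max_chart_is_chart[OF mc]
  have "smooth_on (snd c ` (A \<inter> fst c)) (\<lambda>x. snd c (chart_inv c x))"
    by (rule smooth_on_cong_subset[OF smooth_on_ident subset_refl]) (auto simp: chart_inv_left[OF ch])
  then show "\<exists>c c' U. max_chart M c \<and> max_chart M c' \<and>
     openin (mtop M) U \<and> p \<in> U \<and> U \<subseteq> fst c \<and> (\<lambda>p. p) ` (A \<inter> U) \<subseteq> fst c' \<and>
     smooth_on (snd c ` (A \<inter> U)) (\<lambda>x. snd c' (chart_inv c x))"
    using mc c(2) is_chart_openin[OF ch]
    by (intro exI[of _ c] exI[of _ c] exI[of _ "fst c"]) auto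
qed

section \<open>Submanifolds and tangent vectors\<close>

lemma slice_chart_max_chart: "slice_chart M B c \<Longrightarrow> max_chart M c"
  by (simp add: slice_chart_def max_chart_def)

lemma chart_inv_restrict:
  assumes "is_chart X c" "q \<in> fst c \<inter> B"
  shows "chart_inv (fst c \<inter> B, snd c) (snd c q) = q"
  unfolding chart_inv_def using assms inj_on_subset[OF is_chart_inj_on[OF assms(1)] Int_lower1]
  by simp

lemma is_chart_restrict:
  assumes "slice_chart M B c"
  shows "is_chart (mtop (submfd M B)) (fst c \<inter> B, snd c)"
proof -
  have c: "is_chart (mtop M) c" using assms by (simp add: slice_chart_def)
  obtain W where W: "subspace W" "snd c ` (fst c \<inter> B) = chart_image c \<inter> W"
    using assms by (auto simp: slice_chart_def)
  let ?d = "(fst c \<inter> B, snd c)"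
  have img: "chart_image ?d = chart_image c \<inter> W" using W(2) by (simp add: chart_image_def)
  have "openin (top_of_set (chart_space c \<inter> W)) (chart_image c \<inter> W)"
    using is_chart_openin_image[OF c] by (auto simp: openin_open)
  moreover have "subspace (chart_space c \<inter> W)" using subspace_chart_space W(1) by (rule subspace_inter)
  \<comment> \<open>The span of an empty image is \<open>{0}\<close>, whatever \<open>W\<close> is,
    so the identity may fail for a chart that misses \<open>B\<close>; that case is treated
    separately.\<close>
  ultimately have "chart_space ?d = chart_space c \<inter> W" if "chart_image ?d \<noteq> {}"
    using that unfolding chart_space_def[of ?d] img by (intro span_openin_subspace)
  then have "openin (top_of_set (chart_space ?d)) (chart_image ?d)"
    using \<open>openin (top_of_set (chart_space c \<inter> W)) (chart_image c \<inter> W)\<close> img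
    by (cases "chart_image ?d = {}") auto
  moreover have "openin (subtopology (mtop M) B) (fst c \<inter> B)"
    using is_chart_openin[OF c] by (auto simp: openin_subtopology)
  moreover have "homeomorphic_map (subtopology (subtopology (mtop M) B) (fst c \<inter> B))
      (top_of_set (chart_image ?d)) (snd c)"
  proof -
    have top: "topspace (subtopology (mtop M) (fst c)) = fst c"
      using openin_subset[OF is_chart_openin[OF c]] by auto
    have hom: "homeomorphic_map (subtopology (mtop M) (fst c)) (top_of_set (chart_image c)) (snd c)"
      using c by (simp add: is_chart_def)
    have "homeomorphic_map (subtopology (subtopology (mtop M) (fst c)) B)
        (subtopology (top_of_set (chart_image c)) W) (snd c)"
      by (rule homeomorphic_map_subtopologies[OF hom]) (simp only: top W(2) topspace_euclidean_subtopology)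
    moreover have "subtopology (subtopology (mtop M) (fst c)) B
        = subtopology (subtopology (mtop M) B) (fst c \<inter> B)"
      by (simp add: subtopology_subtopology Int_ac)
    moreover have "subtopology (top_of_set (chart_image c)) W = top_of_set (chart_image ?d)"
      by (simp add: subtopology_subtopology img)
    ultimately show ?thesis by simp
  qed
  ultimately show ?thesis by (simp add: is_chart_def submfd_def)
qed

lemma embedded_submanifold_slice:
  assumes "embedded_submanifold M B" "p \<in> B"
  obtains c where "slice_chart M B c" "p \<in> fst c"
proof -
  have "\<exists>c. slice_chart M B c \<and> p \<in> fst c" using assms by (simp add: embedded_submanifold_def)
  then show thesis by (elim exE conjE) (rule that)
qed

lemma embedded_submanifold_subset: "embedded_submanifold M B \<Longrightarrow> B \<subseteq> points M"
  by (simp add: embedded_submanifold_def)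

lemma points_submfd: "B \<subseteq> points M \<Longrightarrow> points (submfd M B) = B"
  by (auto simp: submfd_def)

lemma premanifold_submfd:
  assumes M: "premanifold M" and B: "embedded_submanifold M B"
  shows "premanifold (submfd M B)"
  unfolding premanifold_def
proof (intro conjI ballI)
  show "is_chart (mtop (submfd M B)) c" if "c \<in> atlas (submfd M B)" for c
    using that is_chart_restrict by (auto simp: submfd_def)
  have half: "smooth_on (snd c ` ((fst c \<inter> B) \<inter> (fst d \<inter> B)))
      (\<lambda>x. snd d (chart_inv (fst c \<inter> B, snd c) x))"
    if c: "slice_chart M B c" and d: "slice_chart M B d" for c d
  proof (rule smooth_on_cong_subset[OF max_chart_transition[OF M]])
    show "max_chart M c" "max_chart M d" using that slice_chart_max_chart by blast+
    note ch = max_chart_is_chart[OF \<open>max_chart M c\<close>]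
    show "snd d (chart_inv c x) = snd d (chart_inv (fst c \<inter> B, snd c) x)"
      if "x \<in> snd c ` ((fst c \<inter> B) \<inter> (fst d \<inter> B))" for x
      using that chart_inv_left[OF ch] chart_inv_restrict[OF ch] by auto
  qed blast
  fix c c' assume "c \<in> atlas (submfd M B)" "c' \<in> atlas (submfd M B)"
  then obtain d d' where d: "slice_chart M B d" "c = (fst d \<inter> B, snd d)"
    "slice_chart M B d'" "c' = (fst d' \<inter> B, snd d')"
    by (auto simp: submfd_def)
  show "compatible_charts c c'"
    using half[OF d(1,3)] half[OF d(3,1)] unfolding compatible_charts_def o_def d(2,4) fst_conv snd_conv
    by (simp add: Int_ac)
next
  show "(\<Union>c\<in>atlas (submfd M B). fst c) = points (submfd M B)"
    unfolding points_submfd[OF embedded_submanifold_subset[OF B]]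
    using B unfolding embedded_submanifold_def by (force simp: submfd_def)
qed

lemma max_chart_submfd:
  assumes "premanifold M" "embedded_submanifold M B" "slice_chart M B c"
  shows "max_chart (submfd M B) (fst c \<inter> B, snd c)"
proof (rule atlas_max_chart[OF premanifold_submfd[OF assms(1,2)]])
  show "(fst c \<inter> B, snd c) \<in> atlas (submfd M B)"
    unfolding submfd_def mfd.simps using assms(3) by blast
qed

text \<open>Restricting a slice chart to \<open>B\<close> keeps its coordinate functions, so the
  coordinate expression of \<open>f\<close> is the same for \<open>M\<close> and for
  \<open>submfd M B\<close>.\<close>

lemma smooth_rel_into_submfd:
  assumes X: "premanifold X" and M: "premanifold M" and B: "embedded_submanifold M B"
    and f: "smooth_rel X A M f" and fB: "f ` A \<subseteq> B"
  shows "smooth_rel X A (submfd M B) f"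
proof (rule smooth_relI)
  fix p assume p: "p \<in> A"
  then have "f p \<in> B" using fB by auto
  then obtain c' where c': "slice_chart M B c'" "f p \<in> fst c'"
    by (rule embedded_submanifold_slice[OF B])
  note mc' = slice_chart_max_chart[OF c'(1)]
  obtain d U where d: "max_chart X d" "openin (mtop X) U" "p \<in> U" "U \<subseteq> fst d"
    by (rule smooth_relE[OF f p]) blast
  obtain V where V: "openin (mtop X) V" "p \<in> V" "f ` (A \<inter> V) \<subseteq> fst c'"
    by (rule smooth_rel_nhd[OF f p is_chart_openin[OF max_chart_is_chart[OF mc']] c'(2)])
  have "smooth_on (snd d ` (A \<inter> (U \<inter> V))) (\<lambda>x. snd c' (f (chart_inv d x)))"
    by (intro smooth_on_subset[OF smooth_rel_in_charts[OF X M f d(1) mc']] image_mono)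
      (use d(4) V(3) in auto)
  moreover have "openin (mtop X) (U \<inter> V)" "p \<in> U \<inter> V" "U \<inter> V \<subseteq> fst d"
    "f ` (A \<inter> (U \<inter> V)) \<subseteq> fst c' \<inter> B" using d V fB by auto
  ultimately show "\<exists>c c' U. max_chart X c \<and> max_chart (submfd M B) c' \<and>
     openin (mtop X) U \<and> p \<in> U \<and> U \<subseteq> fst c \<and> f ` (A \<inter> U) \<subseteq> fst c' \<and>
     smooth_on (snd c ` (A \<inter> U)) (\<lambda>x. snd c' (f (chart_inv c x)))"
    using d(1) max_chart_submfd[OF M B c'(1)]
    by (intro exI[of _ d] exI[of _ "(fst c' \<inter> B, snd c')"] exI[of _ "U \<inter> V"]) simp
qed

lemma smooth_rel_submfd_inclusion:
  assumes M: "premanifold M" and B: "embedded_submanifold M B"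
  shows "smooth_rel (submfd M B) B M (\<lambda>p. p)"
proof (rule smooth_relI)
  fix p assume p: "p \<in> B"
  then obtain c where c: "slice_chart M B c" "p \<in> fst c"
    by (rule embedded_submanifold_slice[OF B])
  note mc = slice_chart_max_chart[OF c(1)]
  note ch = max_chart_is_chart[OF mc]
  have "smooth_on (snd c ` (fst c \<inter> B)) (\<lambda>x. snd c (chart_inv (fst c \<inter> B, snd c) x))"
    by (rule smooth_on_cong_subset[OF smooth_on_ident subset_refl])
      (auto simp: chart_inv_restrict[OF ch])
  moreover have "openin (mtop (submfd M B)) (fst c \<inter> B)"
    using is_chart_openin[OF ch] by (auto simp: submfd_def openin_subtopology)
  moreover have "B \<inter> (fst c \<inter> B) = fst c \<inter> B" by blast
  ultimately show "\<exists>c c' U. max_chart (submfd M B) c \<and> max_chart M c' \<and>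
     openin (mtop (submfd M B)) U \<and> p \<in> U \<and> U \<subseteq> fst c \<and> (\<lambda>p. p) ` (B \<inter> U) \<subseteq> fst c' \<and>
     smooth_on (snd c ` (B \<inter> U)) (\<lambda>x. snd c' (chart_inv c x))"
    using mc p c(2) max_chart_submfd[OF M B c(1)]
    by (intro exI[of _ "(fst c \<inter> B, snd c)"] exI[of _ c] exI[of _ "fst c \<inter> B"]) auto
qed

lemma chart_inv_real_line: "chart_inv (UNIV, \<lambda>x::real. x) = (\<lambda>x. x)"
proof
  show "chart_inv (UNIV, \<lambda>x::real. x) x = x" for x
    unfolding chart_inv_def fst_conv snd_conv by (rule inv_into_f_f) simp_all
qed

lemma premanifold_real_line: "premanifold real_line"
proof -
  let ?c = "(UNIV, \<lambda>x::real. x)"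
  have "homeomorphic_map euclidean euclidean (\<lambda>x::real. x)"
    using homeomorphic_map_id[of euclidean euclidean, unfolded id_def] by (rule iffD2) (rule refl)
  then have "is_chart euclidean ?c"
    by (simp add: is_chart_def chart_image_def chart_space_def)
  moreover have "compatible_charts ?c ?c"
    unfolding compatible_charts_def by (simp add: o_def chart_inv_real_line smooth_on_ident)
  ultimately show ?thesis
    unfolding premanifold_def real_line_def by simp
qed

lemma real_line_chart: "max_chart real_line (UNIV, \<lambda>x::real. x)"
  by (rule atlas_max_chart[OF premanifold_real_line]) (simp add: real_line_def)

lemma chart_inv_in_points:
  assumes "is_chart (mtop M) c" "y \<in> chart_image c"
  shows "chart_inv c y \<in> points M"
  using openin_subset[OF is_chart_openin[OF assms(1)]] chart_inv_in[OF assms(2)] by (rule subsetD)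

section \<open>Coordinate expressions and their derivatives\<close>

lemma smooth_rel_chart_rep:
  assumes M: "premanifold M" and N: "premanifold N" and f: "smooth_rel M (points M) N f"
    and c: "max_chart M c" "p \<in> fst c" and d: "max_chart N d" "f p \<in> fst d"
  defines "D \<equiv> snd c ` {q \<in> fst c. f q \<in> fst d}"
  shows "openin (top_of_set (chart_space c)) D" "snd c p \<in> D"
    "smooth_on D (\<lambda>x. snd d (f (chart_inv c x)))"
    "(\<lambda>x. snd d (f (chart_inv c x))) ` D \<subseteq> chart_image d"
proof -
  note chc = max_chart_is_chart[OF c(1)] and chd = max_chart_is_chart[OF d(1)]
  have cM: "fst c \<subseteq> points M" using openin_subset[OF is_chart_openin[OF chc]] .
  have "continuous_map (mtop M) (mtop N) f" using smooth_rel_continuous_map[OF f] by simp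
  then have "openin (mtop M) {q \<in> points M. f q \<in> fst d}"
    using is_chart_openin[OF chd] by (rule openin_continuous_map_preimage)
  then have "openin (mtop M) (fst c \<inter> {q \<in> points M. f q \<in> fst d})"
    using is_chart_openin[OF chc] by blast
  moreover have eq: "fst c \<inter> {q \<in> points M. f q \<in> fst d} = {q \<in> fst c. f q \<in> fst d}" using cM by blast
  ultimately show "openin (top_of_set (chart_space c)) D"
    unfolding D_def by (intro chart_openin_image[OF chc]) auto
  show "snd c p \<in> D" using c(2) d(2) by (auto simp: D_def)
  have "{q \<in> points M \<inter> fst c. f q \<in> fst d} = {q \<in> fst c. f q \<in> fst d}" using cM by blast
  then show "smooth_on D (\<lambda>x. snd d (f (chart_inv c x)))"
    using smooth_rel_in_charts[OF M N f c(1) d(1)] by (simp add: D_def)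
  show "(\<lambda>x. snd d (f (chart_inv c x))) ` D \<subseteq> chart_image d"
    by (auto simp: D_def chart_inv_left[OF chc] chart_in_image)
qed

text \<open>The map \<open>g\<close> may be smooth only on a subset \<open>B\<close>. The derivative
  of the composite then still factors through that of \<open>f\<close>, which is enough for
  injectivity; if \<open>B\<close> is all of \<open>N\<close>, the factor \<open>L\<close> is the
  derivative of \<open>g\<close> itself.\<close>

lemma ddir_rep_chain:
  assumes M: "premanifold M" and N: "premanifold N" and Q: "premanifold Q"
    and f: "smooth_rel M (points M) N f" and g: "smooth_rel N B Q g" "f ` points M \<subseteq> B"
    and c: "max_chart M c" "p \<in> fst c" and d: "max_chart N d" "f p \<in> fst d"
    and e: "max_chart Q e" "g (f p) \<in> fst e"
  obtains L where "bounded_linear L"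
    "\<And>v. v \<in> chart_space c \<Longrightarrow> ddir (\<lambda>x. snd e (g (f (chart_inv c x)))) (snd c p) v
      = L (ddir (\<lambda>x. snd d (f (chart_inv c x))) (snd c p) v)"
    "\<And>w. B = points N \<Longrightarrow> w \<in> chart_space d \<Longrightarrow>
      ddir (\<lambda>y. snd e (g (chart_inv d y))) (snd d (f p)) w = L w"
proof -
  note chc = max_chart_is_chart[OF c(1)] and chd = max_chart_is_chart[OF d(1)]
  note fg = smooth_rel_compose[OF M N f g]
  let ?D = "snd c ` {q \<in> fst c. f q \<in> fst d} \<inter> snd c ` {q \<in> fst c. g (f q) \<in> fst e}"
  let ?E = "snd d ` {q \<in> B \<inter> fst d. g q \<in> fst e}"
  let ?f = "\<lambda>x. snd d (f (chart_inv c x))" and ?g = "\<lambda>y. snd e (g (chart_inv d y))"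
  note rf = smooth_rel_chart_rep[OF M N f c d] and rfg = smooth_rel_chart_rep[OF M Q fg c e]
  have D: "openin (top_of_set (chart_space c)) ?D" using rf(1) rfg(1) by (rule openin_Int)
  have xD: "snd c p \<in> ?D" using rf(2) rfg(2) by blast
  have smD: "smooth_on ?D ?f" by (rule smooth_on_subset[OF rf(3)]) blast
  have smE: "smooth_on ?E ?g" by (rule smooth_rel_in_charts[OF N Q g(1) d(1) e(1)])
  have cM: "fst c \<subseteq> points M" using openin_subset[OF is_chart_openin[OF chc]] .
  have D_rep: "\<exists>q. x = snd c q \<and> q \<in> fst c \<and> f q \<in> fst d \<and> g (f q) \<in> fst e \<and> chart_inv c x = q"
    if x: "x \<in> ?D" for x
  proof -
    obtain q q' where q: "x = snd c q" "q \<in> fst c" "f q \<in> fst d"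
      and q': "x = snd c q'" "q' \<in> fst c" "g (f q') \<in> fst e" using x by blast
    then have "q = q'" using chart_inv_left[OF chc] by metis
    then show ?thesis using q q' chart_inv_left[OF chc] by metis
  qed
  have fD: "?f ` ?D \<subseteq> ?E"
  proof
    fix y assume "y \<in> ?f ` ?D"
    then obtain x where x: "x \<in> ?D" "y = ?f x" by blast
    from D_rep[OF x(1)] obtain q where q: "q \<in> fst c" "f q \<in> fst d" "g (f q) \<in> fst e" "chart_inv c x = q"
      by blast
    then have "f q \<in> B" using cM g(2) by blast
    then show "y \<in> ?E" using q x(2) by blast
  qed
  have fx: "?f (snd c p) = snd d (f p)" using chart_inv_left[OF chc c(2)] by simp
  obtain L where L: "bounded_linear L"
    "\<And>v. v \<in> chart_space c \<Longrightarrow> ddir (\<lambda>y. ?g (?f y)) (snd c p) v = L (ddir ?f (snd c p) v)"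
    "\<And>W w. \<lbrakk>openin (top_of_set W) ?E; subspace W; w \<in> W\<rbrakk> \<Longrightarrow> ddir ?g (?f (snd c p)) w = L w"
    by (rule ddir_chain[OF smD D subspace_chart_space xD smE fD]) blast
  show ?thesis
  proof (rule that[OF L(1)])
    fix v assume v: "v \<in> chart_space c"
    have "ddir (\<lambda>x. snd e (g (f (chart_inv c x)))) (snd c p) v = ddir (\<lambda>y. ?g (?f y)) (snd c p) v"
    proof (rule ddir_cong[OF D subspace_chart_space xD v])
      fix y assume "y \<in> ?D"
      from D_rep[OF this] chart_inv_left[OF chd]
      show "snd e (g (f (chart_inv c y))) = ?g (?f y)" by auto
    qed
    then show "ddir (\<lambda>x. snd e (g (f (chart_inv c x)))) (snd c p) v = L (ddir ?f (snd c p) v)"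
      using L(2)[OF v] by simp
  next
    fix w assume B: "B = points N" and w: "w \<in> chart_space d"
    have "fst d \<subseteq> points N" using openin_subset[OF is_chart_openin[OF chd]] .
    then have "?E = snd d ` {q \<in> fst d. g q \<in> fst e}" unfolding B by blast
    then have "openin (top_of_set (chart_space d)) ?E"
      using smooth_rel_chart_rep(1)[OF N Q g(1)[unfolded B] d e] by simp
    from L(3)[OF this subspace_chart_space w] show "ddir ?g (snd d (f p)) w = L w" by (simp only: fx)
  qed
qed

lemma ddir_rep_in_space:
  assumes M: "premanifold M" and N: "premanifold N" and f: "smooth_rel M (points M) N f"
    and c: "max_chart M c" "p \<in> fst c" and d: "max_chart N d" "f p \<in> fst d"
    and v: "v \<in> chart_space c"
  shows "ddir (\<lambda>x. snd d (f (chart_inv c x))) (snd c p) v \<in> chart_space d"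
proof -
  note r = smooth_rel_chart_rep[OF M N f c d]
  have "chart_image d \<subseteq> chart_space d" unfolding chart_space_def by (rule span_superset)
  note im = subset_trans[OF r(4) this]
  show ?thesis
    by (rule ddir_in_subspace[OF r(3,1) subspace_chart_space r(2) v im subspace_chart_space])
qed

section \<open>Tangent vectors and differentials in charts\<close>

lemma charts_atD:
  assumes "premanifold M" "c \<in> charts_at M p"
  shows "max_chart M c" "p \<in> fst c"
  using assms(2) atlas_max_chart[OF assms(1), of c] by (simp_all add: charts_at_def)

lemma some_chart_at:
  assumes "premanifold M" "p \<in> points M"
  shows "some_chart M p \<in> charts_at M p"
proof -
  obtain c where "c \<in> atlas M" "p \<in> fst c" by (rule premanifold_chart_at[OF assms])
  then have "c \<in> charts_at M p" by (simp add: charts_at_def)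
  then show ?thesis unfolding some_chart_def by (rule someI)
qed

lemma ddir_chart_ident:
  assumes c: "is_chart X c" "p \<in> fst c" "v \<in> chart_space c"
  shows "ddir (\<lambda>x. snd c (chart_inv c x)) (snd c p) v = v"
proof -
  have "ddir (\<lambda>x. snd c (chart_inv c x)) (snd c p) v = ddir (\<lambda>x. x) (snd c p) v"
    by (rule ddir_cong[OF is_chart_openin_image[OF c(1)] subspace_chart_space chart_in_image[OF c(2)] c(3)])
      (simp add: chart_inv_right)
  also have "\<dots> = v" unfolding ddir_def by (rule vector_derivative_at[OF line_has_vector_derivative])
  finally show ?thesis .
qed

text \<open>The compatibility of the components in the charts \<open>c\<close>, \<open>d\<close>,
  \<open>e\<close> is the chain rule for the identity map read in these three charts.\<close>

lemma tvec_of_tangent: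
  assumes M: "premanifold M" and c: "c \<in> charts_at M p" and v: "v \<in> chart_space c"
  shows "tvec_of M p c v \<in> tangent_space M p" "tvec_of M p c v c = v"
proof -
  note mc = charts_atD[OF M c]
  note I = smooth_rel_ident[OF M subset_refl]
  show "tvec_of M p c v c = v"
    using ddir_chart_ident[OF max_chart_is_chart[OF mc(1)] mc(2) v] c by (simp add: tvec_of_def o_def)
  have in_space: "ddir (\<lambda>x. snd d (chart_inv c x)) (snd c p) v \<in> chart_space d"
    if "d \<in> charts_at M p" for d
    using ddir_rep_in_space[OF M M I mc charts_atD[OF M that] v] .
  have "ddir (\<lambda>x. snd e (chart_inv d x)) (snd d p) (ddir (\<lambda>x. snd d (chart_inv c x)) (snd c p) v)
      = ddir (\<lambda>x. snd e (chart_inv c x)) (snd c p) v"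
    if d: "d \<in> charts_at M p" and e: "e \<in> charts_at M p" for d e
  proof -
    obtain L where "\<And>v. v \<in> chart_space c \<Longrightarrow> ddir (\<lambda>x. snd e (chart_inv c x)) (snd c p) v
        = L (ddir (\<lambda>x. snd d (chart_inv c x)) (snd c p) v)"
      "\<And>w. points M = points M \<Longrightarrow> w \<in> chart_space d \<Longrightarrow>
        ddir (\<lambda>y. snd e (chart_inv d y)) (snd d p) w = L w"
      by (rule ddir_rep_chain[OF M M M I I _ mc charts_atD[OF M d] charts_atD[OF M e]]) blast+
    then show ?thesis using v in_space[OF d] by simp
  qed
  then show "tvec_of M p c v \<in> tangent_space M p"
    using in_space unfolding tangent_space_def tvec_of_def o_def by simp
qed

lemma tangent_spaceD:
  assumes "v \<in> tangent_space M p"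
  shows "c \<in> charts_at M p \<Longrightarrow> v c \<in> chart_space c"
    "c \<in> charts_at M p \<Longrightarrow> c' \<in> charts_at M p \<Longrightarrow>
      v c' = ddir (snd c' \<circ> chart_inv c) (snd c p) (v c)"
    "c \<notin> charts_at M p \<Longrightarrow> v c = 0"
proof -
  have *: "(\<forall>c. c \<notin> charts_at M p \<longrightarrow> v c = 0) \<and> (\<forall>c\<in>charts_at M p. v c \<in> chart_space c) \<and>
      (\<forall>c\<in>charts_at M p. \<forall>c'\<in>charts_at M p. v c' = ddir (snd c' \<circ> chart_inv c) (snd c p) (v c))"
    using assms by (simp only: tangent_space_def mem_Collect_eq)
  show "c \<in> charts_at M p \<Longrightarrow> v c \<in> chart_space c"
    using * by blast
  show "c \<in> charts_at M p \<Longrightarrow> c' \<in> charts_at M p \<Longrightarrow>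
      v c' = ddir (snd c' \<circ> chart_inv c) (snd c p) (v c)"
    using * by blast
  show "c \<notin> charts_at M p \<Longrightarrow> v c = 0"
    using * by blast
qed

lemma tangent_space_eqI:
  assumes u: "u \<in> tangent_space M p" and v: "v \<in> tangent_space M p"
    and c: "c \<in> charts_at M p" "u c = v c"
  shows "u = v"
proof
  fix c' show "u c' = v c'"
  proof (cases "c' \<in> charts_at M p")
    case True
    then show ?thesis using tangent_spaceD(2)[OF u c(1)] tangent_spaceD(2)[OF v c(1)] c(2) by metis
  next
    case False
    then show ?thesis using tangent_spaceD(3)[OF u] tangent_spaceD(3)[OF v] by metis
  qed
qed

lemma tmap_component:
  assumes "d \<in> charts_at N (f p)"
  shows "tmap M N f p v d = ddir (\<lambda>x. snd d (f (chart_inv (some_chart M p) x)))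
    (snd (some_chart M p) p) (v (some_chart M p))"
  unfolding tmap_def Let_def o_def using assms by (rule if_P)

text \<open>\<open>g\<close> may be defined only on a thin set \<open>B\<close>, so it need not have
  a differential at \<open>f p\<close>; a local extension still yields a map \<open>L\<close> that
  recovers the components of a tangent vector from those of its image.\<close>

lemma inj_on_tmap_left_inverse:
  assumes M: "premanifold M" and N: "premanifold N" and f: "smooth_rel M (points M) N f"
    and g: "smooth_rel N B M g" "f ` points M \<subseteq> B" "\<And>p. p \<in> points M \<Longrightarrow> g (f p) = p"
    and p: "p \<in> points M"
  shows "inj_on (tmap M N f p) (tangent_space M p)"
proof (rule inj_onI)
  fix u v assume uv: "u \<in> tangent_space M p" "v \<in> tangent_space M p"
    and eq: "tmap M N f p u = tmap M N f p v"
  let ?c = "some_chart M p" and ?d = "some_chart N (f p)"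
  have c: "?c \<in> charts_at M p" by (rule some_chart_at[OF M p])
  have d: "?d \<in> charts_at N (f p)" using smooth_rel_points(2)[OF f] p by (intro some_chart_at[OF N]) auto
  note mc = charts_atD[OF M c] and md = charts_atD[OF N d]
  note ch = max_chart_is_chart[OF mc(1)]
  have gc: "g (f p) \<in> fst ?c" using g(3)[OF p] mc(2) by simp
  obtain L where L: "\<And>v. v \<in> chart_space ?c \<Longrightarrow> ddir (\<lambda>x. snd ?c (g (f (chart_inv ?c x)))) (snd ?c p) v
      = L (ddir (\<lambda>x. snd ?d (f (chart_inv ?c x))) (snd ?c p) v)"
    by (rule ddir_rep_chain[OF M N M f g(1,2) mc md mc(1) gc]) blast
  have wL: "w ?c = L (tmap M N f p w ?d)" if w: "w \<in> tangent_space M p" for w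
  proof -
    have wc: "w ?c \<in> chart_space ?c" by (rule tangent_spaceD(1)[OF w c])
    have "ddir (\<lambda>x. snd ?c (g (f (chart_inv ?c x)))) (snd ?c p) (w ?c)
        = ddir (\<lambda>x. snd ?c (chart_inv ?c x)) (snd ?c p) (w ?c)"
    proof (rule ddir_cong[OF is_chart_openin_image[OF ch] subspace_chart_space chart_in_image[OF mc(2)] wc])
      fix y assume "y \<in> chart_image ?c"
      then have "chart_inv ?c y \<in> points M" by (rule chart_inv_in_points[OF ch])
      then show "snd ?c (g (f (chart_inv ?c y))) = snd ?c (chart_inv ?c y)" using g(3) by simp
    qed
    also have "\<dots> = w ?c" by (rule ddir_chart_ident[OF ch mc(2) wc])
    finally show ?thesis using L[OF wc] tmap_component[where M = M and N = N and f = f and p = p, OF d] by simp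
  qed
  have "u ?c = v ?c" using wL[OF uv(1)] wL[OF uv(2)] by (simp only: eq)
  then show "u = v" by (rule tangent_space_eqI[OF uv c])
qed

text \<open>Keeping \<open>h'\<close> apart from \<open>h o f\<close> lets the same \<open>h\<close>
  represent, on the points of \<open>NP\<close>, both the restriction of \<open>h\<close> and the
  pullback of \<open>h\<mu>\<close> by \<open>\<tau>\<close>.\<close>

lemma dfun_tmap:
  assumes M: "premanifold M" and N: "premanifold N" and f: "smooth_rel M (points M) N f"
    and h: "smooth_rel N (points N) real_line h" and h': "\<And>q. q \<in> points M \<Longrightarrow> h (f q) = h' q"
    and p: "p \<in> points M" and v: "v \<in> tangent_space M p"
  shows "dfun N h (f p) (tmap M N f p v) = dfun M h' p v"
proof -
  let ?c = "some_chart M p" and ?d = "some_chart N (f p)"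
  have c: "?c \<in> charts_at M p" by (rule some_chart_at[OF M p])
  have d: "?d \<in> charts_at N (f p)" using smooth_rel_points(2)[OF f] p by (intro some_chart_at[OF N]) auto
  note mc = charts_atD[OF M c] and md = charts_atD[OF N d]
  note ch = max_chart_is_chart[OF mc(1)]
  have fN: "f ` points M \<subseteq> points N" by (rule smooth_rel_points(2)[OF f])
  have vc: "v ?c \<in> chart_space ?c" by (rule tangent_spaceD(1)[OF v c])
  define e where "e = (UNIV :: real set, \<lambda>x::real. x)"
  have e: "max_chart real_line e" "h (f p) \<in> fst e" and snd_e: "snd e = (\<lambda>x. x)"
    using real_line_chart by (simp_all add: e_def)
  obtain L where "\<And>v. v \<in> chart_space ?c \<Longrightarrow> ddir (\<lambda>x. snd e (h (f (chart_inv ?c x)))) (snd ?c p) v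
      = L (ddir (\<lambda>x. snd ?d (f (chart_inv ?c x))) (snd ?c p) v)"
    "\<And>w. points N = points N \<Longrightarrow> w \<in> chart_space ?d \<Longrightarrow>
      ddir (\<lambda>y. snd e (h (chart_inv ?d y))) (snd ?d (f p)) w = L w"
    by (rule ddir_rep_chain[OF M N premanifold_real_line f h fN mc md e]) blast
  note L = this[unfolded snd_e]
  have "dfun N h (f p) (tmap M N f p v)
      = ddir (\<lambda>y. h (chart_inv ?d y)) (snd ?d (f p)) (ddir (\<lambda>x. snd ?d (f (chart_inv ?c x))) (snd ?c p) (v ?c))"
    by (simp add: dfun_def Let_def o_def tmap_component[where M = M and N = N and f = f and p = p, OF d])
  also have "\<dots> = ddir (\<lambda>x. h (f (chart_inv ?c x))) (snd ?c p) (v ?c)"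
    using L(1)[OF vc] L(2)[OF refl ddir_rep_in_space[OF M N f mc md vc]] by simp
  also have "\<dots> = ddir (\<lambda>x. h' (chart_inv ?c x)) (snd ?c p) (v ?c)"
  proof (rule ddir_cong[OF is_chart_openin_image[OF ch] subspace_chart_space chart_in_image[OF mc(2)] vc])
    fix y assume "y \<in> chart_image ?c"
    then have "chart_inv ?c y \<in> points M" by (rule chart_inv_in_points[OF ch])
    then show "h (f (chart_inv ?c y)) = h' (chart_inv ?c y)" by (rule h')
  qed
  finally show ?thesis by (simp add: dfun_def Let_def o_def)
qed

lemma smooth_function_chart_rep:
  assumes M: "premanifold M" and h: "smooth_rel M (points M) real_line h" and c: "max_chart M c"
  shows "smooth_on (chart_image c) (\<lambda>x. h (chart_inv c x))"
proof -
  have "fst c \<subseteq> points M" using openin_subset[OF is_chart_openin[OF max_chart_is_chart[OF c]]] .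
  then have "snd c ` {p \<in> points M \<inter> fst c. h p \<in> fst (UNIV, \<lambda>x::real. x)} = chart_image c"
    by (auto simp: chart_image_def)
  then show ?thesis
    using smooth_rel_in_charts[OF M premanifold_real_line h c real_line_chart] by simp
qed

text \<open>Only one component of each vector has to lie in its chart space, so the rule applies to
  a \<open>tmap\<close> image without first proving it tangent.\<close>

lemma dfun_tcomb:
  assumes M: "premanifold M" and h: "smooth_rel M (points M) real_line h" and p: "p \<in> points M"
    and uv: "u (some_chart M p) \<in> chart_space (some_chart M p)"
      "v (some_chart M p) \<in> chart_space (some_chart M p)"
  shows "dfun M h p (tcomb a u b v) = a * dfun M h p u + b * dfun M h p v"
proof -
  let ?c = "some_chart M p"
  note mc = charts_atD[OF M some_chart_at[OF M p]]
  note sm = smooth_function_chart_rep[OF M h mc(1)]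
  obtain L where L: "bounded_linear L"
    "\<And>v. v \<in> chart_space ?c \<Longrightarrow> ddir (\<lambda>x. h (chart_inv ?c x)) (snd ?c p) v = L v"
    by (rule smooth_on_ddir[OF sm is_chart_openin_image[OF max_chart_is_chart[OF mc(1)]]
          subspace_chart_space chart_in_image[OF mc(2)]]) blast
  have "a *\<^sub>R u ?c + b *\<^sub>R v ?c \<in> chart_space ?c"
    using uv by (intro subspace_add subspace_scale subspace_chart_space)
  then show ?thesis using uv L
    by (simp add: dfun_def Let_def o_def tcomb_def linear_simps)
qed

lemma dfun_eq_0:
  assumes M: "premanifold M" and p: "p \<in> points M" and v: "v \<in> tangent_space M p"
    and h: "\<And>q. q \<in> points M \<Longrightarrow> h q = (k::real)"
  shows "dfun M h p v = 0"
proof -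
  let ?c = "some_chart M p"
  have c: "?c \<in> charts_at M p" by (rule some_chart_at[OF M p])
  note mc = charts_atD[OF M c]
  note ch = max_chart_is_chart[OF mc(1)]
  have "ddir (\<lambda>x. h (chart_inv ?c x)) (snd ?c p) (v ?c) = ddir (\<lambda>x. k) (snd ?c p) (v ?c)"
  proof (rule ddir_cong[OF is_chart_openin_image[OF ch] subspace_chart_space chart_in_image[OF mc(2)]
        tangent_spaceD(1)[OF v c]])
    fix y assume "y \<in> chart_image ?c"
    then have "chart_inv ?c y \<in> points M" by (rule chart_inv_in_points[OF ch])
    then show "h (chart_inv ?c y) = k" by (rule h)
  qed
  then show ?thesis by (simp add: dfun_def Let_def o_def ddir_def)
qed

section \<open>Local sections and regular level sets\<close>

lemma ddir_extension:
  fixes f :: "'a::euclidean_space \<Rightarrow> 'b::real_normed_vector"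
  assumes F: "(F has_derivative A) (at x)" "open U" "x \<in> U"
    and D: "openin (top_of_set V) D" "subspace V" "x \<in> D" "v \<in> V"
    and eq: "\<And>y. y \<in> D \<Longrightarrow> y \<in> U \<Longrightarrow> F y = f y"
  shows "ddir f x v = A v"
proof -
  have "openin (top_of_set V) (D \<inter> U)" using D(1) F(2) by (rule openin_Int_open)
  then have "ddir F x v = ddir f x v"
    by (rule ddir_cong[OF _ D(2) _ D(4)]) (use D(3) F(3) eq in auto)
  moreover have "((\<lambda>t. F (x + t *\<^sub>R v)) has_vector_derivative A v) (at 0)"
  proof -
    have "((\<lambda>t. F (x + t *\<^sub>R v)) has_derivative (\<lambda>t. A (t *\<^sub>R v))) (at 0)"
      using line_has_vector_derivative[of x v] unfolding has_vector_derivative_def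
      by (rule has_derivative_compose) (use F(1) in simp)
    then show ?thesis
      using has_derivative_bounded_linear[OF F(1)] unfolding has_vector_derivative_def
      by (simp add: linear_simps)
  qed
  then have "ddir F x v = A v" unfolding ddir_def by (rule vector_derivative_at)
  ultimately show ?thesis by simp
qed

text \<open>If \<open>F\<close> is the coordinate expression of the submersion near \<open>x\<^sub>0\<close>, \<open>A\<close> its derivative and \<open>g\<close> a
  linear right inverse of \<open>A\<close>, then \<open>z \<mapsto> F (x\<^sub>0 + g z) + z - A (g z)\<close> has derivative \<open>id\<close> at \<open>0\<close>,
  preserves the model subspace of the target and equals \<open>F (x\<^sub>0 + g z)\<close> there.\<close>

theorem submersion_local_section:
  assumes N: "premanifold N" and Q: "premanifold Q" and f: "submersion N Q f" and p: "p \<in> points N"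
  obtains V \<sigma> where "openin (mtop Q) V" "f p \<in> V" "smooth_rel Q V N \<sigma>" "\<And>q. q \<in> V \<Longrightarrow> f (\<sigma> q) = q"
proof -
  have fs: "smooth_rel N (points N) Q f" and surj: "tmap N Q f p ` tangent_space N p = tangent_space Q (f p)"
    using f p smooth_map_imp_smooth_rel[OF N Q] unfolding submersion_def by blast+
  define c where "c = some_chart N p"
  define d where "d = some_chart Q (f p)"
  have c: "c \<in> charts_at N p" unfolding c_def by (rule some_chart_at[OF N p])
  have "f p \<in> points Q" using smooth_rel_points(2)[OF fs] p by blast
  then have d: "d \<in> charts_at Q (f p)" unfolding d_def by (rule some_chart_at[OF Q])
  note mc = charts_atD[OF N c] and md = charts_atD[OF Q d]
  note chc = max_chart_is_chart[OF mc(1)] and chd = max_chart_is_chart[OF md(1)]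
  define V W where "V = chart_space c" and "W = chart_space d"
  have sV: "subspace V" and sW: "subspace W" by (simp_all add: V_def W_def subspace_chart_space)
  define D where "D = snd c ` {q \<in> fst c. f q \<in> fst d}"
  define fh where "fh = (\<lambda>x. snd d (f (chart_inv c x)))"
  define x0 where "x0 = snd c p"
  note rep = smooth_rel_chart_rep[OF N Q fs mc md, folded V_def D_def fh_def x0_def]
  have fhW: "fh y \<in> W" if "y \<in> D" for y
    using rep(4) that unfolding W_def chart_space_def by (intro span_base) blast
  obtain U0 F where U0: "open U0" "x0 \<in> U0" "\<And>k. Ck_on k U0 F"
    "\<And>y. y \<in> D \<Longrightarrow> y \<in> U0 \<Longrightarrow> F y = fh y"
    by (rule smooth_onE[OF rep(3,2)]) blast
  obtain T where T: "open T" "D = V \<inter> T" using rep(1) by (auto simp: openin_open)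
  \<comment> \<open>Intersecting with \<open>T\<close> ensures that points of \<open>V\<close> in
    \<open>U\<close> lie in the domain \<open>D\<close> of the coordinate expression.\<close>
  define U where "U = U0 \<inter> T"
  have U: "open U" "x0 \<in> U" "\<And>k. Ck_on k U F" "\<And>y. y \<in> V \<Longrightarrow> y \<in> U \<Longrightarrow> y \<in> D"
    "\<And>y. y \<in> D \<Longrightarrow> y \<in> U \<Longrightarrow> F y = fh y"
    using U0 T rep(2) by (auto simp: U_def intro: Ck_on_subset)
  have x0V: "x0 \<in> V" using rep(2) T(2) by blast
  define A where "A = frechet_derivative F (at x0)"
  have A: "(F has_derivative A) (at x0)" unfolding A_def by (rule Ck_on_has_derivative[OF U(3,2)])
  note linA = has_derivative_linear[OF A]
  have ddA: "ddir fh x0 v = A v" if "v \<in> V" for v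
    by (rule ddir_extension[OF A U(1,2) rep(1) sV rep(2) that U(5)])
  have AV: "A v \<in> W" if "v \<in> V" for v
    using ddir_rep_in_space[OF N Q fs mc md, folded V_def W_def fh_def x0_def, OF that] ddA[OF that] by simp
  \<comment> \<open>Every \<open>w\<close> in the model space is the \<open>d\<close>-component of a
    tangent vector, so surjectivity of the differential becomes surjectivity of \<open>A\<close>
    from \<open>V\<close> onto \<open>W\<close>.\<close>
  have AW: "w \<in> A ` V" if w: "w \<in> W" for w
  proof -
    note tv = tvec_of_tangent[OF Q d, folded W_def, OF w]
    obtain v where v: "v \<in> tangent_space N p" "tmap N Q f p v = tvec_of Q (f p) d w"
      using tv(1) surj by (metis imageE)
    have vV: "v c \<in> V" unfolding V_def by (rule tangent_spaceD(1)[OF v(1) c])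
    have "tmap N Q f p v d = ddir fh x0 (v c)"
      using tmap_component[where f = f and p = p and M = N and N = Q and v = v, OF d]
      unfolding fh_def x0_def c_def .
    then have "w = A (v c)" using v(2) tv(2) ddA[OF vV] by simp
    then show ?thesis using vV by (rule image_eqI)
  qed
  \<comment> \<open>The right inverse is total with range in \<open>V\<close>, so
    \<open>x0 + g z\<close> stays in the model space for every \<open>z\<close>, even outside
    \<open>W\<close>.\<close>
  have "\<exists>g. range g \<subseteq> V \<and> linear g \<and> (\<forall>w\<in>A ` V. A (g w) = w)"
    by (rule linear_exists_right_inverse_on[OF linA sV])
  then obtain g where g: "range g \<subseteq> V" "linear g" "\<forall>w\<in>A ` V. A (g w) = w" by (elim exE conjE)
  have gV: "g z \<in> V" for z using g(1) by blast
  have Ag: "A (g w) = w" if "w \<in> W" for w using g(3) AW[OF that] by blast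
  have blg: "bounded_linear g" and blA: "bounded_linear A"
    using g(2) linA linear_conv_bounded_linear by blast+
  define P where "P = (\<lambda>z. x0 + g z) -` U"
  have P: "open P"
    unfolding P_def using U(1) blg
    by (intro open_vimage continuous_intros linear_continuous_on)
  define H where "H = (\<lambda>z. F (x0 + g z) + (z - A (g z)))"
  have Cg: "Ck_on k S (\<lambda>z. x0 + g z)" if "open S" for k S
    by (intro Ck_on_add Ck_on_const Ck_on_linear[OF blg] Ck_on_ident that)
  have CH: "Ck_on k P H" for k
    unfolding H_def
    by (intro Ck_on_add[OF P] Ck_on_diff[OF P] Ck_on_ident Ck_on_linear[OF blA P] Ck_on_linear[OF blg P]
        Ck_on_compose[OF P U(1) _ Cg[OF P] U(3)]) (auto simp: P_def)
  have g0: "g 0 = 0" and A0: "A 0 = 0" using g(2) linA by (simp_all add: linear_0)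
  have P0: "0 \<in> P" using U(2) by (simp add: P_def g0)
  have H0: "H 0 = fh x0" using U(2,5) rep(2) by (simp add: H_def g0 A0)
  have "((\<lambda>z. x0 + g z) has_derivative g) (at 0)"
    using has_derivative_add[OF has_derivative_const bounded_linear_imp_has_derivative[OF blg]] by simp
  moreover have "(F has_derivative A) (at (x0 + g 0))" using A by (simp add: g0)
  ultimately have "((\<lambda>z. F (x0 + g z)) has_derivative (\<lambda>z. A (g z))) (at 0)"
    by (rule has_derivative_compose)
  moreover have "((\<lambda>z. z - A (g z)) has_derivative (\<lambda>z. z - A (g z))) (at 0)"
    by (intro bounded_linear_imp_has_derivative bounded_linear_sub bounded_linear_ident
        bounded_linear_compose[OF blA blg])
  ultimately have "(H has_derivative (\<lambda>z. A (g z) + (z - A (g z)))) (at 0)"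
    unfolding H_def by (rule has_derivative_add)
  then have der: "(H has_derivative (\<lambda>z. z)) (at 0)" by simp
  obtain U' V' G where inv: "open U'" "U' \<subseteq> P" "0 \<in> U'" "open V'" "H 0 \<in> V'"
    "homeomorphism U' V' H G" "\<And>k. Ck_on k V' G"
    by (rule smooth_inverse_function[OF P CH P0 der]) blast
  have GU: "G y \<in> U'" and HG: "H (G y) = y" if "y \<in> V'" for y
    using inv(6) that unfolding homeomorphism_def by blast+
  define sh where "sh = (\<lambda>y. x0 + g (G y))"
  have key: "sh y \<in> D \<and> fh (sh y) = y" if y: "y \<in> V'" "y \<in> W" for y
  proof -
    have shU: "sh y \<in> U" using GU[OF y(1)] inv(2) by (auto simp: sh_def P_def)
    have "sh y \<in> V" unfolding sh_def by (intro subspace_add[OF sV] x0V gV)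
    then have shD: "sh y \<in> D" using shU by (rule U(4))
    have Hy: "fh (sh y) + (G y - A (g (G y))) = y"
      using HG[OF y(1)] U(5)[OF shD shU] by (simp add: H_def sh_def)
    \<comment> \<open>Solving \<open>H (G y) = y\<close> for \<open>G y\<close> shows that
      \<open>G y\<close> lies in \<open>W\<close>, where \<open>g\<close> is an exact right inverse
      of \<open>A\<close>; the correction term then vanishes and \<open>fh (sh y) = y\<close>
      remains.\<close>
    then have "G y = y - fh (sh y) + A (g (G y))" by (simp add: algebra_simps)
    also have "\<dots> \<in> W" using y(2) fhW[OF shD] AV[OF gV] by (intro subspace_add[OF sW] subspace_diff[OF sW])
    finally have "A (g (G y)) = G y" by (rule Ag)
    then show ?thesis using Hy shD by simp
  qed
  define Vq where "Vq = {q \<in> fst d. snd d q \<in> V'}"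
  define \<sigma> where "\<sigma> q = chart_inv c (sh (snd d q))" for q
  have sec: "\<sigma> q \<in> fst c \<and> f (\<sigma> q) = q \<and> snd c (\<sigma> q) = sh (snd d q)" if q: "q \<in> Vq" for q
  proof -
    have q': "q \<in> fst d" "snd d q \<in> V'" using q by (simp_all add: Vq_def)
    have k: "sh (snd d q) \<in> D" "fh (sh (snd d q)) = snd d q"
      using key[OF q'(2)] chart_in_space[OF q'(1)] unfolding W_def by blast+
    then obtain r where r: "r \<in> fst c" "f r \<in> fst d" "sh (snd d q) = snd c r" unfolding D_def by blast
    then have \<sigma>: "\<sigma> q = r" unfolding \<sigma>_def using chart_inv_left[OF chc r(1)] by simp
    have "snd d (f r) = snd d q" using k(2) r(3) chart_inv_left[OF chc r(1)] by (simp add: fh_def)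
    then have "f r = q" using is_chart_inj_on[OF chd] r(2) q'(1) by (simp add: inj_on_eq_iff)
    then show ?thesis using r \<sigma> by simp
  qed
  show ?thesis
  proof (rule that)
    show Vop: "openin (mtop Q) Vq" unfolding Vq_def by (rule chart_openin_vimage[OF chd inv(4)])
    show "f p \<in> Vq" using inv(5) md(2) H0 chart_inv_left[OF chc mc(2)]
      by (simp add: Vq_def fh_def x0_def)
    show "f (\<sigma> q) = q" if "q \<in> Vq" for q using sec[OF that] by blast
    show "smooth_rel Q Vq N \<sigma>"
    proof (rule smooth_relI)
      fix q assume q: "q \<in> Vq"
      have "Ck_on k V' sh" for k
        unfolding sh_def by (intro Ck_on_add Ck_on_const Ck_on_linear[OF blg] inv(4,7))
      then have "smooth_on (snd d ` Vq) sh"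
        by (rule smooth_on_Ck[OF inv(4)]) (auto simp: Vq_def)
      then have "smooth_on (snd d ` (Vq \<inter> Vq)) (\<lambda>y. snd c (\<sigma> (chart_inv d y)))"
      proof (rule smooth_on_cong_subset)
        show "snd d ` (Vq \<inter> Vq) \<subseteq> snd d ` Vq" by simp
        fix y assume "y \<in> snd d ` (Vq \<inter> Vq)"
        then obtain r where r: "r \<in> Vq" "y = snd d r" by blast
        then have "chart_inv d y = r" using chart_inv_left[OF chd] by (simp add: Vq_def)
        then show "sh y = snd c (\<sigma> (chart_inv d y))" using sec[OF r(1)] r(2) by simp
      qed
      moreover have "\<sigma> ` (Vq \<inter> Vq) \<subseteq> fst c" using sec by blast
      moreover have "Vq \<subseteq> fst d" by (auto simp: Vq_def)
      ultimately show "\<exists>c c' U. max_chart Q c \<and> max_chart N c' \<and> openin (mtop Q) U \<and> q \<in> U \<and> U \<subseteq> fst c \<and>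
          \<sigma> ` (Vq \<inter> U) \<subseteq> fst c' \<and> smooth_on (snd c ` (Vq \<inter> U)) (\<lambda>x. snd c' (\<sigma> (chart_inv c x)))"
        using mc(1) md(1) Vop q by (intro exI[of _ d] exI[of _ c] exI[of _ Vq] conjI)
    qed
  qed
qed

text \<open>\<open>H\<close> acts on the full Euclidean space, whereas the chart sees only its model
  subspace; \<open>inv\<close> makes \<open>H\<close> respect that subspace, and \<open>ne\<close>
  prevents the span of the new image from collapsing to \<open>{0}\<close>.\<close>

lemma max_chart_compose_diffeo:
  fixes M :: "('a, 'e::euclidean_space) mfd" and H G :: "'e \<Rightarrow> 'e"
  assumes M: "premanifold M" and c: "max_chart M c"
    and U: "open U" "chart_space c \<inter> U \<subseteq> chart_image c" and V: "open V"
    and hom: "homeomorphism U V H G" and H: "\<And>k. Ck_on k U H" and G: "\<And>k. Ck_on k V G"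
    and inv: "\<And>z. z \<in> U \<Longrightarrow> H z \<in> chart_space c \<longleftrightarrow> z \<in> chart_space c"
    and ne: "chart_space c \<inter> U \<noteq> {}"
  defines "d \<equiv> ({q \<in> fst c. snd c q \<in> U}, \<lambda>q. H (snd c q))"
  shows "max_chart M d" "chart_image d = chart_space c \<inter> V"
proof -
  note chc = max_chart_is_chart[OF c]
  let ?C = "chart_space c"
  have HV: "H z \<in> V" and GH: "G (H z) = z" if "z \<in> U" for z
    using hom that unfolding homeomorphism_def by blast+
  have GU: "G y \<in> U" and HG: "H (G y) = y" if "y \<in> V" for y
    using hom that unfolding homeomorphism_def by blast+
  have im1: "snd c ` fst d = ?C \<inter> U"
  proof
    show "snd c ` fst d \<subseteq> ?C \<inter> U" using chart_in_space[of _ c] by (auto simp: d_def)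
    show "?C \<inter> U \<subseteq> snd c ` fst d" using U(2) unfolding d_def chart_image_def by auto
  qed
  have HCU: "H ` (?C \<inter> U) = ?C \<inter> V"
  proof
    show "H ` (?C \<inter> U) \<subseteq> ?C \<inter> V" using HV inv by auto
    show "?C \<inter> V \<subseteq> H ` (?C \<inter> U)"
    proof
      fix y assume y: "y \<in> ?C \<inter> V"
      then have "G y \<in> ?C \<inter> U" using GU HG inv[of "G y"] by auto
      then have "H (G y) \<in> H ` (?C \<inter> U)" by (rule imageI)
      then show "y \<in> H ` (?C \<inter> U)" using HG y by simp
    qed
  qed
  have snd_d: "snd d = H \<circ> snd c" by (simp add: d_def o_def)
  show im: "chart_image d = ?C \<inter> V"
    unfolding chart_image_def snd_d image_comp[symmetric] im1 by (rule HCU)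
  have Cop: "openin (top_of_set ?C) (?C \<inter> V)" using V by (rule openin_open_Int)
  have "?C \<inter> V \<noteq> {}" using ne HCU by blast
  then have sp: "chart_space d = ?C"
    unfolding chart_space_def[of d] im by (rule span_openin_subspace[OF Cop subspace_chart_space])
  have dsub: "fst d \<subseteq> fst c" by (auto simp: d_def)
  have "is_chart (mtop M) d"
    unfolding is_chart_def
  proof (intro conjI)
    show "openin (mtop M) (fst d)"
      unfolding d_def fst_conv by (rule chart_openin_vimage[OF chc U(1)])
    show "openin (top_of_set (chart_space d)) (chart_image d)" unfolding sp im by (rule Cop)
    have top: "topspace (subtopology (mtop M) (fst c)) = fst c"
      using openin_subset[OF is_chart_openin[OF chc]] by auto
    have "homeomorphic_map (subtopology (mtop M) (fst c)) (top_of_set (chart_image c)) (snd c)"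
      using chc by (simp add: is_chart_def)
    then have "homeomorphic_map (subtopology (subtopology (mtop M) (fst c)) (fst d))
        (subtopology (top_of_set (chart_image c)) (?C \<inter> U)) (snd c)"
    proof (rule homeomorphic_map_subtopologies)
      have "fst c \<inter> fst d = fst d" "chart_image c \<inter> (?C \<inter> U) = ?C \<inter> U" using dsub U(2) by blast+
      then show "snd c ` (topspace (subtopology (mtop M) (fst c)) \<inter> fst d)
          = topspace (top_of_set (chart_image c)) \<inter> (?C \<inter> U)"
        by (simp only: top topspace_euclidean_subtopology im1)
    qed
    moreover have "subtopology (subtopology (mtop M) (fst c)) (fst d) = subtopology (mtop M) (fst d)"
      using dsub by (simp add: subtopology_subtopology Int_absorb1)
    moreover have "subtopology (top_of_set (chart_image c)) (?C \<inter> U) = top_of_set (?C \<inter> U)"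
      using U(2) by (simp add: subtopology_subtopology Int_absorb1)
    ultimately have h1: "homeomorphic_map (subtopology (mtop M) (fst d)) (top_of_set (?C \<inter> U)) (snd c)"
      by (simp only:)
    have "homeomorphism (?C \<inter> U) (?C \<inter> V) H G"
      by (rule homeomorphism_of_subsets[OF hom _ _ HCU]) auto
    then have "homeomorphic_maps (top_of_set (?C \<inter> U)) (top_of_set (?C \<inter> V)) H G"
      unfolding homeomorphism_def homeomorphic_maps_def by auto
    then have "homeomorphic_map (top_of_set (?C \<inter> U)) (top_of_set (?C \<inter> V)) H"
      by (rule homeomorphic_maps_imp_map)
    from homeomorphic_map_compose[OF h1 this]
    show "homeomorphic_map (subtopology (mtop M) (fst d)) (top_of_set (chart_image d)) (snd d)"
      unfolding im snd_d .
  qed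
  then show "max_chart M d"
    unfolding max_chart_def
  proof (intro conjI ballI)
    fix e assume e: "e \<in> atlas M"
    note me = atlas_max_chart[OF M e]
    note che = max_chart_is_chart[OF me]
    show "compatible_charts d e"
      unfolding compatible_charts_def o_def
    proof
      have inv_d: "chart_inv d (snd d q) = q" if "q \<in> fst d" for q
        using chart_inv_left[OF \<open>is_chart (mtop M) d\<close> that] .
      have inv_c: "chart_inv c (G (snd d q)) = q" if "q \<in> fst d" for q
        using that GH[of "snd c q"] chart_inv_left[OF chc, of q] by (simp add: d_def)
      have "smooth_on (snd d ` (fst d \<inter> fst e)) (\<lambda>y. snd e (chart_inv c (G y)))"
      proof (rule smooth_on_compose[OF _ max_chart_transition[OF M c me]])
        show "smooth_on (snd d ` (fst d \<inter> fst e)) G"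
          by (rule smooth_on_Ck[OF V G]) (use HV in \<open>auto simp: d_def\<close>)
        show "G ` snd d ` (fst d \<inter> fst e) \<subseteq> snd c ` (fst c \<inter> fst e)"
          using GH by (auto simp: d_def)
      qed
      then show "smooth_on (snd d ` (fst d \<inter> fst e)) (\<lambda>y. snd e (chart_inv d y))"
        by (rule smooth_on_cong_subset) (auto simp: inv_d inv_c)
      have "smooth_on (snd e ` (fst d \<inter> fst e)) (\<lambda>y. H (snd c (chart_inv e y)))"
      proof (rule smooth_on_compose[where g = H and f = "\<lambda>y. snd c (chart_inv e y)"])
        show "smooth_on (snd e ` (fst d \<inter> fst e)) (\<lambda>y. snd c (chart_inv e y))"
          by (rule smooth_on_subset[OF max_chart_transition[OF M me c]]) (use dsub in auto)
        show "smooth_on U H" by (rule smooth_on_Ck[OF U(1) H subset_refl])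
        show "(\<lambda>y. snd c (chart_inv e y)) ` snd e ` (fst d \<inter> fst e) \<subseteq> U"
          using chart_inv_left[OF che] by (auto simp: d_def)
      qed
      then show "smooth_on (snd e ` (fst d \<inter> fst e)) (\<lambda>y. snd d (chart_inv e y))"
        by (simp add: d_def)
    qed
  qed
qed

text \<open>With \<open>L\<close> the derivative of \<open>h\<close> in a chart centred at \<open>x\<^sub>0\<close> and \<open>L u = 1\<close>, the coordinate
  change \<open>z \<mapsto> z - x\<^sub>0 + (h z - k - L (z - x\<^sub>0)) u\<close> has derivative \<open>id\<close> at \<open>x\<^sub>0\<close> and turns \<open>h - k\<close>
  into \<open>L\<close>, so that the level set becomes the slice \<open>ker L\<close>.\<close>

theorem embedded_level_set:
  fixes M :: "('a, 'e::euclidean_space) mfd"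
  assumes M: "premanifold M" and h: "smooth_rel M (points M) real_line h" and reg: "regular_value M h k"
  shows "embedded_submanifold M {p \<in> points M. h p = k}"
  unfolding embedded_submanifold_def
proof (intro conjI ballI)
  show "{p \<in> points M. h p = k} \<subseteq> points M" by blast
  fix p assume "p \<in> {p \<in> points M. h p = k}"
  then have p: "p \<in> points M" "h p = k" by auto
  then obtain v where v: "v \<in> tangent_space M p" "dfun M h p v \<noteq> 0"
    using reg unfolding regular_value_def by blast
  define c where "c = some_chart M p"
  have c: "c \<in> charts_at M p" unfolding c_def by (rule some_chart_at[OF M p(1)])
  note mc = charts_atD[OF M c]
  note chc = max_chart_is_chart[OF mc(1)]
  define x0 where "x0 = snd c p"
  let ?C = "chart_space c" and ?D = "chart_image c" and ?h = "\<lambda>x. h (chart_inv c x)"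
  have x0D: "x0 \<in> ?D" and x0C: "x0 \<in> ?C"
    unfolding x0_def using chart_in_image[OF mc(2)] chart_in_space[OF mc(2)] by auto
  have hx0: "?h x0 = k" unfolding x0_def using chart_inv_left[OF chc mc(2)] p(2) by simp
  obtain U0 F where U0: "open U0" "x0 \<in> U0" "\<And>k. Ck_on k U0 F"
    "\<And>y. y \<in> ?D \<Longrightarrow> y \<in> U0 \<Longrightarrow> F y = ?h y"
    by (rule smooth_onE[OF smooth_function_chart_rep[OF M h mc(1)] x0D]) blast
  obtain T where T: "open T" "?D = ?C \<inter> T"
    using is_chart_openin_image[OF chc] by (auto simp: openin_open)
  define U where "U = U0 \<inter> T"
  have U: "open U" "x0 \<in> U" "\<And>k. Ck_on k U F" "?C \<inter> U \<subseteq> ?D"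
    "\<And>y. y \<in> ?D \<Longrightarrow> y \<in> U \<Longrightarrow> F y = ?h y"
    using U0 T x0D by (auto simp: U_def intro: Ck_on_subset)
  define L where "L = frechet_derivative F (at x0)"
  have L: "(F has_derivative L) (at x0)" unfolding L_def by (rule Ck_on_has_derivative[OF U(3,2)])
  note linL = has_derivative_linear[OF L] and blL = has_derivative_bounded_linear[OF L]
  have vC: "v c \<in> ?C" by (rule tangent_spaceD(1)[OF v(1) c])
  have "dfun M h p v = ddir ?h x0 (v c)"
    unfolding dfun_def Let_def o_def c_def x0_def ..
  also have "\<dots> = L (v c)"
    by (rule ddir_extension[OF L U(1,2) is_chart_openin_image[OF chc] subspace_chart_space x0D vC U(5)])
  finally have Lv: "L (v c) \<noteq> 0" using v(2) by simp
  \<comment> \<open>Regularity supplies a vector on which \<open>L\<close> does not vanish;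
    rescaling gives a direction in the model space along which \<open>h\<close> grows at unit
    rate.\<close>
  define u where "u = v c /\<^sub>R L (v c)"
  have uC: "u \<in> ?C" unfolding u_def by (rule subspace_scale[OF subspace_chart_space vC])
  have Lu: "L u = 1" unfolding u_def using Lv linL by (simp add: linear_scale)
  define H where "H = (\<lambda>z. (z - x0) + (F z - k - L (z - x0)) *\<^sub>R u)"
  have CH: "Ck_on k U H" for k
    unfolding H_def
    by (intro Ck_on_add Ck_on_diff Ck_on_scaleR Ck_on_ident Ck_on_const Ck_on_linear[OF blL] U(1,3))
  \<comment> \<open>By \<open>L u = 1\<close> the terms \<open>L (z - x0)\<close> cancel, so the
    equality is exact and not only of first order.\<close>
  have LH: "L (H z) = F z - k" for z
    unfolding H_def using linL Lu by (simp add: linear_add linear_scale)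
  have Hx0: "H x0 = 0" using U(2,5) x0D hx0 linL by (simp add: H_def linear_0)
  have "((\<lambda>z. F z - k - L (z - x0)) has_derivative (\<lambda>w. L w - 0 - L (w - 0))) (at x0)"
    by (intro has_derivative_diff L has_derivative_const bounded_linear.has_derivative[OF blL]
        has_derivative_ident)
  then have "((\<lambda>z. (F z - k - L (z - x0)) *\<^sub>R u) has_derivative (\<lambda>w. 0 *\<^sub>R u)) (at x0)"
    using has_derivative_scaleR_left by fastforce
  then have "(H has_derivative (\<lambda>w. (w - 0) + 0 *\<^sub>R u)) (at x0)"
    unfolding H_def by (intro has_derivative_add has_derivative_diff has_derivative_ident has_derivative_const)
  then have der: "(H has_derivative (\<lambda>w. w)) (at x0)" by simp
  obtain U' V' G where inv: "open U'" "U' \<subseteq> U" "x0 \<in> U'" "open V'" "H x0 \<in> V'"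
    "homeomorphism U' V' H G" "\<And>k. Ck_on k V' G"
    by (rule smooth_inverse_function[OF U(1) CH U(2) der]) blast
  \<comment> \<open>\<open>H z - z\<close> lies in the model space for every \<open>z\<close>,
    because \<open>x0\<close> and \<open>u\<close> do.\<close>
  have HC: "H z \<in> ?C \<longleftrightarrow> z \<in> ?C" for z
  proof -
    have s: "(F z - k - L (z - x0)) *\<^sub>R u \<in> ?C" for z by (rule subspace_scale[OF subspace_chart_space uC])
    have "z \<in> ?C" if "H z \<in> ?C"
    proof -
      have "z = H z + x0 - (F z - k - L (z - x0)) *\<^sub>R u" by (simp add: H_def)
      also have "\<dots> \<in> ?C" using that s x0C subspace_chart_space
        by (intro subspace_diff subspace_add)
      finally show ?thesis .
    qed
    moreover have "H z \<in> ?C" if "z \<in> ?C"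
      unfolding H_def using that s x0C subspace_chart_space by (intro subspace_diff subspace_add)
    ultimately show ?thesis by blast
  qed
  define d where "d = ({q \<in> fst c. snd c q \<in> U'}, \<lambda>q. H (snd c q))"
  have CU': "?C \<inter> U' \<subseteq> ?D" using inv(2) U(4) by blast
  have ne: "?C \<inter> U' \<noteq> {}" using x0C inv(3) by blast
  note md = max_chart_compose_diffeo[OF M mc(1) inv(1) CU' inv(4,6)
      Ck_on_subset[OF CH inv(2)] inv(7) HC ne, folded d_def]
  have hL: "h q = k \<longleftrightarrow> L (snd d q) = 0" if "q \<in> fst d" for q
  proof -
    have q: "q \<in> fst c" "snd c q \<in> U" using that inv(2) by (auto simp: d_def)
    have "F (snd c q) = h q" using U(5)[OF chart_in_image[OF q(1)] q(2)] chart_inv_left[OF chc q(1)] by simp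
    then show ?thesis by (simp add: d_def LH)
  qed
  have dM: "fst d \<subseteq> points M" using openin_subset[OF is_chart_openin[OF max_chart_is_chart[OF md(1)]]] .
  have "snd d ` (fst d \<inter> {p \<in> points M. h p = k}) = chart_image d \<inter> {z. L z = 0}"
    using hL dM unfolding chart_image_def by blast
  moreover have "subspace {z. L z = 0}" 
    unfolding subspace_def using linL by (simp add: linear_0 linear_add linear_scale)
  ultimately have "slice_chart M {p \<in> points M. h p = k} d"
    using md(1) unfolding slice_chart_def max_chart_def by blast
  moreover have "p \<in> fst d" using mc(2) inv(3) by (simp add: d_def x0_def)
  ultimately show "\<exists>c. slice_chart M {p \<in> points M. h p = k} c \<and> p \<in> fst c" by blast
qed

section \<open>Level sets and quotients\<close>

lemma topology_eq_if_continuous_ident: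
  assumes XY: "continuous_map X Y (\<lambda>x. x)" and YX: "continuous_map Y X (\<lambda>x. x)"
  shows "X = Y"
proof -
  have half: "openin A U" if "continuous_map A B (\<lambda>x. x)" "continuous_map B A (\<lambda>x. x)" "openin B U"
    for A B :: "'a topology" and U
  proof -
    have "topspace B \<subseteq> topspace A" using that(2) by (auto simp: continuous_map_def)
    then have "{x \<in> topspace A. x \<in> U} = U" using openin_subset[OF that(3)] by blast
    then show ?thesis using openin_continuous_map_preimage[OF that(1,3)] by simp
  qed
  show ?thesis unfolding topology_eq using half XY YX by blast
qed

text \<open>The differential of \<open>h\<close> kills vectors tangent to the level. If it also
  killed \<open>X p\<close>, transversality would make it vanish on the whole tangent space,
  contradicting regularity.\<close>

lemma transverse_dfun_nonzero:
  assumes P: "premanifold P" and h: "smooth_rel P (points P) real_line h"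
    and S: "embedded_submanifold P {p \<in> points P. h p = k}" and reg: "regular_value P h k"
    and X: "vector_field P X" and tr: "transverse P X {p \<in> points P. h p = k}"
    and p: "p \<in> points P" "h p = k"
  shows "dfun P h p (X p) \<noteq> 0"
proof
  assume 0: "dfun P h p (X p) = 0"
  let ?L = "{p \<in> points P. h p = k}"
  let ?S = "submfd P ?L"
  let ?d = "some_chart P p"
  note pS = premanifold_submfd[OF P S]
  have pts: "points ?S = ?L" by (rule points_submfd) blast
  have incl: "smooth_rel ?S (points ?S) P (\<lambda>q. q)"
    unfolding pts by (rule smooth_rel_submfd_inclusion[OF P S])
  have pL: "p \<in> points ?S" unfolding pts using p by blast
  note cS = some_chart_at[OF pS pL] and dP = some_chart_at[OF P p(1)]
  note mS = charts_atD[OF pS cS] and mP = charts_atD[OF P dP]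
  obtain w where w: "w \<in> tangent_space P p" "dfun P h p w \<noteq> 0"
    using reg p unfolding regular_value_def by blast
  have "w \<in> {tcomb a (X p) 1 (tmap ?S P (\<lambda>q. q) p u) | a u. u \<in> tangent_space ?S p}"
    using tr w(1) p unfolding transverse_def by blast
  then obtain a u where u: "w = tcomb a (X p) 1 (tmap ?S P (\<lambda>q. q) p u)" "u \<in> tangent_space ?S p"
    by blast
  let ?t = "tmap ?S P (\<lambda>q. q) p u"
  have "?t ?d = ddir (\<lambda>x. snd ?d (chart_inv (some_chart ?S p) x)) (snd (some_chart ?S p) p) (u (some_chart ?S p))"
    by (rule tmap_component[where f = "\<lambda>q. q", OF dP])
  then have t: "?t ?d \<in> chart_space ?d"
    using ddir_rep_in_space[OF pS P incl mS mP tangent_spaceD(1)[OF u(2) cS]] by simp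
  have "X p \<in> tangent_space P p" using X p(1) unfolding vector_field_def by blast
  then have Xp: "X p ?d \<in> chart_space ?d" using dP by (rule tangent_spaceD(1))
  have "dfun P h p ?t = dfun ?S h p u"
    by (rule dfun_tmap[OF pS P incl h refl pL u(2)])
  also have "\<dots> = 0" by (rule dfun_eq_0[OF pS pL u(2), where k = k]) (simp add: pts)
  finally have "dfun P h p w = 0"
    unfolding u(1) using dfun_tcomb[where u = "X p" and v = "?t", OF P h p(1) Xp t, of a 1] 0
    by simp
  then show False using w(2) by simp
qed

text \<open>The group enters only through two facts: the projections agree on \<open>NS\<close>, and
  \<open>LQ\<close> pulls back to \<open>L\<close> along \<open>\<tau>\<close>.\<close>

lemma quotient_level_smooth:
  fixes P :: "('p, 'e::euclidean_space) mfd" and Q R :: "('b, 'f::euclidean_space) mfd"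
  assumes P: "premanifold P" and L: "embedded_submanifold P L"
    and NP: "embedded_submanifold P NP" and NS: "embedded_submanifold (submfd P L) NS" "NS = NP \<inter> L"
    and Q: "premanifold Q" and R: "premanifold R"
    and \<tau>: "submersion (submfd P NP) Q \<tau>" "\<tau> ` NP = points Q"
    and \<pi>: "submersion (submfd (submfd P L) NS) R \<pi>" "\<pi> ` NS = points R"
    and eq: "\<And>q. q \<in> NS \<Longrightarrow> \<pi> q = \<tau> q" and LQ: "\<And>p. p \<in> NP \<Longrightarrow> \<tau> p \<in> LQ \<longleftrightarrow> p \<in> L"
  shows "smooth_rel R (points R) Q (\<lambda>x. x)" "LQ \<subseteq> points Q \<Longrightarrow> smooth_rel Q LQ R (\<lambda>x. x)"
proof -
  let ?S = "submfd P L"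
  let ?MP = "submfd P NP" and ?MS = "submfd ?S NS"
  note S = premanifold_submfd[OF P L]
  note MP = premanifold_submfd[OF P NP] and MS = premanifold_submfd[OF S NS(1)]
  have pP: "points ?MP = NP" and pS: "points ?MS = NS"
    by (rule points_submfd[OF embedded_submanifold_subset[OF NP]],
        rule points_submfd[OF embedded_submanifold_subset[OF NS(1)]])
  have \<tau>s: "smooth_rel ?MP NP Q \<tau>"
    using smooth_map_imp_smooth_rel[OF MP Q] \<tau>(1) unfolding submersion_def pP by blast
  have \<pi>s: "smooth_rel ?MS NS R \<pi>"
    using smooth_map_imp_smooth_rel[OF MS R] \<pi>(1) unfolding submersion_def pS by blast
  note iP = smooth_rel_submfd_inclusion[OF P NP] and iS = smooth_rel_submfd_inclusion[OF S NS(1)]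
    and iL = smooth_rel_submfd_inclusion[OF P L]
  show "smooth_rel R (points R) Q (\<lambda>x. x)"
  proof (rule smooth_rel_local)
    fix x assume "x \<in> points R"
    then obtain q where q: "q \<in> points ?MS" "x = \<pi> q" using \<pi>(2) unfolding pS by blast
    obtain V \<rho> where V: "openin (mtop R) V" "\<pi> q \<in> V" "smooth_rel R V ?MS \<rho>"
      and sec: "\<And>y. y \<in> V \<Longrightarrow> \<pi> (\<rho> y) = y"
      by (rule submersion_local_section[OF MS R \<pi>(1) q(1)]) blast
    have \<rho>: "\<rho> ` V \<subseteq> NS" using smooth_rel_points(2)[OF V(3)] pS by simp
    then have \<rho>': "\<rho> ` V \<subseteq> L" "\<rho> ` V \<subseteq> NP" unfolding NS(2) by auto
    \<comment> \<open>\<open>NS\<close> is given as a submanifold of \<open>S\<close>, so the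
      section is carried out through \<open>S\<close> to \<open>P\<close> and only then into
      \<open>NP\<close>.\<close>
    have "smooth_rel R V ?S \<rho>" by (rule smooth_rel_compose[OF R MS V(3) iS \<rho>])
    then have "smooth_rel R V P \<rho>" by (rule smooth_rel_compose[OF R S _ iL \<rho>'(1)])
    then have "smooth_rel R V ?MP \<rho>" by (rule smooth_rel_into_submfd[OF R P NP _ \<rho>'(2)])
    then have "smooth_rel R V Q (\<lambda>y. \<tau> (\<rho> y))" by (rule smooth_rel_compose[OF R MP _ \<tau>s \<rho>'(2)])
    then have "smooth_rel R (points R \<inter> V) Q (\<lambda>x. x)"
    proof (rule smooth_rel_cong_subset)
      fix y assume "y \<in> points R \<inter> V"
      then have "y \<in> V" by blast
      then have "\<rho> y \<in> NS" using \<rho> by blast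
      then show "\<tau> (\<rho> y) = y" using eq sec[OF \<open>y \<in> V\<close>] by simp
    qed blast
    then show "\<exists>V. openin (mtop R) V \<and> x \<in> V \<and> smooth_rel R (points R \<inter> V) Q (\<lambda>x. x)"
      using V(1,2) q(2) by blast
  qed
  assume LQ_sub: "LQ \<subseteq> points Q"
  show "smooth_rel Q LQ R (\<lambda>x. x)"
  proof (rule smooth_rel_local)
    fix x assume "x \<in> LQ"
    then obtain p where p: "p \<in> points ?MP" "x = \<tau> p" using \<tau>(2) LQ_sub unfolding pP by blast
    obtain V \<sigma> where V: "openin (mtop Q) V" "\<tau> p \<in> V" "smooth_rel Q V ?MP \<sigma>"
      and sec: "\<And>y. y \<in> V \<Longrightarrow> \<tau> (\<sigma> y) = y"
      by (rule submersion_local_section[OF MP Q \<tau>(1) p(1)]) blast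
    have \<sigma>: "\<sigma> ` V \<subseteq> NP" using smooth_rel_points(2)[OF V(3)] pP by simp
    \<comment> \<open>Since \<open>\<tau> (\<sigma> y) = y\<close>, the lift of a point of
      \<open>LQ\<close> lies in \<open>L\<close>. Off \<open>LQ\<close> the section leaves
      \<open>NS\<close>, so \<open>\<pi>\<close> can be applied only over
      \<open>LQ \<inter> V\<close>.\<close>
    have \<sigma>L: "\<sigma> ` (LQ \<inter> V) \<subseteq> L"
    proof
      fix r assume "r \<in> \<sigma> ` (LQ \<inter> V)"
      then obtain y where y: "y \<in> LQ" "y \<in> V" "r = \<sigma> y" by blast
      then have "r \<in> NP" using \<sigma> by blast
      then show "r \<in> L" using LQ[of r] sec[OF y(2)] y by simp
    qed
    have \<sigma>S: "\<sigma> ` (LQ \<inter> V) \<subseteq> NS" using \<sigma> \<sigma>L unfolding NS(2) by blast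
    have "smooth_rel Q V P \<sigma>" by (rule smooth_rel_compose[OF Q MP V(3) iP \<sigma>])
    then have "smooth_rel Q (LQ \<inter> V) P \<sigma>" by (rule smooth_rel_subset) blast
    then have "smooth_rel Q (LQ \<inter> V) ?S \<sigma>" by (rule smooth_rel_into_submfd[OF Q P L _ \<sigma>L])
    then have "smooth_rel Q (LQ \<inter> V) ?MS \<sigma>" by (rule smooth_rel_into_submfd[OF Q S NS(1) _ \<sigma>S])
    then have "smooth_rel Q (LQ \<inter> V) R (\<lambda>y. \<pi> (\<sigma> y))" by (rule smooth_rel_compose[OF Q MS _ \<pi>s \<sigma>S])
    then have "smooth_rel Q (LQ \<inter> V) R (\<lambda>x. x)"
    proof (rule smooth_rel_cong_subset)
      fix y assume y: "y \<in> LQ \<inter> V"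
      then have "\<sigma> y \<in> NS" using \<sigma>S by blast
      then show "\<pi> (\<sigma> y) = y" using eq sec y by simp
    qed blast
    then show "\<exists>V. openin (mtop Q) V \<and> x \<in> V \<and> smooth_rel Q (LQ \<inter> V) R (\<lambda>x. x)"
      using V(1,2) p(2) by blast
  qed
qed

text \<open>Both identity maps are continuous, hence the two topologies are equal, and the level set
  inherits the Hausdorff property and paracompactness from \<open>R\<close>.\<close>

lemma diffeomorphism_submfd_ident:
  assumes Q: "premanifold Q" and R: "smooth_manifold R" and L: "embedded_submanifold Q (points R)"
    and RQ: "smooth_rel R (points R) Q (\<lambda>x. x)" and QR: "smooth_rel Q (points R) R (\<lambda>x. x)"
    and f: "\<And>x. x \<in> points R \<Longrightarrow> f x = x"
  shows "diffeomorphism (submfd Q (points R)) R f"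
proof -
  let ?S = "submfd Q (points R)"
  have pR: "premanifold R" using R by (simp add: smooth_manifold_iff_premanifold)
  note S = premanifold_submfd[OF Q L]
  have pts: "points ?S = points R" by (rule points_submfd[OF embedded_submanifold_subset[OF L]])
  have RS: "smooth_rel R (points R) ?S (\<lambda>x. x)"
    by (rule smooth_rel_into_submfd[OF pR Q L RQ]) simp
  have SR: "smooth_rel ?S (points ?S) R (\<lambda>x. x)"
    unfolding pts by (rule smooth_rel_compose[OF S Q smooth_rel_submfd_inclusion[OF Q L] QR]) simp
  have top: "mtop ?S = mtop R"
    using smooth_rel_continuous_map[OF SR] smooth_rel_continuous_map[OF RS]
    by (intro topology_eq_if_continuous_ident) (simp_all del: pts)
  have "smooth_manifold ?S"
    using R S unfolding smooth_manifold_iff_premanifold top by blast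
  moreover have "smooth_map ?S R f"
    by (rule smooth_rel_imp_smooth_map[OF S pR smooth_rel_cong_subset[OF SR subset_refl]])
      (simp add: pts f)
  moreover have "smooth_map R ?S (\<lambda>x. x)" by (rule smooth_rel_imp_smooth_map[OF pR S RS])
  ultimately show ?thesis unfolding diffeomorphism_def pts using R f by auto
qed

text \<open>The identity back from the subset \<open>points R\<close> of \<open>Q\<close> is a
  smooth left inverse; it gives injective differentials and a continuous inverse on the
  image.\<close>

lemma smooth_embedding_ident:
  assumes Q: "premanifold Q" and R: "premanifold R"
    and RQ: "smooth_rel R (points R) Q (\<lambda>x. x)" and QR: "smooth_rel Q (points R) R (\<lambda>x. x)"
    and f: "\<And>x. x \<in> points R \<Longrightarrow> f x = x"
  shows "smooth_embedding R Q f"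
proof -
  have fRQ: "smooth_rel R (points R) Q f"
    by (rule smooth_rel_cong_subset[OF RQ subset_refl]) (simp add: f)
  have im: "f ` points R = points R" using f by force
  have "inj_on (tmap R Q f p) (tangent_space R p)" if "p \<in> points R" for p
    by (rule inj_on_tmap_left_inverse[OF R Q fRQ QR _ _ that]) (use im f in auto)
  moreover have "smooth_map R Q f" by (rule smooth_rel_imp_smooth_map[OF R Q fRQ])
  moreover have "embedding_map (mtop R) (mtop Q) f"
  proof -
    have "points R \<subseteq> points Q" by (rule smooth_rel_points(1)[OF QR])
    moreover have "continuous_map (mtop R) (mtop Q) f" using smooth_rel_continuous_map[OF fRQ] by simp
    ultimately have "homeomorphic_maps (mtop R) (subtopology (mtop Q) (points R)) f (\<lambda>x. x)"
      using smooth_rel_continuous_map[OF QR] f im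
      by (auto simp: homeomorphic_maps_def continuous_map_in_subtopology)
    then show ?thesis unfolding embedding_map_def im by (rule homeomorphic_maps_imp_map)
  qed
  ultimately show ?thesis unfolding smooth_embedding_def immersion_def by blast
qed

lemma orbit_proj_cong:
  assumes "\<And>g. g \<in> K \<Longrightarrow> \<Phi> g q = \<Psi> g q"
  shows "orbit_proj G K \<Phi> q = orbit_proj G K \<Psi> q"
  using assms unfolding orbit_proj_def orbit_def by force

text \<open>The conjuncts before the last justify the notions in it: a submanifold structure on
  \<open>S\<mu>\<close>, a well-defined embedding \<open>iM\<close>, and a unique
  \<open>\<kappa>\<close>. Uniqueness is stated in \<open>\<rightarrow>\<^sub>E\<close>, which fixes
  the values off \<open>points S\<mu>\<close>; the last conjunct admits any values there.\<close>

theorem theorem5p1: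
  fixes G :: "'g monoid" and MG :: "('g, 'k::euclidean_space) mfd"
    and P :: "('p, 'e::euclidean_space) mfd"
    and \<theta> :: "('p, 'e) form1" and nabla :: "'p \<Rightarrow> ('p, 'e) tvec" and h :: "'p \<Rightarrow> real"
    and \<Phi> :: "'g \<Rightarrow> 'p \<Rightarrow> 'p" and J :: "'p \<Rightarrow> ('g, 'k) tvec \<Rightarrow> real"
    and c :: real and i :: "'p \<Rightarrow> 'p"
    and S :: "('p, 'e) mfd" and \<eta> :: "('p, 'e) form1"
    and \<Phi>S :: "'g \<Rightarrow> 'p \<Rightarrow> 'p" and JS :: "'p \<Rightarrow> ('g, 'k) tvec \<Rightarrow> real"
    and \<mu> :: "('g, 'k) tvec \<Rightarrow> real"
    and MK :: "('g, 'k) mfd" and K :: "'g set" and NP NS :: "'p set"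
    and \<tau> \<pi> :: "'p \<Rightarrow> 'p set"
    and P\<mu> M\<mu> S\<mu> :: "('p set, 'e) mfd"
    and \<theta>\<mu> :: "('p set, 'e) form1" and nabla\<mu> :: "'p set \<Rightarrow> ('p set, 'e) tvec"
    and h\<mu> :: "'p set \<Rightarrow> real"
    and j iM :: "'p set \<Rightarrow> 'p set"
  assumes "Lie_group G MG" and "connected_space (mtop MG)"
    and "exact_symplectic_Hamiltonian_system P \<theta> nabla h" and "connected_space (mtop P)"
    and "form_preserving_action G MG P \<theta> \<Phi>"
    and "\<forall>g\<in>carrier G. \<forall>p\<in>points P. h (\<Phi> g p) = h p"
    and "momentum_map G MG P \<theta> \<Phi> J"
    and "regular_value P h c" and "transverse P nabla {p \<in> points P. h p = c}"
    \<comment> \<open>energy hypersurface with the induced contact action and contact momentum map\<close>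
    and "i = (\<lambda>q. q)" and "energy_hypersurface P \<theta> h c S \<eta>"
    and "form_preserving_action G MG S \<eta> \<Phi>S"
    and "\<forall>g\<in>carrier G. \<forall>q\<in>points S. \<Phi> g (i q) = i (\<Phi>S g q)"
    and "momentum_map G MG S \<eta> \<Phi>S JS" and "\<forall>q\<in>points S. JS q = J (i q)"
    and "\<mu> \<in> Lie_dual G MG"
    and "regular_momentum_value G MG P J \<mu>" and "regular_momentum_value G MG S JS \<mu>"
    \<comment> \<open>the momentum level sets and the group \<open>K\<^sub>[\<^sub>\<mu>\<^sub>]\<close>\<close>
    and "NP = momentum_level P J \<mu>" and "embedded_submanifold P NP"
    and "NS = momentum_level S JS \<mu>" and "embedded_submanifold S NS"
    and "connected_Lie_subgroup G MG MK (k_alg G MG \<mu>)" and "K = points MK"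
    and "quotientable G K \<Phi> (submfd P NP)" and "quotientable G K \<Phi>S (submfd S NS)"
    \<comment> \<open>the two quotients and the reduced system\<close>
    and "\<tau> = orbit_proj G K \<Phi>" and "orbit_manifold G K \<Phi> (submfd P NP) P\<mu>"
    and "\<pi> = orbit_proj G K \<Phi>S" and "orbit_manifold G K \<Phi>S (submfd S NS) M\<mu>"
    and "reduced_system P \<theta> nabla h NP \<tau> P\<mu> \<theta>\<mu> nabla\<mu> h\<mu>"
    and "S\<mu> = submfd P\<mu> {x \<in> points P\<mu>. h\<mu> x = c}" and "j = (\<lambda>x. x)"
    and "iM = induced_orbit_map NS \<pi> \<tau> i"
  shows "embedded_submanifold P\<mu> {x \<in> points P\<mu>. h\<mu> x = c} \<and>
    (\<forall>q\<in>NS. iM (\<pi> q) = \<tau> (i q)) \<and> smooth_embedding M\<mu> P\<mu> iM \<and>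
    (\<exists>!\<kappa>. \<kappa> \<in> points S\<mu> \<rightarrow>\<^sub>E points M\<mu> \<and> (\<forall>x\<in>points S\<mu>. iM (\<kappa> x) = j x)) \<and>
    (\<forall>\<kappa>. \<kappa> \<in> points S\<mu> \<rightarrow> points M\<mu> \<and> (\<forall>x\<in>points S\<mu>. iM (\<kappa> x) = j x)
       \<longrightarrow> diffeomorphism S\<mu> M\<mu> \<kappa>)"
proof -
  let ?L = "{p \<in> points P. h p = c}" and ?LQ = "{x \<in> points P\<mu>. h\<mu> x = c}"
  note S_hyp = assms(11) and reg = assms(8) and trans = assms(9)
    and emb_P = assms(20) and emb_S = assms(22) and quot_P = assms(28) and quot_S = assms(30)
    and red = assms(31)
  have P: "premanifold P" and h: "smooth_rel P (points P) real_line h" and nabla: "vector_field P nabla"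
  proof -
    show P: "premanifold P"
      using assms(3) unfolding exact_symplectic_Hamiltonian_system_def exact_symplectic_manifold_def
        smooth_manifold_iff_premanifold by blast
    show "smooth_rel P (points P) real_line h"
      using assms(3) unfolding exact_symplectic_Hamiltonian_system_def
      by (intro smooth_map_imp_smooth_rel[OF P premanifold_real_line]) blast
    show "vector_field P nabla"
      using assms(3) unfolding exact_symplectic_Hamiltonian_system_def Liouville_field_def by blast
  qed
  have embL: "embedded_submanifold P ?L" by (rule embedded_level_set[OF P h reg])
  have S: "S = submfd P ?L" using S_hyp unfolding energy_hypersurface_def by blast
  have pS: "points S = ?L" unfolding S by (rule points_submfd) blast
  have Q: "premanifold P\<mu>" and subm_\<tau>: "submersion (submfd P NP) P\<mu> \<tau>"
    and R: "smooth_manifold M\<mu>" and subm_\<pi>: "submersion (submfd S NS) M\<mu> \<pi>"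
    using quot_P quot_S unfolding orbit_manifold_def assms(27,29) smooth_manifold_iff_premanifold
    by blast+
  have pR: "premanifold M\<mu>" using R unfolding smooth_manifold_iff_premanifold by blast
  have pNP: "points (submfd P NP) = NP" and pNS: "points (submfd S NS) = NS"
    by (rule points_submfd[OF embedded_submanifold_subset[OF emb_P]],
        rule points_submfd[OF embedded_submanifold_subset[OF emb_S]])
  have im_\<tau>: "\<tau> ` NP = points P\<mu>" and im_\<pi>: "\<pi> ` NS = points M\<mu>"
  proof -
    have "quotient_map (mtop (submfd P NP)) (mtop P\<mu>) \<tau>" "quotient_map (mtop (submfd S NS)) (mtop M\<mu>) \<pi>"
      using quot_P quot_S unfolding orbit_manifold_def assms(27,29) by blast+
    then show "\<tau> ` NP = points P\<mu>" "\<pi> ` NS = points M\<mu>"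
      using quotient_imp_surjective_map pNP pNS by force+
  qed
  have NS: "NS = NP \<inter> ?L"
    unfolding assms(19,21) momentum_level_def using assms(15) unfolding pS assms(10) by auto
  have K: "K \<subseteq> carrier G"
    using assms(23) subgroup.subset unfolding connected_Lie_subgroup_def assms(24) by blast
  \<comment> \<open>Points of the quotients are orbits as sets. The two actions agree on
    \<open>S\<close>, so both projections yield literally the same set.\<close>
  have \<pi>\<tau>: "\<pi> q = \<tau> q" if "q \<in> NS" for q
  proof -
    have "q \<in> points S" using that unfolding pS NS by blast
    then have "\<Phi>S g q = \<Phi> g q" if "g \<in> K" for g
      using assms(13) that K unfolding assms(10) by auto
    then show ?thesis unfolding assms(27,29) by (rule orbit_proj_cong)
  qed
  have hQ: "smooth_rel P\<mu> (points P\<mu>) real_line h\<mu>"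
    using red unfolding reduced_system_def exact_symplectic_Hamiltonian_system_def
    by (intro smooth_map_imp_smooth_rel[OF Q premanifold_real_line]) blast
  have h\<tau>: "h\<mu> (\<tau> p) = h p" if "p \<in> NP" for p
    using red that unfolding reduced_system_def by blast
  note MP = premanifold_submfd[OF P emb_P]
  have \<tau>s: "smooth_rel (submfd P NP) (points (submfd P NP)) P\<mu> \<tau>"
    using subm_\<tau> unfolding submersion_def by (intro smooth_map_imp_smooth_rel[OF MP Q]) blast
  have incl: "smooth_rel (submfd P NP) (points (submfd P NP)) P (\<lambda>q. q)"
    unfolding pNP by (rule smooth_rel_submfd_inclusion[OF P emb_P])
  have "regular_value P\<mu> h\<mu> c"
    unfolding regular_value_def
  proof (intro ballI impI)
    fix x assume "x \<in> points P\<mu>" and hx: "h\<mu> x = c"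
    then obtain p where p: "p \<in> NP" "x = \<tau> p" using im_\<tau> by blast
    have pP: "p \<in> points P" using p(1) embedded_submanifold_subset[OF emb_P] by blast
    have hp: "h p = c" using h\<tau>[OF p(1)] hx p(2) by simp
    have pMP: "p \<in> points (submfd P NP)" unfolding pNP by (rule p(1))
    \<comment> \<open>Tangency of \<open>nabla\<close> to the momentum level, part of the reduced
      system: \<open>v\<close> on \<open>NP\<close> represents \<open>nabla p\<close> and can also
      be pushed down by \<open>\<tau>\<close>, so both differentials are compared with that of
      \<open>h\<close> on \<open>NP\<close>.\<close>
    obtain v where v: "v \<in> tangent_space (submfd P NP) p"
      "tmap (submfd P NP) P (\<lambda>q. q) p v = nabla p"
      using red p(1) unfolding reduced_system_def by blast
    have "dfun P\<mu> h\<mu> (\<tau> p) (tmap (submfd P NP) P\<mu> \<tau> p v) = dfun (submfd P NP) h p v"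
      by (rule dfun_tmap[OF MP Q \<tau>s hQ _ pMP v(1)]) (simp add: pNP h\<tau>)
    also have "\<dots> = dfun P h p (tmap (submfd P NP) P (\<lambda>q. q) p v)"
      by (rule dfun_tmap[symmetric, OF MP P incl h refl pMP v(1)])
    also have "\<dots> \<noteq> 0"
      unfolding v(2) by (rule transverse_dfun_nonzero[OF P h embL reg nabla trans pP hp])
    finally have "dfun P\<mu> h\<mu> x (tmap (submfd P NP) P\<mu> \<tau> p v) \<noteq> 0" unfolding p(2) .
    moreover have "tmap (submfd P NP) P\<mu> \<tau> p v \<in> tangent_space P\<mu> x"
      using subm_\<tau> pMP v(1) unfolding submersion_def p(2) by blast
    ultimately show "\<exists>v\<in>tangent_space P\<mu> x. dfun P\<mu> h\<mu> x v \<noteq> 0" by blast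
  qed
  then have embQ: "embedded_submanifold P\<mu> ?LQ" by (rule embedded_level_set[OF Q hQ])
  have LQ_iff: "\<tau> p \<in> ?LQ \<longleftrightarrow> p \<in> ?L" if p: "p \<in> NP" for p
  proof -
    have "\<tau> p \<in> points P\<mu>" unfolding im_\<tau>[symmetric] using p by (rule imageI)
    moreover have "p \<in> points P" using embedded_submanifold_subset[OF emb_P] p by (rule subsetD)
    ultimately show ?thesis using h\<tau>[OF p] by simp
  qed
  have LQ: "?LQ = points M\<mu>"
  proof
    show "?LQ \<subseteq> points M\<mu>"
    proof
      fix x assume x: "x \<in> ?LQ"
      then obtain p where p: "p \<in> NP" "x = \<tau> p" using im_\<tau> by blast
      have "p \<in> ?L" using LQ_iff[OF p(1)] x unfolding p(2) by (rule iffD1)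
      then have "p \<in> NS" unfolding NS using p(1) by (rule IntI[rotated])
      then show "x \<in> points M\<mu>"
        unfolding im_\<pi>[symmetric] p(2) using \<pi>\<tau>[symmetric] by (intro image_eqI)
    qed
    show "points M\<mu> \<subseteq> ?LQ"
    proof
      fix x assume "x \<in> points M\<mu>"
      then obtain q where q: "q \<in> NS" "x = \<pi> q" using im_\<pi> by blast
      then have "q \<in> NP" "q \<in> ?L" unfolding NS by auto
      then show "x \<in> ?LQ" using LQ_iff[of q] \<pi>\<tau>[OF q(1)] q(2) by simp
    qed
  qed
  note sm = quotient_level_smooth[OF P embL emb_P emb_S[unfolded S] NS Q pR subm_\<tau> im_\<tau>
      subm_\<pi>[unfolded S] im_\<pi> \<pi>\<tau> LQ_iff]
  have RQ: "smooth_rel M\<mu> (points M\<mu>) P\<mu> (\<lambda>x. x)" by (rule sm(1))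
  have QR: "smooth_rel P\<mu> (points M\<mu>) M\<mu> (\<lambda>x. x)" using sm(2) unfolding LQ[symmetric] by blast
  have iM: "iM (\<pi> q) = \<pi> q" if q: "q \<in> NS" for q
  proof -
    \<comment> \<open>\<open>iM\<close> uses an unspecified representative \<open>r\<close> of the
      orbit; in any case \<open>\<tau> r = \<pi> r = \<pi> q\<close>.\<close>
    have "(SOME r. r \<in> NS \<and> \<pi> r = \<pi> q) \<in> NS \<and> \<pi> (SOME r. r \<in> NS \<and> \<pi> r = \<pi> q) = \<pi> q"
      by (rule someI[of _ q]) (use q in simp)
    then show ?thesis
      unfolding assms(34) induced_orbit_map_def assms(10) using \<pi>\<tau> by metis
  qed
  have iM_id: "iM x = x" if "x \<in> points M\<mu>" for x
    using that iM unfolding im_\<pi>[symmetric] by blast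
  have pS\<mu>: "points S\<mu> = points M\<mu>"
    unfolding assms(32) LQ by (rule points_submfd) (use smooth_rel_points(1)[OF QR] in blast)
  have \<kappa>_iff: "(\<forall>x\<in>points S\<mu>. iM (\<kappa> x) = j x) \<longleftrightarrow> (\<forall>x\<in>points M\<mu>. \<kappa> x = x)"
    if "\<kappa> \<in> points S\<mu> \<rightarrow> points M\<mu>" for \<kappa>
    using that iM_id unfolding pS\<mu> assms(33) by (auto simp: Pi_iff)
  show ?thesis
  proof (intro conjI ballI allI impI)
    show "embedded_submanifold P\<mu> ?LQ" by (rule embQ)
    show "iM (\<pi> q) = \<tau> (i q)" if "q \<in> NS" for q
      using iM[OF that] \<pi>\<tau>[OF that] unfolding assms(10) by simp
    show "smooth_embedding M\<mu> P\<mu> iM" by (rule smooth_embedding_ident[OF Q pR RQ QR iM_id])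
    show "\<exists>!\<kappa>. \<kappa> \<in> points S\<mu> \<rightarrow>\<^sub>E points M\<mu> \<and> (\<forall>x\<in>points S\<mu>. iM (\<kappa> x) = j x)"
    proof (rule ex1I[of _ "restrict (\<lambda>x. x) (points M\<mu>)"])
      show "restrict (\<lambda>x. x) (points M\<mu>) \<in> points S\<mu> \<rightarrow>\<^sub>E points M\<mu> \<and>
          (\<forall>x\<in>points S\<mu>. iM (restrict (\<lambda>x. x) (points M\<mu>) x) = j x)"
        unfolding pS\<mu> assms(33) by (simp add: iM_id)
      fix \<kappa> assume \<kappa>: "\<kappa> \<in> points S\<mu> \<rightarrow>\<^sub>E points M\<mu> \<and> (\<forall>x\<in>points S\<mu>. iM (\<kappa> x) = j x)"
      then have "\<kappa> \<in> points S\<mu> \<rightarrow> points M\<mu>" by (simp add: PiE_def)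
      then have "\<forall>x\<in>points M\<mu>. \<kappa> x = x" using \<kappa>_iff \<kappa> by blast
      moreover have "\<kappa> \<in> extensional (points M\<mu>)" using \<kappa> unfolding pS\<mu> PiE_def by blast
      ultimately show "\<kappa> = restrict (\<lambda>x. x) (points M\<mu>)"
        by (intro extensionalityI[of _ "points M\<mu>"]) simp_all
    qed
    fix \<kappa> assume \<kappa>: "\<kappa> \<in> points S\<mu> \<rightarrow> points M\<mu> \<and> (\<forall>x\<in>points S\<mu>. iM (\<kappa> x) = j x)"
    then have "\<kappa> x = x" if "x \<in> points M\<mu>" for x using \<kappa>_iff[of \<kappa>] that by blast
    then show "diffeomorphism S\<mu> M\<mu> \<kappa>"
      unfolding assms(32) LQ
      by (rule diffeomorphism_submfd_ident[OF Q R embQ[unfolded LQ] RQ QR])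
  qed
qed

end
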